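(* Let $A$ be a finite-dimensional formally real Jordan algebra with unit $u$, let $A_+^\circ$ be the interior of its cone of squares, let $PA_+^\circ=\{x\in A_+^\circ:\det x=1\}$ and $T_u=\{w\in A:\mathrm{tr}\,w=0\}$. (a) The exponential map $\exp_u\colon A\to A_+^\circ$, $x\mapsto e^x$, extends to a homeomorphism from the horofunction compactification of the normed space $(A,\|\cdot\|_u)$ onto the horofunction compactification of $(A_+^\circ,d_T)$, such that each part of the horofunction boundary of $(A,\|\cdot\|_u)$ is mapped onto a part of the horofunction boundary of $(A_+^\circ,d_T)$. (b) The exponential map $\exp_u\colon T_u\to PA_+^\circ$, $x\mapsto e^x$, extends to a homeomorphism from the horofunction compactification of the normed space $(T_u,|\cdot|_u)$ onto the horofunction compactification of $(PA_+^\circ,d_H)$, such that each part of the horofunction boundary of $(T_u,|\cdot|_u)$ is mapped onto a part of the horofunction boundary of $(PA_+^\circ,d_H)$.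
   Context: A finite-dimensional formally real Jordan algebra is a finite-dimensional real vector space $A$ with a commutative bilinear product $\bullet$ satisfying $x^2\bullet(x\bullet y)=x\bullet(x^2\bullet y)$ and such that $x^2+y^2=0$ implies $x=y=0$; $u$ is its unit. $A_+=\{x^2:x\in A\}$, $A_+^\circ$ is its interior, and $x\le y$ means $y-x\in A_+$. Every $x\in A$ has a spectral decomposition $x=\sum_{i=1}^r\lambda_ip_i$ with $p_1,\dots,p_r$ a Jordan frame (mutually orthogonal primitive idempotents summing to $u$); $\sigma(x)=\{\lambda_i\}$, $\mathrm{tr}\,x=\sum_i\lambda_i$, $\det x=\prod_i\lambda_i$, and $e^x=\sum_i e^{\lambda_i}p_i$. The spectral norm is $\|x\|_u=\max\{|\lambda|:\lambda\in\sigma(x)\}$ and the variation norm on $T_u$ is $|w|_u=\max\sigma(w)-\min\sigma(w)$. For $x\in A$ and $y\in A_+^\circ$ let $M(x/y)=\inf\{\beta\in\mathbb{R}:x\le\beta y\}$. The Thompson distance on $A_+^\circ$ is $d_T(x,y)=\max\{\log M(x/y),\log M(y/x)\}$ and the Hilbert distance on $PA_+^\circ$ is $d_H(x,y)=\log M(x/y)+\log M(y/x)$. Horofunction compactification: for a metric space $(M,d)$ with basepoint $b$ (here $b=0$ for the normed spaces and $b=u$ for $A_+^\circ$ and $PA_+^\circ$), let $h_y(z)=d(z,y)-d(b,y)$ for $y,z\in M$; the horofunction compactification $\overline{M}^h$ is the closure of $\{h_y:y\in M\}$ in $\mathbb{R}^M$ with the topology of pointwise convergence, the point $y\in M$ being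 identified with $h_y$; its horofunction boundary is $\overline{M}^h\setminus\{h_y:y\in M\}$, whose elements are horofunctions. For horofunctions $h,h'$ the detour cost is $H(h,h')=\sup_{W}\inf\{d(b,x)+h'(x): x\in M, h_x\in W\}$, the supremum over neighbourhoods $W$ of $h$ in $\overline{M}^h$, and the detour distance is $\delta(h,h')=H(h,h')+H(h',h)$. Parts of the horofunction boundary are the equivalence classes of horofunctions under $h\equiv h'$ iff $\delta(h,h')<\infty$ (in all four spaces here every horofunction is a Busemann point, i.e. a limit of an almost geodesic, and $\delta$ is a possibly infinite metric on them). *)

theory Defs
  imports "HOL-Analysis.Analysis"
begin

definition formally_real_jordan :: "('a::euclidean_space \<Rightarrow> 'a \<Rightarrow> 'a) \<Rightarrow> 'a \<Rightarrow> bool" where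
  "formally_real_jordan m u \<longleftrightarrow>
     bilinear m \<and>
     (\<forall>x y. m x y = m y x) \<and>
     (\<forall>x y. m (m x x) (m x y) = m x (m (m x x) y)) \<and>
     (\<forall>x y. m x x + m y y = 0 \<longrightarrow> x = 0 \<and> y = 0) \<and>
     (\<forall>x. m u x = x)"

definition idempotent :: "('a::real_vector \<Rightarrow> 'a \<Rightarrow> 'a) \<Rightarrow> 'a \<Rightarrow> bool" where
  "idempotent m p \<longleftrightarrow> m p p = p"

definition primitive_idempotent :: "('a::real_vector \<Rightarrow> 'a \<Rightarrow> 'a) \<Rightarrow> 'a \<Rightarrow> bool" where
  "primitive_idempotent m p \<longleftrightarrow> idempotent m p \<and> p \<noteq> 0 \<and>
     \<not> (\<exists>q r. idempotent m q \<and> idempotent m r \<and> q \<noteq> 0 \<and> r \<noteq> 0 \<and> m q r = 0 \<and> p = q + r)"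

definition jordan_frame :: "('a::real_vector \<Rightarrow> 'a \<Rightarrow> 'a) \<Rightarrow> 'a \<Rightarrow> nat \<Rightarrow> (nat \<Rightarrow> 'a) \<Rightarrow> bool" where
  "jordan_frame m u r p \<longleftrightarrow>
     (\<forall>i<r. primitive_idempotent m (p i)) \<and>
     (\<forall>i<r. \<forall>j<r. i \<noteq> j \<longrightarrow> m (p i) (p j) = 0) \<and>
     (\<Sum>i<r. p i) = u"

definition spectral_decomp ::
    "('a::real_vector \<Rightarrow> 'a \<Rightarrow> 'a) \<Rightarrow> 'a \<Rightarrow> 'a \<Rightarrow> nat \<Rightarrow> (nat \<Rightarrow> 'a) \<Rightarrow> (nat \<Rightarrow> real) \<Rightarrow> bool" where
  "spectral_decomp m u x r p l \<longleftrightarrow> jordan_frame m u r p \<and> x = (\<Sum>i<r. l i *\<^sub>R p i)"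

definition jspectrum :: "('a::real_vector \<Rightarrow> 'a \<Rightarrow> 'a) \<Rightarrow> 'a \<Rightarrow> 'a \<Rightarrow> real set" where
  "jspectrum m u x = {c. \<exists>r p l. spectral_decomp m u x r p l \<and> (\<exists>i<r. l i = c)}"

definition jtrace :: "('a::real_vector \<Rightarrow> 'a \<Rightarrow> 'a) \<Rightarrow> 'a \<Rightarrow> 'a \<Rightarrow> real" where
  "jtrace m u x = (SOME t. \<exists>r p l. spectral_decomp m u x r p l \<and> t = (\<Sum>i<r. l i))"

definition jdet :: "('a::real_vector \<Rightarrow> 'a \<Rightarrow> 'a) \<Rightarrow> 'a \<Rightarrow> 'a \<Rightarrow> real" where
  "jdet m u x = (SOME t. \<exists>r p l. spectral_decomp m u x r p l \<and> t = (\<Prod>i<r. l i))"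

definition jexp :: "('a::real_vector \<Rightarrow> 'a \<Rightarrow> 'a) \<Rightarrow> 'a \<Rightarrow> 'a \<Rightarrow> 'a" where
  "jexp m u x = (SOME y. \<exists>r p l. spectral_decomp m u x r p l \<and> y = (\<Sum>i<r. exp (l i) *\<^sub>R p i))"

definition spec_norm :: "('a::real_vector \<Rightarrow> 'a \<Rightarrow> 'a) \<Rightarrow> 'a \<Rightarrow> 'a \<Rightarrow> real" where
  "spec_norm m u x = Max (abs ` jspectrum m u x)"

definition var_norm :: "('a::real_vector \<Rightarrow> 'a \<Rightarrow> 'a) \<Rightarrow> 'a \<Rightarrow> 'a \<Rightarrow> real" where
  "var_norm m u w = Max (jspectrum m u w) - Min (jspectrum m u w)"

definition tangent_space :: "('a::real_vector \<Rightarrow> 'a \<Rightarrow> 'a) \<Rightarrow> 'a \<Rightarrow> 'a set" where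
  "tangent_space m u = {w. jtrace m u w = 0}"

definition jcone :: "('a::real_vector \<Rightarrow> 'a \<Rightarrow> 'a) \<Rightarrow> 'a set" where
  "jcone m = range (\<lambda>x. m x x)"

definition jcone_int :: "('a::real_normed_vector \<Rightarrow> 'a \<Rightarrow> 'a) \<Rightarrow> 'a set" where
  "jcone_int m = interior (jcone m)"

definition proj_cone_int :: "('a::real_normed_vector \<Rightarrow> 'a \<Rightarrow> 'a) \<Rightarrow> 'a \<Rightarrow> 'a set" where
  "proj_cone_int m u = {x \<in> jcone_int m. jdet m u x = 1}"

definition jle :: "('a::real_vector \<Rightarrow> 'a \<Rightarrow> 'a) \<Rightarrow> 'a \<Rightarrow> 'a \<Rightarrow> bool" where
  "jle m x y \<longleftrightarrow> y - x \<in> jcone m"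

definition Mfun :: "('a::real_vector \<Rightarrow> 'a \<Rightarrow> 'a) \<Rightarrow> 'a \<Rightarrow> 'a \<Rightarrow> real" where
  "Mfun m x y = Inf {\<beta>. jle m x (\<beta> *\<^sub>R y)}"

definition thompson_dist :: "('a::real_vector \<Rightarrow> 'a \<Rightarrow> 'a) \<Rightarrow> 'a \<Rightarrow> 'a \<Rightarrow> real" where
  "thompson_dist m x y = max (ln (Mfun m x y)) (ln (Mfun m y x))"

definition hilbert_dist :: "('a::real_vector \<Rightarrow> 'a \<Rightarrow> 'a) \<Rightarrow> 'a \<Rightarrow> 'a \<Rightarrow> real" where
  "hilbert_dist m x y = ln (Mfun m x y) + ln (Mfun m y x)"

text \<open>Functions on the space S are represented as functions on the whole type which vanish
outside S; the pointwise-convergence topology on real-valued functions on S is then the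
subspace topology of the product topology on the function type.\<close>

definition horo_fn :: "('b \<Rightarrow> 'b \<Rightarrow> real) \<Rightarrow> 'b set \<Rightarrow> 'b \<Rightarrow> 'b \<Rightarrow> ('b \<Rightarrow> real)" where
  "horo_fn d S b y = (\<lambda>z. if z \<in> S then d z y - d b y else 0)"

definition horo_compact :: "('b \<Rightarrow> 'b \<Rightarrow> real) \<Rightarrow> 'b set \<Rightarrow> 'b \<Rightarrow> ('b \<Rightarrow> real) set" where
  "horo_compact d S b = closure (horo_fn d S b ` S)"

definition horo_boundary :: "('b \<Rightarrow> 'b \<Rightarrow> real) \<Rightarrow> 'b set \<Rightarrow> 'b \<Rightarrow> ('b \<Rightarrow> real) set" where
  "horo_boundary d S b = horo_compact d S b - horo_fn d S b ` S"

definition detour_cost ::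
    "('b \<Rightarrow> 'b \<Rightarrow> real) \<Rightarrow> 'b set \<Rightarrow> 'b \<Rightarrow> ('b \<Rightarrow> real) \<Rightarrow> ('b \<Rightarrow> real) \<Rightarrow> ereal" where
  "detour_cost d S b h h' =
     (SUP W \<in> {W. W \<subseteq> horo_compact d S b \<and>
                  (\<exists>U. open U \<and> h \<in> U \<and> U \<inter> horo_compact d S b \<subseteq> W)}.
        INF x \<in> {x \<in> S. horo_fn d S b x \<in> W}. ereal (d b x + h' x))"

definition detour_dist ::
    "('b \<Rightarrow> 'b \<Rightarrow> real) \<Rightarrow> 'b set \<Rightarrow> 'b \<Rightarrow> ('b \<Rightarrow> real) \<Rightarrow> ('b \<Rightarrow> real) \<Rightarrow> ereal" where
  "detour_dist d S b h h' = detour_cost d S b h h' + detour_cost d S b h' h"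

definition horo_parts :: "('b \<Rightarrow> 'b \<Rightarrow> real) \<Rightarrow> 'b set \<Rightarrow> 'b \<Rightarrow> ('b \<Rightarrow> real) set set" where
  "horo_parts d S b =
     {P. \<exists>h \<in> horo_boundary d S b. P = {h' \<in> horo_boundary d S b. detour_dist d S b h h' < \<infinity>}}"

end

theory Submission
  imports Defs "HOL-Computational_Algebra.Fundamental_Theorem_Algebra"
begin

text \<open>Transport both cone metrics to A by the exponential map. All four metrics are then built in
  the same way from a gauge g(Y, z), the exponential of an asymmetric distance from x to z where
  Y = exp x: it is M(exp x / exp z) for the cone and exp (max (spectrum (x - z))) for the norms, and
  it extends continuously to boundary points Y of the cone. The map
  x \<mapsto> (exp (x - s), exp (-x - s')), with s = s' the spectral norm of x in part (a) and s, s' the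
  largest eigenvalues of x and -x in part (b), sends A into a compact set of pairs (Y, W). The
  closure of its image parametrises both horofunction compactifications, the horofunction of
  (Y, W) being the logarithm of the maximum (a) or of the product (b) of g(Y, z) and g(W, -z).

  For h with parameter (Y, W), the function d(0, x) + h(x) is this same expression with z and -z
  replaced by the logarithms of the two components of the image of x. Evaluating it along points
  whose images dominate a given (Y', W') within one system of idempotents shows that the
  parametrisation is injective and that a detour cost is finite exactly if Y \<le> b Y' and
  W \<le> b W' for some b, a condition which does not involve the gauge. So parts correspond to parts.

  On the algebraic side, the symmetry of transition probabilities between primitive idempotents
  yields a well-defined trace and the positivity of the quadratic representation, hence that
  inversion reverses the order.\<close>

text \<open>No horofunction is computed explicitly. The parameter set \<open>K\<close> is built from
  \<open>embed\<close> alone, so two gauges parametrise their compactifications by the same compact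
  space, and the required extension is one parametrisation after the inverse of the other. Two
  components are needed because each metric combines two one-sided distances; since inversion
  reverses the order, the moving point can be brought into the first argument of both gauges, the
  argument in which they extend to the boundary. The obstacle on the norm side is that the logarithm
  diverges on the kernel of a boundary point. The gauge is therefore a supremum over states, and its
  continuity in \<open>Y\<close> splits into two semicontinuity arguments of different kinds. The
  second argument of a gauge has no such extension: if \<open>exp y\<close> tends to
  \<open>Y'\<close>, a bound on \<open>g Y y\<close> survives as \<open>rel\<close>, but
  \<open>rel\<close> gives back a bound only along points that dominate \<open>Y'\<close>. Hence
  every parameter must be shown to be a limit of dominating points, which needs both components
  diagonal in one system of idempotents.\<close>

locale formally_real_jordan_algebra =
  fixes m :: "'a::euclidean_space \<Rightarrow> 'a \<Rightarrow> 'a" (infixl "\<odot>" 70) and u :: 'a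
  assumes formally_real: "formally_real_jordan m u"
begin

lemma bilinear_m: "bilinear m"
  using formally_real by (simp add: formally_real_jordan_def)

sublocale bounded_bilinear m
  using bilinear_m by (simp add: bilinear_conv_bounded_bilinear)

declare zero_left [simp] zero_right [simp]

lemma jordan: "(x \<odot> x) \<odot> (x \<odot> y) = x \<odot> ((x \<odot> x) \<odot> y)"
  using formally_real by (simp add: formally_real_jordan_def)

lemma comm: "x \<odot> y = y \<odot> x"
  using formally_real unfolding formally_real_jordan_def by blast

lemma unit_left [simp]: "u \<odot> x = x"
  using formally_real by (simp add: formally_real_jordan_def)

lemma unit_right [simp]: "x \<odot> u = x"
  using unit_left comm by metis

lemma sq_zero: "x \<odot> x = 0 \<Longrightarrow> x = 0"
  using formally_real unfolding formally_real_jordan_def by (metis add.right_neutral zero_left)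

lemma sum_sq_zero: "x \<odot> x + y \<odot> y = 0 \<Longrightarrow> x = 0"
  using formally_real unfolding formally_real_jordan_def by blast

lemma u_nonzero [simp]: "u \<noteq> 0"
  by (metis unit_left zero_left nonzero_Basis SOME_Basis)

lemmas distribs = add_left add_right diff_left diff_right minus_left minus_right scaleR_left scaleR_right

subsection \<open>Power associativity\<close>

text \<open>The Jordan identity is cubic in \<open>x\<close>. Subtracting its instances at
  \<open>x + z\<close> and \<open>x - z\<close> keeps the part odd in \<open>z\<close>, and the
  instance at \<open>z\<close> removes the cubic part. Pairing with an arbitrary \<open>w\<close>
  turns vector equations into real ones that linear arithmetic can combine.\<close>

lemma jordan_lin:
  "2 *\<^sub>R ((x \<odot> z) \<odot> (x \<odot> y)) + (x \<odot> x) \<odot> (z \<odot> y) = z \<odot> ((x \<odot> x) \<odot> y) + 2 *\<^sub>R (x \<odot> ((x \<odot> z) \<odot> y))"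
proof (rule vector_eq_rdot[THEN iffD1], rule allI)
  fix w
  note * = comm[of z x]
  have 1: "(((x + z) \<odot> (x + z)) \<odot> ((x + z) \<odot> y)) \<bullet> w = ((x + z) \<odot> (((x + z) \<odot> (x + z)) \<odot> y)) \<bullet> w"
    by (simp only: jordan)
  have 2: "(((x - z) \<odot> (x - z)) \<odot> ((x - z) \<odot> y)) \<bullet> w = ((x - z) \<odot> (((x - z) \<odot> (x - z)) \<odot> y)) \<bullet> w"
    by (simp only: jordan)
  have 3: "((z \<odot> z) \<odot> (z \<odot> y)) \<bullet> w = (z \<odot> ((z \<odot> z) \<odot> y)) \<bullet> w"
    by (simp only: jordan)
  show "(2 *\<^sub>R ((x \<odot> z) \<odot> (x \<odot> y)) + (x \<odot> x) \<odot> (z \<odot> y)) \<bullet> w =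
        (z \<odot> ((x \<odot> x) \<odot> y) + 2 *\<^sub>R (x \<odot> ((x \<odot> z) \<odot> y))) \<bullet> w"
    using 1 2 3 by (simp add: distribs inner_simps *)
qed

text \<open>Polarises \<open>jordan_lin\<close> in its quadratic variable, from
  \<open>x + w\<close>, \<open>x\<close> and \<open>w\<close>; the result is the full linearisation,
  symmetric in \<open>x\<close>, \<open>z\<close> and \<open>w\<close>.\<close>

lemma jordan_lin2:
  "(x \<odot> z) \<odot> (w \<odot> y) + (w \<odot> z) \<odot> (x \<odot> y) + (x \<odot> w) \<odot> (z \<odot> y)
   = z \<odot> ((x \<odot> w) \<odot> y) + x \<odot> ((w \<odot> z) \<odot> y) + w \<odot> ((x \<odot> z) \<odot> y)"
proof (rule vector_eq_rdot[THEN iffD1], rule allI)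
  fix v
  note * = comm[of w x]
  have 1: "(2 *\<^sub>R (((x+w) \<odot> z) \<odot> ((x+w) \<odot> y)) + ((x+w) \<odot> (x+w)) \<odot> (z \<odot> y)) \<bullet> v
      = (z \<odot> (((x+w) \<odot> (x+w)) \<odot> y) + 2 *\<^sub>R ((x+w) \<odot> (((x+w) \<odot> z) \<odot> y))) \<bullet> v"
    by (simp only: jordan_lin)
  have 2: "(2 *\<^sub>R ((x \<odot> z) \<odot> (x \<odot> y)) + (x \<odot> x) \<odot> (z \<odot> y)) \<bullet> v
      = (z \<odot> ((x \<odot> x) \<odot> y) + 2 *\<^sub>R (x \<odot> ((x \<odot> z) \<odot> y))) \<bullet> v"
    by (simp only: jordan_lin)
  have 3: "(2 *\<^sub>R ((w \<odot> z) \<odot> (w \<odot> y)) + (w \<odot> w) \<odot> (z \<odot> y)) \<bullet> v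
      = (z \<odot> ((w \<odot> w) \<odot> y) + 2 *\<^sub>R (w \<odot> ((w \<odot> z) \<odot> y))) \<bullet> v"
    by (simp only: jordan_lin)
  show "((x \<odot> z) \<odot> (w \<odot> y) + (w \<odot> z) \<odot> (x \<odot> y) + (x \<odot> w) \<odot> (z \<odot> y)) \<bullet> v
   = (z \<odot> ((x \<odot> w) \<odot> y) + x \<odot> ((w \<odot> z) \<odot> y) + w \<odot> ((x \<odot> z) \<odot> y)) \<bullet> v"
    using 1 2 3 by (simp add: distribs inner_simps *)
qed

text \<open>The product is commutative but not associative, so the useful notion is commutation of
  the multiplication operators.\<close>

definition opcomm :: "'a \<Rightarrow> 'a \<Rightarrow> bool" where
  "opcomm a b \<longleftrightarrow> (\<forall>z. a \<odot> (b \<odot> z) = b \<odot> (a \<odot> z))"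

lemma opcomm_sym: "opcomm a b \<Longrightarrow> opcomm b a"
  by (simp add: opcomm_def)

lemma opcomm_span: "x \<in> span S \<Longrightarrow> (\<And>s. s \<in> S \<Longrightarrow> opcomm a s) \<Longrightarrow> opcomm a x"
  by (induction rule: span_induct_alt) (auto simp: opcomm_def distribs)

text \<open>Read in \<open>z\<close>, this expresses multiplication by
  \<open>(x \<odot> x) \<odot> y\<close> through multiplications by \<open>x\<close>,
  \<open>x \<odot> x\<close>, \<open>y\<close> and \<open>x \<odot> y\<close>. It drives the
  recursion for powers and later the inversion of \<open>U\<close>.\<close>

lemma L_sq_mult:
  "((x \<odot> x) \<odot> y) \<odot> z = 2 *\<^sub>R ((x \<odot> y) \<odot> (x \<odot> z)) + (x \<odot> x) \<odot> (y \<odot> z) - 2 *\<^sub>R (x \<odot> (y \<odot> (x \<odot> z)))"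
  using jordan_lin[of x z y] comm[of z "(x \<odot> x) \<odot> y"] comm[of "x \<odot> z" "x \<odot> y"] comm[of z y] comm[of "x \<odot> z" y]
  by (simp add: eq_diff_eq)

primrec jpow :: "'a \<Rightarrow> nat \<Rightarrow> 'a" where
  "jpow x 0 = u"
| "jpow x (Suc n) = x \<odot> jpow x n"

lemma jpow_sq: "(x \<odot> x) \<odot> jpow x n = jpow x (Suc (Suc n))"
  by (induction n) (simp_all add: jordan)

text \<open>By \<open>L_sq_mult\<close> the operator of the power \<open>k + 2\<close> is a
  polynomial in those of \<open>x\<close>, \<open>x \<odot> x\<close> and the powers
  \<open>k\<close> and \<open>k + 1\<close>, so the induction goes two steps back.\<close>

lemma opcomm_jpow: "opcomm a x \<Longrightarrow> opcomm a (x \<odot> x) \<Longrightarrow> opcomm a (jpow x n)"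
proof (induction n rule: less_induct)
  case (less n)
  consider "n = 0" | "n = 1" | k where "n = Suc (Suc k)"
    by (metis One_nat_def not0_implies_Suc)
  then show ?case
  proof cases
    case 3
    have k: "opcomm a (jpow x k)" "opcomm a (jpow x (Suc k))"
      using less.IH[of k] less.IH[of "Suc k"] less.prems 3 by auto
    have "jpow x (Suc (Suc k)) \<odot> z = 2 *\<^sub>R (jpow x (Suc k) \<odot> (x \<odot> z)) + (x \<odot> x) \<odot> (jpow x k \<odot> z)
        - 2 *\<^sub>R (x \<odot> (jpow x k \<odot> (x \<odot> z)))" for z
      using L_sq_mult[of x "jpow x k" z] jpow_sq[of x k] by simp
    then show ?thesis
      using k less.prems unfolding 3 opcomm_def by (simp add: distribs)
  qed (use less.prems in \<open>auto simp: opcomm_def\<close>)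
qed

lemma opcomm_x_sq: "opcomm x (x \<odot> x)"
  using jordan by (simp add: opcomm_def)

lemma opcomm_jpow_x: "opcomm (jpow x n) x" "opcomm (jpow x n) (x \<odot> x)"
proof -
  have "opcomm x (jpow x n)" "opcomm (x \<odot> x) (jpow x n)"
    by (intro opcomm_jpow opcomm_x_sq opcomm_sym[OF opcomm_x_sq]; simp add: opcomm_def)+
  then show "opcomm (jpow x n) x" "opcomm (jpow x n) (x \<odot> x)"
    by (auto intro: opcomm_sym)
qed

lemma opcomm_jpow_jpow: "opcomm (jpow x n) (jpow x k)"
  by (intro opcomm_jpow opcomm_jpow_x)

text \<open>A Horner scheme using left multiplications by \<open>x\<close> only, so it makes sense
  before powers are known to associate.\<close>

definition ev :: "'a \<Rightarrow> real poly \<Rightarrow> 'a" where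
  "ev x p = fold_coeffs (\<lambda>a r. a *\<^sub>R u + x \<odot> r) p 0"

lemma ev_0 [simp]: "ev x 0 = 0"
  by (simp add: ev_def)

lemma ev_pCons [simp]: "ev x (pCons a p) = a *\<^sub>R u + x \<odot> ev x p"
proof (cases "p = 0 \<and> a = 0")
  case False
  then show ?thesis
    by (auto simp: ev_def fold_coeffs_pCons_not_0_0_eq fold_coeffs_pCons_coeff_not_0_eq)
qed simp

lemma ev_1 [simp]: "ev x 1 = u"
  by (simp add: one_pCons)

lemma ev_add: "ev x (p + q) = ev x p + ev x q"
  by (induction p q rule: poly_induct2) (auto simp: algebra_simps distribs)

lemma ev_smult: "ev x (smult c p) = c *\<^sub>R ev x p"
  by (induction p) (auto simp: algebra_simps distribs)

lemma ev_in_span: "ev x p \<in> span (range (jpow x))"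
proof (induction p)
  case (pCons a p)
  have "x \<odot> y \<in> span (range (jpow x))" if "y \<in> span (range (jpow x))" for y
    using that
  proof (induction rule: span_induct_alt)
    case (step c b y)
    then obtain n where "b = jpow x n" by auto
    then have "x \<odot> b \<in> span (range (jpow x))"
      by (metis jpow.simps(2) rangeI span_base)
    then show ?case
      using step by (simp add: distribs span_add span_scale)
  qed (simp add: span_zero)
  moreover have "u \<in> span (range (jpow x))"
    by (metis jpow.simps(1) rangeI span_base)
  ultimately show ?case
    using pCons by (simp add: span_add span_scale)
qed (simp add: span_zero)

lemma opcomm_ev: "opcomm (ev x p) (ev x q)"
proof (rule opcomm_span[OF ev_in_span])
  fix s assume "s \<in> range (jpow x)"
  then obtain n where s: "s = jpow x n" by auto
  have "opcomm s (ev x p)"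
    unfolding s by (rule opcomm_span[OF ev_in_span]) (auto intro: opcomm_jpow_jpow)
  then show "opcomm (ev x p) s" by (rule opcomm_sym)
qed

text \<open>Power associativity: moving \<open>x\<close> past \<open>ev x q\<close> only takes
  commuting multiplication operators.\<close>

lemma ev_mult: "ev x (p * q) = ev x p \<odot> ev x q"
proof (induction p)
  case (pCons a p)
  have "opcomm (ev x q) x"
    using opcomm_ev[of x q "[:0,1:]"] by simp
  then have "ev x q \<odot> (x \<odot> ev x p) = x \<odot> (ev x q \<odot> ev x p)"
    by (simp add: opcomm_def)
  then have "(x \<odot> ev x p) \<odot> ev x q = x \<odot> (ev x p \<odot> ev x q)"
    by (metis comm)
  then show ?case
    using pCons by (simp add: ev_add ev_smult distribs)
qed simp

lemma ev_diff: "ev x (p - q) = ev x p - ev x q"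
  using ev_add[of x "p - q" q] by simp

lemma ev_sum: "ev x (sum f A) = (\<Sum>i\<in>A. ev x (f i))"
  by (induction A rule: infinite_finite_induct) (auto simp: ev_add)

lemma ev_sq_zero: "ev x (p * p) = 0 \<Longrightarrow> ev x p = 0"
  using sq_zero[of "ev x p"] by (simp add: ev_mult)

lemma ev_monom: "ev x (monom c n) = c *\<^sub>R jpow x n"
  by (induction n) (auto simp: monom_0 monom_Suc zero_right distribs)

subsection \<open>Spectral decompositions\<close>

text \<open>The first \<open>DIM('a) + 1\<close> powers cannot be independent. Coinciding powers
  form a separate case, since linear dependence is a property of the set of powers.\<close>

lemma annihilator_exists: "\<exists>p. p \<noteq> 0 \<and> ev x p = 0"
proof (cases "inj_on (jpow x) {..DIM('a)}")
  case False
  then obtain i j where ij: "i \<noteq> j" "jpow x i = jpow x j"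
    by (auto simp: inj_on_def)
  have "monom (1::real) i \<noteq> monom 1 j"
    using ij by (metis coeff_monom zero_neq_one)
  then show ?thesis
    using ij by (intro exI[of _ "monom 1 i - monom 1 j"]) (simp add: ev_diff ev_monom)
next
  case True
  let ?B = "jpow x ` {..DIM('a)}"
  have "card ?B = Suc DIM('a)"
    using True by (simp add: card_image)
  then have "dependent ?B"
    using dependent_biggerset[of ?B] by simp
  then obtain c where c: "\<exists>v\<in>?B. c v \<noteq> 0" "(\<Sum>v\<in>?B. c v *\<^sub>R v) = 0"
    using dependent_finite[of ?B] by auto
  let ?p = "\<Sum>i\<le>DIM('a). monom (c (jpow x i)) i"
  have "ev x ?p = (\<Sum>i\<le>DIM('a). c (jpow x i) *\<^sub>R jpow x i)"
    by (simp add: ev_sum ev_monom)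
  also have "\<dots> = (\<Sum>v\<in>?B. c v *\<^sub>R v)"
    using True by (subst sum.reindex) auto
  finally have "ev x ?p = 0" using c by simp
  moreover obtain i where "i \<le> DIM('a)" "c (jpow x i) \<noteq> 0"
    using c by auto
  then have "coeff ?p i \<noteq> 0"
    by (simp add: coeff_sum sum.delta')
  then have "?p \<noteq> 0" by auto
  ultimately show ?thesis by blast
qed

end

section \<open>Factors and interpolation of real polynomials\<close>

lemma poly_of_real_mult:
  "poly (map_poly complex_of_real (p * q)) z = poly (map_poly complex_of_real p) z * poly (map_poly complex_of_real q) z"
proof -
  have add: "poly (map_poly complex_of_real (p + q)) z
      = poly (map_poly complex_of_real p) z + poly (map_poly complex_of_real q) z" for p q
    by (induction p q rule: poly_induct2) (auto simp: map_poly_pCons algebra_simps)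
  have smult: "poly (map_poly complex_of_real (smult c p)) z = c * poly (map_poly complex_of_real p) z" for c p
    by (induction p) (auto simp: map_poly_pCons algebra_simps)
  show ?thesis
    by (induction p) (auto simp: map_poly_pCons add smult algebra_simps)
qed

text \<open>There is a complex root \<open>z\<close>. If it is not real, \<open>R\<close> is the
  real quadratic with roots \<open>z\<close> and its conjugate; the remainder modulo
  \<open>R\<close> has degree below 2, real coefficients and the root \<open>z\<close>, so it is
  zero.\<close>

lemma real_poly_factor:
  fixes p :: "real poly"
  assumes "degree p > 0"
  shows "(\<exists>a q. p = [:-a, 1:] * q) \<or> (\<exists>a b q. b \<noteq> 0 \<and> p = [:a\<^sup>2 + b\<^sup>2, - 2 * a, 1:] * q)"
proof -
  let ?P = "map_poly complex_of_real p"
  have "degree ?P = degree p" by (simp add: degree_map_poly)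
  then have "\<not> constant (poly ?P)"
    using assms constant_degree[of ?P] by simp
  then obtain z where z: "poly ?P z = 0"
    using fundamental_theorem_of_algebra by blast
  define R where "R = [:(Re z)\<^sup>2 + (Im z)\<^sup>2, - 2 * Re z, 1:]"
  have "poly (map_poly complex_of_real R) z = 0"
    by (simp add: R_def map_poly_pCons complex_eq_iff algebra_simps power2_eq_square)
  have lin: "poly (map_poly complex_of_real [:c, d:]) z = of_real c + z * of_real d" for c d
    by (simp add: map_poly_pCons)
  show ?thesis
  proof (cases "Im z = 0")
    case True
    then have zr: "z = of_real (Re z)" by (simp add: complex_eq_iff)
    have "poly (map_poly complex_of_real q) (of_real (Re z)) = of_real (poly q (Re z))" for q
      by (induction q) (auto simp: map_poly_pCons)
    from this[of p] have "of_real (poly p (Re z)) = (0::complex)"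
      using z by (subst (asm) zr[symmetric]) simp
    then have "poly p (Re z) = 0" by simp
    then obtain q where "p = [:- Re z, 1:] * q"
      by (auto simp: poly_eq_0_iff_dvd elim!: dvdE)
    then show ?thesis by blast
  next
    case False
    have "p = R * (p div R) + p mod R" by simp
    have add: "poly (map_poly complex_of_real (p + q)) z
        = poly (map_poly complex_of_real p) z + poly (map_poly complex_of_real q) z" for p q
      by (induction p q rule: poly_induct2) (auto simp: map_poly_pCons algebra_simps)
    have "poly (map_poly complex_of_real (p mod R + R * (p div R))) z = 0"
      using z by (simp only: mod_mult_div_eq)
    then have rz: "poly (map_poly complex_of_real (p mod R)) z = 0"
      using \<open>poly (map_poly complex_of_real R) z = 0\<close>
      unfolding add poly_of_real_mult by simp
    have "degree R = 2" "R \<noteq> 0" by (simp_all add: R_def)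
    then have deg: "degree (p mod R) < 2"
      using degree_mod_less[OF \<open>R \<noteq> 0\<close>, of p] by (metis degree_0 zero_less_numeral)
    have cd: "p mod R = [:coeff (p mod R) 0, coeff (p mod R) 1:]"
    proof (rule poly_eqI)
      fix n
      show "coeff (p mod R) n = coeff [:coeff (p mod R) 0, coeff (p mod R) 1:] n"
      proof (cases "n < 2")
        case True
        then consider "n = 0" | "n = 1" by linarith
        then show ?thesis by cases (simp_all only: coeff_pCons_0 coeff_pCons_Suc One_nat_def)
      next
        case False
        then have "coeff (p mod R) n = 0" using deg by (intro coeff_eq_0) linarith
        moreover have "coeff [:coeff (p mod R) 0, coeff (p mod R) 1:] n = 0"
          using False by (intro coeff_eq_0) simp
        ultimately show ?thesis by metis
      qed
    qed
    define c d where "c = coeff (p mod R) 0" and "d = coeff (p mod R) 1"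
    have "p mod R = [:c, d:]" using cd unfolding c_def d_def .
    then have "of_real c + z * of_real d = 0"
      using rz lin by metis
    then have "d = 0" "c = 0" using False by (auto simp: complex_eq_iff)
    then have "p mod R = 0" using \<open>p mod R = [:c, d:]\<close> by simp
    then obtain q where "p = R * q"
      using \<open>p = R * (p div R) + p mod R\<close> by (metis add.right_neutral)
    then show ?thesis
      using False unfolding R_def by blast
  qed
qed


lemma vec_eqI: "(\<And>w. a \<bullet> w = b \<bullet> w) \<Longrightarrow> a = (b :: 'a :: real_inner)"
  by (rule vector_eq_rdot[THEN iffD1]) blast

lemma poly_interpolation:
  fixes f :: "real \<Rightarrow> real"
  assumes "finite S"
  shows "\<exists>q. \<forall>s\<in>S. poly q s = f s"
  using assms
proof induction
  case (insert a S)
  then obtain q where q: "\<forall>s\<in>S. poly q s = f s" by blast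
  let ?w = "\<Prod>s\<in>S. [:-s, 1:]"
  have "poly ?w s = 0" if "s \<in> S" for s
    using that insert.hyps by (auto simp: poly_prod intro!: prod_zero)
  moreover have "poly ?w a \<noteq> 0"
    using insert.hyps by (auto simp: poly_prod)
  ultimately show ?case
    using q by (intro exI[of _ "q + smult ((f a - poly q a) / poly ?w a) ?w"]) simp
qed auto

lemma poly_vanish_dvd:
  fixes q :: "real poly"
  assumes "finite S" "\<forall>s\<in>S. poly q s = 0"
  shows "(\<Prod>s\<in>S. [:-s, 1:]) dvd q"
  using assms
proof (induction arbitrary: q)
  case (insert a S)
  then obtain q' where q': "q = [:-a, 1:] * q'"
    by (auto simp: poly_eq_0_iff_dvd elim!: dvdE)
  have "poly q' s = 0" if "s \<in> S" for s
  proof -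
    have "poly q s = 0" "s \<noteq> a" using insert that by auto
    then show ?thesis unfolding q' by auto
  qed
  then have "(\<Prod>s\<in>S. [:-s, 1:]) dvd q'" using insert by blast
  then show ?case
    using insert.hyps unfolding q' by (simp add: mult_dvd_mono del: mult_pCons_left)
qed auto

context formally_real_jordan_algebra
begin

text \<open>Formal reality removes a non-real pair of roots, because ((X - a)^2 + b^2) w^2 is a sum of two
  squares, and a repeated root, because the square of an annihilating polynomial with that root
  made simple is a multiple of it.\<close>

lemma annihilator_split:
  assumes "p \<noteq> 0" "ev x (p * q) = 0"
  shows "\<exists>S. finite S \<and> ev x ((\<Prod>s\<in>S. [:-s, 1:]) * q) = 0"
  using assms
proof (induction "degree p" arbitrary: p q rule: less_induct)
  case less
  show ?case
  proof (cases "degree p = 0")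
    case True
    then obtain c where p: "p = [:c:]" by (metis degree_eq_zeroE)
    then have "ev x q = 0" using less.prems by (simp add: ev_smult)
    then show ?thesis by (intro exI[of _ "{}"]) simp
  next
    case False
    then consider a p' where "p = [:-a, 1:] * p'"
      | a b p' where "b \<noteq> 0" "p = [:a\<^sup>2 + b\<^sup>2, - 2 * a, 1:] * p'"
      using real_poly_factor[of p] by auto
    then show ?thesis
    proof cases
      case 1
      have "p' \<noteq> 0" using less.prems(1) unfolding 1 by auto
      moreover have "degree p' < degree p"
        unfolding 1 using \<open>p' \<noteq> 0\<close> by (subst degree_mult_eq) auto
      moreover have "p * q = p' * ([:-a, 1:] * q)"
        unfolding 1 by (simp only: mult.assoc mult.left_commute)
      ultimately obtain S where S: "finite S" "ev x ((\<Prod>s\<in>S. [:-s, 1:]) * ([:-a, 1:] * q)) = 0"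
        using less.hyps[of p' "[:-a, 1:] * q"] less.prems(2) by metis
      show ?thesis
      proof (cases "a \<in> S")
        case False
        have eq: "(\<Prod>s\<in>insert a S. [:-s, 1:]) * q = (\<Prod>s\<in>S. [:-s, 1:]) * ([:-a, 1:] * q)"
          using False S(1) by (simp only: prod.insert mult.assoc mult.left_commute not_False_eq_True)
        show ?thesis
          using S(1) by (intro exI[of _ "insert a S"]) (simp only: eq S(2) finite_insert simp_thms)
      next
        case True
        let ?w = "(\<Prod>s\<in>S - {a}. [:-s, 1:]) * q"
        have P: "(\<Prod>s\<in>S. [:-s, 1:]) = [:-a, 1:] * (\<Prod>s\<in>S - {a}. [:-s, 1:])"
          using True S(1) by (rule prod.remove[rotated])
        let ?v = "(\<Prod>s\<in>S. [:-s, 1:]) * q"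
        have "?v * ?v = ((\<Prod>s\<in>S. [:-s, 1:]) * ([:-a, 1:] * q)) * ?w"
          by (subst (2) P) (simp only: mult_ac)
        then have "ev x (?v * ?v) = 0"
          using S(2) by (simp only: ev_mult zero_left)
        then show ?thesis using S(1) ev_sq_zero by blast
      qed
    next
      case 2
      let ?Q = "[:a\<^sup>2 + b\<^sup>2, - 2 * a, 1:]"
      have "p' \<noteq> 0" using less.prems(1) unfolding 2 by auto
      moreover have "degree p' < degree p"
        unfolding 2 using \<open>p' \<noteq> 0\<close> by (subst degree_mult_eq) auto
      moreover have "p * q = p' * (?Q * q)"
        unfolding 2 by (simp only: mult.assoc mult.left_commute)
      ultimately obtain S where S: "finite S" "ev x ((\<Prod>s\<in>S. [:-s, 1:]) * (?Q * q)) = 0"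
        using less.hyps[of p' "?Q * q"] less.prems(2) by metis
      define w where "w = (\<Prod>s\<in>S. [:-s, 1:]) * q"
      have Q: "?Q = [:-a, 1:] * [:-a, 1:] + [:b:] * [:b:]"
        by (simp add: power2_eq_square)
      have "((\<Prod>s\<in>S. [:-s, 1:]) * (?Q * q)) * w = ([:b:] * w) * ([:b:] * w) + ([:-a, 1:] * w) * ([:-a, 1:] * w)"
        unfolding Q w_def by (simp only: ring_distribs mult_ac add_ac)
      then have "ev x ([:b:] * w) \<odot> ev x ([:b:] * w) + ev x ([:-a,1:] * w) \<odot> ev x ([:-a,1:] * w) = 0"
        using S(2) by (metis ev_add ev_mult zero_left)
      then have "ev x ([:b:] * w) = 0" by (rule sum_sq_zero)
      then have "ev x w = 0" using 2 by (simp add: ev_smult)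
      then show ?thesis using S(1) unfolding w_def by blast
    qed
  qed
qed

definition osys :: "nat \<Rightarrow> (nat \<Rightarrow> 'a) \<Rightarrow> bool" where
  "osys r p \<longleftrightarrow> (\<forall>i<r. p i \<odot> p i = p i) \<and> (\<forall>i<r. \<forall>j<r. i \<noteq> j \<longrightarrow> p i \<odot> p j = 0) \<and> (\<Sum>i<r. p i) = u"

text \<open>Weaker than a Jordan frame: this is the class shown to be stable under limits in
  \<open>nsys_compact\<close>. Nonzero members make the coefficients recoverable.\<close>

definition nsys :: "nat \<Rightarrow> (nat \<Rightarrow> 'a) \<Rightarrow> bool" where
  "nsys r p \<longleftrightarrow> osys r p \<and> (\<forall>i<r. p i \<noteq> 0)"

abbreviation jframe :: "nat \<Rightarrow> (nat \<Rightarrow> 'a) \<Rightarrow> bool" where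
  "jframe \<equiv> jordan_frame m u"

abbreviation primitive :: "'a \<Rightarrow> bool" where
  "primitive \<equiv> primitive_idempotent m"

abbreviation lc :: "nat \<Rightarrow> (nat \<Rightarrow> 'a) \<Rightarrow> (nat \<Rightarrow> real) \<Rightarrow> 'a" where
  "lc r p l \<equiv> \<Sum>i<r. l i *\<^sub>R p i"

lemma nsys_osys: "nsys r p \<Longrightarrow> osys r p"
  by (simp add: nsys_def)

lemma primitive_idem: "primitive p \<Longrightarrow> p \<odot> p = p"
  by (simp add: primitive_idempotent_def idempotent_def)

lemma primitive_nonzero: "primitive p \<Longrightarrow> p \<noteq> 0"
  by (simp add: primitive_idempotent_def)

lemma jframe_nsys: "jframe r p \<Longrightarrow> nsys r p"
  by (auto simp: jordan_frame_def nsys_def osys_def primitive_idem primitive_nonzero)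

lemma osys_mult_left: 
  assumes "osys r p" "j < r"
  shows "p j \<odot> lc r p l = l j *\<^sub>R p j"
proof -
  have "p j \<odot> lc r p l = (\<Sum>i<r. l i *\<^sub>R (p j \<odot> p i))"
    by (simp add: sum_right scaleR_right)
  also have "\<dots> = (\<Sum>i<r. if i = j then l j *\<^sub>R p j else 0)"
    using assms by (intro sum.cong) (auto simp: osys_def)
  finally show ?thesis using assms by simp
qed

lemma osys_mult:
  assumes "osys r p"
  shows "lc r p k \<odot> lc r p l = lc r p (\<lambda>i. k i * l i)"
proof -
  have "lc r p k \<odot> lc r p l = (\<Sum>i<r. k i *\<^sub>R (p i \<odot> lc r p l))"
    by (simp add: sum_left scaleR_left)
  also have "\<dots> = lc r p (\<lambda>i. k i * l i)"
    using assms by (intro sum.cong) (auto simp: osys_mult_left)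
  finally show ?thesis .
qed

lemma osys_unit: "osys r p \<Longrightarrow> c *\<^sub>R u = lc r p (\<lambda>_. c)"
  by (simp add: osys_def flip: scaleR_sum_right)

lemma ev_osys: "osys r p \<Longrightarrow> ev (lc r p l) q = lc r p (\<lambda>i. poly q (l i))"
proof (induction q)
  case (pCons a q)
  then show ?case
    by (simp add: osys_mult osys_unit[of r p a] sum.distrib[symmetric] scaleR_add_left)
qed simp

text \<open>One polynomial interpolates \<open>f\<close> on both coefficient lists, and evaluating
  it at the common element gives either side. This makes the functional calculus well
  defined.\<close>

lemma lc_unique:
  assumes "osys r p" "osys s q" "lc r p k = lc s q l"
  shows "lc r p (\<lambda>i. f (k i)) = lc s q (\<lambda>i. f (l i))"
proof -
  obtain w where w: "\<forall>t \<in> k ` {..<r} \<union> l ` {..<s}. poly w t = f t"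
    using poly_interpolation[of "k ` {..<r} \<union> l ` {..<s}" f] by auto
  have "lc r p (\<lambda>i. f (k i)) = ev (lc r p k) w"
    using assms(1) w by (auto simp: ev_osys intro!: sum.cong)
  also have "\<dots> = lc s q (\<lambda>i. f (l i))"
    unfolding assms(3) using assms(2) w by (auto simp: ev_osys intro!: sum.cong)
  finally show ?thesis .
qed

lemma lc_zero_imp:
  assumes "nsys r p" "lc r p k = 0" "i < r" shows "k i = 0"
proof -
  have "k i *\<^sub>R p i = 0"
    using osys_mult_left[of r p i k] assms by (simp add: nsys_def)
  then show ?thesis using assms by (simp add: nsys_def)
qed

text \<open>Apply \<open>lc_unique\<close> to the indicator function of the value
  \<open>k i\<close>: if that value were missing on the right, the right-hand side would
  vanish.\<close>

lemma lc_spectrum_subset: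
  assumes "nsys r p" "osys s q" "lc r p k = lc s q l" "i < r"
  shows "k i \<in> l ` {..<s}"
proof (rule ccontr)
  assume "k i \<notin> l ` {..<s}"
  then have "\<forall>j<s. l j \<noteq> k i" by (metis image_eqI lessThan_iff)
  then have "(if l j = k i then 1 else (0::real)) = 0" if "j \<in> {..<s}" for j
    using that by (auto simp: image_iff)
  then have "lc s q (\<lambda>j. if l j = k i then 1 else 0) = 0"
    by (intro sum.neutral ballI) (simp only: scaleR_zero_left)
  then have "lc r p (\<lambda>j. if k j = k i then 1 else 0) = 0"
    using lc_unique[OF nsys_osys[OF assms(1)] assms(2,3), of "\<lambda>t. if t = k i then 1 else 0"] by metis
  from lc_zero_imp[OF assms(1) this assms(4)] show False by (simp only: if_True zero_neq_one refl)
qed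

lemma lc_spectrum_eq:
  assumes "nsys r p" "nsys s q" "lc r p k = lc s q l"
  shows "k ` {..<r} = l ` {..<s}"
  using lc_spectrum_subset[OF assms(1) nsys_osys[OF assms(2)] assms(3)]
    lc_spectrum_subset[OF assms(2) nsys_osys[OF assms(1)] assms(3)[symmetric]] by blast

text \<open>Orthogonality makes the members linearly independent. The bound allows a longest system
  to be chosen in \<open>jframe_exists\<close>.\<close>

lemma nsys_bound:
  assumes "nsys r p" shows "r \<le> DIM('a)"
proof -
  have o: "osys r p" using assms by (simp add: nsys_def)
  have inj: "inj_on p {..<r}"
  proof (rule inj_onI, rule ccontr)
    fix i j assume "i \<in> {..<r}" "j \<in> {..<r}" "p i = p j" "i \<noteq> j"
    then have "p i \<odot> p j = 0" "p i \<odot> p i = p i" "p i \<noteq> 0"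
      using assms unfolding nsys_def osys_def by blast+
    then show False using \<open>p i = p j\<close> by metis
  qed
  have "independent (p ` {..<r})"
  proof (subst independent_explicit_finite_subsets, intro allI impI ballI)
    fix A c v
    assume A: "A \<subseteq> p ` {..<r}" "finite A" "(\<Sum>v\<in>A. c v *\<^sub>R v) = 0" and v: "v \<in> A"
    obtain i where i: "i < r" "v = p i" using A v by auto
    have "(\<Sum>v\<in>p ` {..<r}. (if v \<in> A then c v else 0) *\<^sub>R v) = (\<Sum>v\<in>A. c v *\<^sub>R v)"
      using A by (intro sum.mono_neutral_cong_right) auto
    then have "lc r p (\<lambda>i. if p i \<in> A then c (p i) else 0) = 0"
      using A inj by (simp add: sum.reindex)
    from lc_zero_imp[OF assms this i(1)] show "c v = 0"
      using v i by simp
  qed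
  then have "card (p ` {..<r}) \<le> DIM('a)"
    using independent_bound by blast
  then show ?thesis using inj by (simp add: card_image)
qed

text \<open>The Lagrange polynomials of the roots \<open>S\<close> of a split annihilating
  polynomial, evaluated at \<open>x\<close>, are the idempotents: a polynomial identity valid at
  every root also holds at \<open>x\<close>.\<close>

lemma nsys_decomp_exists: "\<exists>r p l. nsys r p \<and> x = lc r p l"
proof -
  obtain p0 where "p0 \<noteq> 0" "ev x p0 = 0" using annihilator_exists by blast
  then obtain S where S: "finite S" "ev x (\<Prod>s\<in>S. [:-s, 1:]) = 0"
    using annihilator_split[of p0 x 1] by auto
  have vanish: "ev x q = 0" if q: "\<And>s. s \<in> S \<Longrightarrow> poly q s = 0" for q
  proof -
    obtain w where "q = (\<Prod>s\<in>S. [:-s, 1:]) * w"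
      using poly_vanish_dvd[OF S(1), of q] q by (meson dvdE)
    then show ?thesis using S by (simp add: ev_mult)
  qed
  have "\<exists>w. \<forall>s\<in>S. poly w s = (if s = t then 1 else 0)" for t
    using poly_interpolation[OF S(1), of "\<lambda>s. if s = t then 1 else 0"] .
  then obtain w where w: "\<And>s t. s \<in> S \<Longrightarrow> poly (w t) s = (if s = t then 1 else 0)"
    by metis
  define e where "e s = ev x (w s)" for s
  have idem: "e s \<odot> e s = e s" if "s \<in> S" for s
    using vanish[of "w s * w s - w s"] w by (simp add: e_def ev_mult ev_diff)
  have orth: "e s \<odot> e t = 0" if "s \<in> S" "t \<in> S" "s \<noteq> t" for s t
    using vanish[of "w s * w t"] w that by (simp add: e_def ev_mult)
  have sumu: "(\<Sum>s\<in>S. e s) = u"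
    using vanish[of "(\<Sum>s\<in>S. w s) - 1"] w S(1) by (simp add: e_def ev_diff ev_sum poly_sum)
  have sumx: "(\<Sum>s\<in>S. s *\<^sub>R e s) = x"
    using vanish[of "(\<Sum>s\<in>S. smult s (w s)) - [:0,1:]"] w S(1)
    by (simp add: e_def ev_diff ev_sum ev_smult poly_sum if_distrib cong: if_cong)
  \<comment> \<open>\<open>S\<close> may contain numbers that are not eigenvalues of
    \<open>x\<close>; these yield the zero idempotent and are dropped.\<close>
  define T where "T = {s\<in>S. e s \<noteq> 0}"
  have T: "finite T" using S by (simp add: T_def)
  have Tu: "(\<Sum>s\<in>T. e s) = u" unfolding sumu[symmetric] T_def
    using S by (intro sum.mono_neutral_left) auto
  have Tx: "(\<Sum>s\<in>T. s *\<^sub>R e s) = x" unfolding sumx[symmetric] T_def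
    using S by (intro sum.mono_neutral_left) auto
  obtain h where h: "bij_betw h {..<card T} T"
    using ex_bij_betw_nat_finite[OF T] by (auto simp: lessThan_atLeast0)
  have hT: "h i \<in> T" if "i < card T" for i
    using h that by (auto simp: bij_betw_def)
  have hinj: "h i \<noteq> h j" if "i < card T" "j < card T" "i \<noteq> j" for i j
    using h that by (auto simp: bij_betw_def inj_on_def)
  have "nsys (card T) (\<lambda>i. e (h i))"
    unfolding nsys_def osys_def
    using hT hinj idem orth Tu sum.reindex_bij_betw[OF h, of e] by (auto simp: T_def)
  moreover have "x = lc (card T) (\<lambda>i. e (h i)) h"
    using Tx sum.reindex_bij_betw[OF h, of "\<lambda>s. s *\<^sub>R e s"] by simp
  ultimately show ?thesis by blast
qed

subsection \<open>Peirce decomposition\<close>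

text \<open>The factor \<open>1 - 2 * i\<close> stays on both sides because it vanishes for the
  eigenvalue 1/2; products of two half-space elements are treated by
  \<open>peirce_hh\<close>.\<close>

lemma peirce_mult_aux:
  assumes "c \<odot> c = c" "c \<odot> a = i *\<^sub>R a" "c \<odot> b = j *\<^sub>R b"
  shows "(1 - 2 * i) *\<^sub>R (c \<odot> (a \<odot> b)) = (1 - 2 * i) *\<^sub>R (j *\<^sub>R (a \<odot> b))"
  using jordan_lin[of c a b] assms by (simp add: distribs algebra_simps)

lemma peirce_1: "c \<odot> c = c \<Longrightarrow> c \<odot> a = a \<Longrightarrow> c \<odot> b = j *\<^sub>R b \<Longrightarrow> c \<odot> (a \<odot> b) = j *\<^sub>R (a \<odot> b)"
  using peirce_mult_aux[of c a 1 b j] by simp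

lemma peirce_0: "c \<odot> c = c \<Longrightarrow> c \<odot> a = 0 \<Longrightarrow> c \<odot> b = j *\<^sub>R b \<Longrightarrow> c \<odot> (a \<odot> b) = j *\<^sub>R (a \<odot> b)"
  using peirce_mult_aux[of c a 0 b j] by simp

text \<open>The product is an eigenvector for 0 by \<open>peirce_1\<close> and, with
  \<open>a\<close> and \<open>b\<close> exchanged, for 1 by \<open>peirce_0\<close>.\<close>

lemma peirce_10: "c \<odot> c = c \<Longrightarrow> c \<odot> a = a \<Longrightarrow> c \<odot> b = 0 \<Longrightarrow> a \<odot> b = 0"
  using peirce_1[of c a b 0] peirce_0[of c b a 1] comm[of b a] by simp

lemma peirce_11: "c \<odot> c = c \<Longrightarrow> c \<odot> a = a \<Longrightarrow> c \<odot> b = b \<Longrightarrow> c \<odot> (a \<odot> b) = a \<odot> b"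
  using peirce_1[of c a b 1] by simp

lemma peirce_00: "c \<odot> c = c \<Longrightarrow> c \<odot> a = 0 \<Longrightarrow> c \<odot> b = 0 \<Longrightarrow> c \<odot> (a \<odot> b) = 0"
  using peirce_0[of c a b 0] by simp

text \<open>The full linearisation with \<open>c\<close> inserted twice shows that the product has
  no half-space component, so multiplying it by \<open>c\<close> leaves its 1-component.\<close>

lemma peirce_hh:
  assumes "c \<odot> c = c" "c \<odot> a = (1/2) *\<^sub>R a" "c \<odot> b = (1/2) *\<^sub>R b"
  shows "c \<odot> (c \<odot> (a \<odot> b)) = c \<odot> (a \<odot> b)"
proof -
  have "a \<odot> c = (1/2) *\<^sub>R a" "b \<odot> c = (1/2) *\<^sub>R b" "(a \<odot> b) \<odot> c = c \<odot> (a \<odot> b)" "b \<odot> a = a \<odot> b"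
    using assms comm by metis+
  then show ?thesis
    using jordan_lin2[of c b a c] assms by (simp add: distribs algebra_simps)
qed

text \<open>Multiplication by an idempotent is annihilated by
  \<open>t * (t - 1) * (2 * t - 1)\<close>, so its eigenvalues are among 0, 1/2 and 1.\<close>

lemma peirce_poly: 
  assumes "c \<odot> c = c" 
  shows "2 *\<^sub>R (c \<odot> (c \<odot> (c \<odot> z))) = 3 *\<^sub>R (c \<odot> (c \<odot> z)) - c \<odot> z"
proof -
  have *: "z \<odot> c = c \<odot> z" "(c \<odot> z) \<odot> c = c \<odot> (c \<odot> z)" by (rule comm)+
  have "2 *\<^sub>R (c \<odot> (c \<odot> z)) + c \<odot> (c \<odot> z) = c \<odot> z + 2 *\<^sub>R (c \<odot> (c \<odot> (c \<odot> z)))"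
    using jordan_lin[of c z c] unfolding assms * .
  then have **: "(2 *\<^sub>R (c \<odot> (c \<odot> z)) + c \<odot> (c \<odot> z)) \<bullet> w = (c \<odot> z + 2 *\<^sub>R (c \<odot> (c \<odot> (c \<odot> z)))) \<bullet> w" for w
    by metis
  show ?thesis
  proof (rule vec_eqI)
    fix w
    show "(2 *\<^sub>R (c \<odot> (c \<odot> (c \<odot> z)))) \<bullet> w = (3 *\<^sub>R (c \<odot> (c \<odot> z)) - c \<odot> z) \<bullet> w"
      using **[of w] by (simp add: inner_left_distrib inner_diff_left)
  qed
qed

text \<open>The three projections are the Lagrange polynomials for the nodes 1, 1/2 and 0, evaluated
  at the operator of multiplication by \<open>c\<close>.\<close>

definition peirce_one where "peirce_one c z = 2 *\<^sub>R (c \<odot> (c \<odot> z)) - c \<odot> z"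
definition peirce_half where "peirce_half c z = 4 *\<^sub>R (c \<odot> z) - 4 *\<^sub>R (c \<odot> (c \<odot> z))"
definition peirce_zero where "peirce_zero c z = z - 3 *\<^sub>R (c \<odot> z) + 2 *\<^sub>R (c \<odot> (c \<odot> z))"

lemma peirce_sum: "z = peirce_one c z + peirce_half c z + peirce_zero c z"
  by (rule vec_eqI) (simp add: peirce_one_def peirce_half_def peirce_zero_def inner_simps)

lemma c_peirce:
  assumes "c \<odot> c = c"
  shows "c \<odot> peirce_one c z = peirce_one c z" "c \<odot> peirce_half c z = (1/2) *\<^sub>R peirce_half c z" "c \<odot> peirce_zero c z = 0"
proof -
  have *: "c \<odot> (c \<odot> (c \<odot> z)) = (3/2) *\<^sub>R (c \<odot> (c \<odot> z)) - (1/2) *\<^sub>R (c \<odot> z)"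
    using arg_cong[OF peirce_poly[OF assms, of z], of "scaleR (1/2)"] by (simp add: algebra_simps)
  show "c \<odot> peirce_one c z = peirce_one c z" "c \<odot> peirce_half c z = (1/2) *\<^sub>R peirce_half c z" "c \<odot> peirce_zero c z = 0"
    by (rule vec_eqI, simp add: peirce_one_def peirce_half_def peirce_zero_def distribs * inner_simps)+
qed

lemma idem_split_orth:
  assumes "q \<odot> q = q" "s \<odot> s = s" "q \<odot> s = 0" "(q + s) \<odot> f = 0"
  shows "q \<odot> f = 0" "s \<odot> f = 0"
proof -
  have sq: "s \<odot> q = 0" using assms comm by metis
  have "(q + s) \<odot> (q + s) = q + s" "(q + s) \<odot> q = q" "(q + s) \<odot> s = s"
    using assms sq by (simp_all add: distribs)
  then show "q \<odot> f = 0" "s \<odot> f = 0"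
    using peirce_10 assms(4) by blast+
qed

text \<open>A longest decomposition into nonzero orthogonal idempotents is primitive.\<close>

lemma jframe_exists: "\<exists>r p l. jframe r p \<and> x = lc r p l"
proof -
  define P where "P r \<longleftrightarrow> (\<exists>p l. nsys r p \<and> x = lc r p l)" for r
  have bd: "\<And>r. P r \<Longrightarrow> r \<le> DIM('a)"
    using nsys_bound by (auto simp: P_def)
  have "\<exists>r. P r" using nsys_decomp_exists by (auto simp: P_def)
  then have PG: "P (Greatest P)"
    using GreatestI_ex_nat[of P] bd by blast
  define r where "r = Greatest P"
  obtain p l where p: "nsys r p" "x = lc r p l" using PG by (auto simp: P_def r_def)
  have "primitive (p k)" if k: "k < r" for k
  proof (rule ccontr)
    assume "\<not> primitive (p k)"
    then obtain q s where qs: "q \<odot> q = q" "s \<odot> s = s" "q \<noteq> 0" "s \<noteq> 0" "q \<odot> s = 0" "p k = q + s"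
      using p k unfolding primitive_idempotent_def idempotent_def nsys_def osys_def by blast
    have sq: "s \<odot> q = 0" using qs comm by metis
    define p' where "p' i = (if i = k then q else if i = r then s else p i)" for i
    define l' where "l' i = (if i = r then l k else l i)" for i
    have pp: "p i \<odot> p i = p i" "p i \<noteq> 0" if "i < r" for i
      using p(1) that by (auto simp: nsys_def osys_def)
    have pq: "p i \<odot> p j = 0" if "i < r" "j < r" "i \<noteq> j" for i j
      using p(1) that by (auto simp: nsys_def osys_def)
    have o1: "q \<odot> p i = 0" "s \<odot> p i = 0" if "i < r" "i \<noteq> k" for i
      using idem_split_orth[of q s "p i"] qs pq[OF k, of i] that by metis+
    have o2: "p i \<odot> q = 0" "p i \<odot> s = 0" if "i < r" "i \<noteq> k" for i
      using o1[OF that] comm by metis+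
    have sum_eq: "lc (Suc r) p' (\<lambda>i. f (l' i)) = lc r p (\<lambda>i. f (l i))" for f
    proof -
      have "lc r p' (\<lambda>i. f (l' i)) = f (l k) *\<^sub>R q + (\<Sum>i\<in>{..<r} - {k}. f (l i) *\<^sub>R p i)"
        using k by (subst sum.remove[of _ k]) (auto simp: p'_def l'_def intro!: sum.cong)
      moreover have "lc r p (\<lambda>i. f (l i)) = f (l k) *\<^sub>R p k + (\<Sum>i\<in>{..<r} - {k}. f (l i) *\<^sub>R p i)"
        using k by (subst sum.remove[of _ k]) auto
      moreover have "p' r = s" "l' r = l k" using k by (auto simp: p'_def l'_def)
      ultimately show ?thesis using qs by (simp add: algebra_simps)
    qed
    have "nsys (Suc r) p'"
    proof -
      have "p' i \<odot> p' j = 0" if "i < Suc r" "j < Suc r" "i \<noteq> j" for i j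
        using that o1 o2 qs(5) sq k pq by (auto simp add: p'_def less_Suc_eq)
      moreover have "p' i \<odot> p' i = p' i" "p' i \<noteq> 0" if "i < Suc r" for i
        using that pp[of i] qs(1-4) k by (auto simp add: p'_def less_Suc_eq)
      moreover have "(\<Sum>i<Suc r. p' i) = u"
        using sum_eq[of "\<lambda>_. 1"] p by (simp add: nsys_def osys_def)
      ultimately show ?thesis unfolding nsys_def osys_def by blast
    qed
    moreover have "x = lc (Suc r) p' l'"
      using sum_eq[of "\<lambda>t. t"] p by simp
    ultimately have "P (Suc r)" unfolding P_def by blast
    then have "Suc r \<le> Greatest P" by (rule Greatest_le_nat) (rule bd)
    then have "Suc r \<le> r" by (simp only: r_def)
    then show False by simp
  qed
  then show ?thesis using p unfolding jordan_frame_def nsys_def osys_def by blast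
qed


subsection \<open>Pure states and the cone of squares\<close>

lemma primitive_dichotomy:
  assumes "primitive p" "e \<odot> e = e" "p \<odot> e = e"
  shows "e = 0 \<or> e = p"
proof (rule ccontr)
  assume *: "\<not> (e = 0 \<or> e = p)"
  have ep: "e \<odot> p = e" using assms comm by metis
  have "p \<odot> p = p" using assms primitive_idem by blast
  then have "(p - e) \<odot> (p - e) = p - e" "e \<odot> (p - e) = 0" "p = e + (p - e)" "p - e \<noteq> 0"
    using assms ep * by (auto simp add: distribs)
  then show False
    using assms(1,2) * unfolding primitive_idempotent_def idempotent_def by metis
qed

lemma ev_no_const_A1:
  assumes "p \<odot> p = p" "p \<odot> x = x"
  shows "p \<odot> (x \<odot> ev x w) = x \<odot> ev x w"
proof (induction w)
  case (pCons a w)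
  have "p \<odot> (x \<odot> (x \<odot> ev x w)) = x \<odot> (x \<odot> ev x w)"
    using peirce_11[OF assms pCons(2)] .
  then show ?case using assms by (simp add: distribs)
qed simp

text \<open>A spectral idempotent of \<open>x\<close> with nonzero eigenvalue is a polynomial in
  \<open>x\<close> without constant term. It therefore stays in the 1-space of \<open>p\<close> and
  equals \<open>p\<close> by primitivity, so \<open>x\<close> has at most one nonzero
  eigenvalue.\<close>

lemma primitive_A1:
  assumes "primitive p" "p \<odot> x = x"
  shows "\<exists>t. x = t *\<^sub>R p"
proof -
  obtain r q l where q: "nsys r q" "x = lc r q l" using nsys_decomp_exists by blast
  note o = nsys_osys[OF q(1)]
  define E where "E c = lc r q (\<lambda>i. if l i = c then 1 else 0)" for c
  have Eq: "q j \<odot> E c = (if l j = c then q j else 0)" if "j < r" for j c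
    unfolding E_def using osys_mult_left[OF o that] by simp
  have Ep: "E (l i) = p" if i: "i < r" "l i \<noteq> 0" for i
  proof -
    \<comment> \<open>The extra node 0 forces the constant term of \<open>w\<close> to vanish, even
      if 0 is not an eigenvalue of \<open>x\<close>; a constant term would contribute a multiple of
      \<open>u\<close>, which need not lie in the 1-space.\<close>
    obtain w where w: "\<forall>t\<in>insert 0 (l ` {..<r}). poly w t = (if t = l i then 1 else 0)"
      using poly_interpolation[of "insert 0 (l ` {..<r})" "\<lambda>t. if t = l i then 1 else 0"] by auto
    have "poly w 0 = 0" using w i by auto
    then obtain w' where w': "w = pCons 0 w'"
      by (metis pCons_cases poly_pCons mult_zero_left add.right_neutral)
    have "E (l i) = ev x w"
      unfolding E_def q(2) ev_osys[OF o] using w by (intro sum.cong) auto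
    then have "E (l i) = x \<odot> ev x w'" unfolding w' by simp
    then have "p \<odot> E (l i) = E (l i)"
      using ev_no_const_A1[of p x w'] assms primitive_idem by metis
    moreover have "E (l i) \<odot> E (l i) = E (l i)"
      unfolding E_def osys_mult[OF o] by (intro sum.cong) auto
    moreover have "E (l i) \<noteq> 0"
      using Eq[of i "l i"] i q(1) by (auto simp: nsys_def)
    ultimately show ?thesis using primitive_dichotomy[OF assms(1)] by blast
  qed
  show ?thesis
  proof (cases "\<exists>i<r. l i \<noteq> 0")
    case False
    then have "x = 0 *\<^sub>R p" unfolding q(2) by (simp add: sum.neutral)
    then show ?thesis by blast
  next
    case True
    then obtain i where i: "i < r" "l i \<noteq> 0" by blast
    have "l j = l i \<or> l j = 0" if "j < r" for j
    proof (rule ccontr)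
      assume *: "\<not> (l j = l i \<or> l j = 0)"
      then have "q j \<odot> E (l j) = q j \<odot> E (l i)" using Ep i that by simp
      then have "q j = 0" using Eq[OF that] * by auto
      then show False using q(1) that by (auto simp: nsys_def)
    qed
    then have "x = l i *\<^sub>R E (l i)"
      unfolding q(2) E_def scaleR_sum_right by (intro sum.cong) auto
    then show ?thesis using Ep[OF i] by auto
  qed
qed

text \<open>The pure state of \<open>p\<close>: the coefficient of \<open>p\<close> in the
  1-component of \<open>x\<close>. The ambient inner product merely reads off this coefficient and
  has no relation to the algebra.\<close>

definition phi :: "'a \<Rightarrow> 'a \<Rightarrow> real" where
  "phi p x = (peirce_one p x \<bullet> p) / (p \<bullet> p)"

lemma peirce_one_phi: "primitive p \<Longrightarrow> peirce_one p x = phi p x *\<^sub>R p"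
  using primitive_A1[of p "peirce_one p x"] c_peirce(1)[of p x] primitive_idem[of p] primitive_nonzero[of p]
  by (auto simp: phi_def)

lemma peirce_one_linear: "linear (peirce_one p)"
  by (rule linearI) (simp_all add: peirce_one_def distribs algebra_simps)

lemma phi_linear: "linear (phi p)"
  by (rule linearI)
     (simp_all add: phi_def linear_add[OF peirce_one_linear] linear_scale[OF peirce_one_linear] inner_simps add_divide_distrib)

lemmas phi_add = linear_add[OF phi_linear]
lemmas phi_diff = linear_diff[OF phi_linear]
lemmas phi_scale = linear_scale[OF phi_linear]
lemmas phi_sum = linear_sum[OF phi_linear]

lemma phi_A1: "primitive p \<Longrightarrow> phi p p = 1"
  using primitive_idem[of p] primitive_nonzero[of p] by (simp add: phi_def peirce_one_def scaleR_2)

lemma phi_A0: "p \<odot> x = 0 \<Longrightarrow> phi p x = 0"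
  by (simp add: phi_def peirce_one_def)

lemma phi_Ah: "p \<odot> x = (1/2) *\<^sub>R x \<Longrightarrow> phi p x = 0"
  by (simp add: phi_def peirce_one_def distribs)

lemma phi_unit: "primitive p \<Longrightarrow> phi p u = 1"
  using primitive_idem[of p] primitive_nonzero[of p] by (simp add: phi_def peirce_one_def scaleR_2)

text \<open>For z in the Peirce half space, the component of z^2 along p is an eigenvalue of z^2, hence
  the square of an eigenvalue of z.\<close>

lemma peirce_half_square_phi:
  assumes "primitive p" "p \<odot> z = (1/2) *\<^sub>R z"
  obtains a b where "z \<odot> z = a *\<^sub>R p + b" "p \<odot> b = 0" "a \<ge> 0"
proof -
  have pp: "p \<odot> p = p" using assms primitive_idem by blast
  have "p \<odot> (p \<odot> (z \<odot> z)) = p \<odot> (z \<odot> z)" using peirce_hh[OF pp assms(2) assms(2)] .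
  then obtain a where a: "p \<odot> (z \<odot> z) = a *\<^sub>R p" using primitive_A1[OF assms(1)] by blast
  define b where "b = z \<odot> z - a *\<^sub>R p"
  have zb: "z \<odot> z = a *\<^sub>R p + b" by (simp add: b_def)
  have pb: "p \<odot> b = 0" "b \<odot> p = 0" using a pp comm[of b p] by (simp_all add: b_def distribs)
  have evp: "p \<odot> ev (a *\<^sub>R p + b) q = poly q a *\<^sub>R p" for q
  proof (induction q)
    case (pCons c q)
    define E where "E = ev (a *\<^sub>R p + b) q - poly q a *\<^sub>R p"
    have E: "ev (a *\<^sub>R p + b) q = poly q a *\<^sub>R p + E" by (simp add: E_def)
    have pE: "p \<odot> E = 0" unfolding E_def using pCons pp by (simp add: distribs)
    have "p \<odot> (b \<odot> E) = 0" using peirce_00[OF pp pb(1) pE] .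
    then show ?case
      using pp pb pE unfolding ev_pCons E by (simp add: distribs scaleR_add_left mult.commute)
  qed simp
  obtain r q l where q: "nsys r q" "z = lc r q l" using nsys_decomp_exists by blast
  note o = nsys_osys[OF q(1)]
  let ?w = "\<Prod>t\<in>(\<lambda>i. l i * l i) ` {..<r}. [:-t, 1:]"
  have w0: "poly ?w (l i * l i) = 0" if "i < r" for i
    using that by (auto simp: poly_prod intro!: prod_zero)
  have "z \<odot> z = lc r q (\<lambda>i. l i * l i)" unfolding q(2) using osys_mult[OF o] by simp
  then have "ev (z \<odot> z) ?w = lc r q (\<lambda>i. poly ?w (l i * l i))"
    using ev_osys[OF o] by metis
  also have "\<dots> = 0" using w0 by (intro sum.neutral) auto
  finally have "poly ?w a *\<^sub>R p = 0" using evp[of ?w] zb by simp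
  then have "poly ?w a = 0" using primitive_nonzero[OF assms(1)] by simp
  then obtain i where "a = l i * l i" by (auto simp: poly_prod)
  then have "a \<ge> 0" by simp
  then show thesis using that zb pb by blast
qed

text \<open>In the square of \<open>phi p x *\<^sub>R p + h + k\<close> only the square of the first
  term and \<open>h \<odot> h\<close> have a component along \<open>p\<close>, and the latter is
  nonnegative by \<open>peirce_half_square_phi\<close>.\<close>

lemma phi_sq:
  assumes "primitive p" shows "0 \<le> phi p (x \<odot> x)"
proof -
  have pp: "p \<odot> p = p" using assms primitive_idem by blast
  define h k where "h = peirce_half p x" and "k = peirce_zero p x"
  have h: "p \<odot> h = (1/2) *\<^sub>R h" "h \<odot> p = (1/2) *\<^sub>R h" and k: "p \<odot> k = 0" "k \<odot> p = 0"
    using c_peirce[OF pp, of x] comm[of h p] comm[of k p] by (simp_all add: h_def k_def)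
  have x: "x = phi p x *\<^sub>R p + h + k"
    unfolding h_def k_def using peirce_sum[of x p] peirce_one_phi[OF assms] by metis
  obtain a b where ab: "h \<odot> h = a *\<^sub>R p + b" "p \<odot> b = 0" "a \<ge> 0"
    using peirce_half_square_phi[OF assms h(1)] .
  have kh: "p \<odot> (k \<odot> h) = (1/2) *\<^sub>R (k \<odot> h)" using peirce_0[OF pp k(1) h(1)] .
  have kk: "p \<odot> (k \<odot> k) = 0" using peirce_00[OF pp k(1) k(1)] .
  define t where "t = phi p x"
  have "x \<odot> x = (t * t + a) *\<^sub>R p + b + t *\<^sub>R h + k \<odot> k + 2 *\<^sub>R (k \<odot> h)"
    unfolding x[folded t_def] using pp h k ab(1) comm[of h k]
    by - (rule vec_eqI, simp add: distribs inner_simps algebra_simps)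
  then have "phi p (x \<odot> x) = t * t + a"
    using phi_A1[OF assms] phi_A0[OF ab(2)] phi_Ah[OF h(1)] phi_A0[OF kk] phi_Ah[OF kh]
    by (simp add: phi_add phi_scale)
  then show ?thesis using ab(3) by simp
qed

abbreviation C where "C \<equiv> jcone m"

lemma sq_in_C: "x \<odot> x \<in> C"
  by (simp add: jcone_def)

lemma idem_in_C: "e \<odot> e = e \<Longrightarrow> e \<in> C"
  using sq_in_C by metis

lemma phi_C: "primitive p \<Longrightarrow> x \<in> C \<Longrightarrow> 0 \<le> phi p x"
  using phi_sq by (auto simp: jcone_def)

lemma phi_lc: "jframe r p \<Longrightarrow> i < r \<Longrightarrow> phi (p i) (lc r p l) = l i"
proof -
  assume a: "jframe r p" "i < r"
  then have pr: "primitive (p i)" by (simp add: jordan_frame_def)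
  have "phi (p i) (lc r p l) = (\<Sum>j<r. if j = i then l j else 0)"
    unfolding phi_sum using a
    by (intro sum.cong) (auto simp: phi_scale phi_A1[OF pr] phi_A0 jordan_frame_def)
  then show ?thesis using a by simp
qed

lemma osys_C: 
  assumes "osys r p" "\<And>i. i < r \<Longrightarrow> 0 \<le> l i"
  shows "lc r p l \<in> C"
proof -
  have "lc r p l = lc r p (\<lambda>i. sqrt (l i)) \<odot> lc r p (\<lambda>i. sqrt (l i))"
    unfolding osys_mult[OF assms(1)] using assms(2) by (intro sum.cong) auto
  then show ?thesis using sq_in_C by metis
qed

lemma jframe_C_iff: "jframe r p \<Longrightarrow> lc r p l \<in> C \<longleftrightarrow> (\<forall>i<r. 0 \<le> l i)"
  using osys_C[OF nsys_osys[OF jframe_nsys]] phi_C[of _ "lc r p l"] phi_lc[of r p _ l]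
  by (metis jordan_frame_def)

lemma nsys_C_iff:
  assumes "nsys r p" shows "lc r p l \<in> C \<longleftrightarrow> (\<forall>i<r. 0 \<le> l i)"
proof
  assume C: "lc r p l \<in> C"
  obtain s q k where q: "jframe s q" "lc r p l = lc s q k" using jframe_exists by blast
  show "\<forall>i<r. 0 \<le> l i"
  proof safe
    fix i assume "i < r"
    then obtain j where "j < s" "l i = k j"
      using lc_spectrum_subset[OF assms nsys_osys[OF jframe_nsys[OF q(1)]] q(2)] by auto
    then show "0 \<le> l i" using jframe_C_iff[OF q(1)] C q(2) by simp
  qed
qed (use osys_C[OF nsys_osys[OF assms]] in blast)

text \<open>A frame of \<open>x\<close> already supplies the functionals that detect a negative
  eigenvalue. The cone of squares, not visibly convex or closed, thereby becomes an intersection of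
  closed half spaces.\<close>

lemma C_iff_phi: "x \<in> C \<longleftrightarrow> (\<forall>p. primitive p \<longrightarrow> 0 \<le> phi p x)"
proof
  assume *: "\<forall>p. primitive p \<longrightarrow> 0 \<le> phi p x"
  obtain s q k where q: "jframe s q" "x = lc s q k" using jframe_exists by blast
  then show "x \<in> C" using * jframe_C_iff[OF q(1)] phi_lc[OF q(1)] q(1) unfolding jordan_frame_def by metis
qed (use phi_C in blast)

lemma C_add: "x \<in> C \<Longrightarrow> y \<in> C \<Longrightarrow> x + y \<in> C"
  by (simp add: C_iff_phi phi_add)

lemma C_scale: "x \<in> C \<Longrightarrow> 0 \<le> c \<Longrightarrow> c *\<^sub>R x \<in> C"
  by (simp add: C_iff_phi phi_scale)

lemma C_0: "0 \<in> C"
  by (simp add: C_iff_phi linear_0[OF phi_linear])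

lemma C_sum: "(\<And>i. i \<in> A \<Longrightarrow> f i \<in> C) \<Longrightarrow> sum f A \<in> C"
  by (induction A rule: infinite_finite_induct) (auto simp: C_0 C_add)

lemma C_closed: "closed C"
proof -
  have "C = (\<Inter>p\<in>{p. primitive p}. {x. 0 \<le> phi p x})"
    using C_iff_phi by auto
  moreover have "closed {x. 0 \<le> phi p x}" for p
    by (intro closed_Collect_le continuous_intros linear_continuous_on)
       (simp add: phi_linear linear_conv_bounded_linear[symmetric])
  ultimately show ?thesis by auto
qed

lemma u_in_C: "u \<in> C" using sq_in_C[of u] by simp

lemma C_antisym: "x \<in> C \<Longrightarrow> - x \<in> C \<Longrightarrow> x = 0"
proof -
  assume a: "x \<in> C" "- x \<in> C"
  obtain r p l where q: "jframe r p" "x = lc r p l" using jframe_exists by blast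
  have "- x = lc r p (\<lambda>i. - l i)" by (simp add: q sum_negf)
  then have "\<forall>i<r. l i = 0" using a q jframe_C_iff[OF q(1)] by (metis neg_0_le_iff_le order_antisym)
  then show "x = 0" using q by simp
qed

subsection \<open>Transition probabilities and the trace\<close>

lemma peirce_unique:
  assumes "a + b + d = 0" "c \<odot> a = a" "c \<odot> b = (1/2) *\<^sub>R b" "c \<odot> d = 0"
  shows "a = 0" "b = 0" "d = 0"
proof -
  have 1: "a + (1/2) *\<^sub>R b = 0" using arg_cong[OF assms(1), of "\<lambda>v. c \<odot> v"] assms(2-) by (simp add: distribs)
  have 2: "a + (1/4) *\<^sub>R b = 0" using arg_cong[OF 1, of "\<lambda>v. c \<odot> v"] assms(2-) by (simp add: distribs)
  have "(1/4) *\<^sub>R b = (a + (1/2) *\<^sub>R b) - (a + (1/4) *\<^sub>R b)"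
    by (rule vec_eqI) (simp add: inner_simps)
  then show "b = 0" using 1 2 by simp
  then show "a = 0" "d = 0" using 1 assms by auto
qed

text \<open>The Jordan identity for \<open>h\<close> and \<open>p\<close> gives
  \<open>(h \<odot> h) \<odot> h = 0\<close>, so the square of \<open>h \<odot> h\<close> vanishes
  as well, and formal reality applies twice.\<close>

lemma peirce_h_zero:
  assumes "p \<odot> h = (1/2) *\<^sub>R h" "p \<odot> (h \<odot> h) = 0"
  shows "h = 0"
proof -
  have "h \<odot> p = (1/2) *\<^sub>R h" "(h \<odot> h) \<odot> p = 0" using assms comm by metis+
  then have "(h \<odot> h) \<odot> h = 0" using jordan[of h p] by (simp add: distribs)
  then have "(h \<odot> h) \<odot> (h \<odot> h) = 0" using jordan[of h h] by simp
  then show ?thesis using sq_zero by blast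
qed

text \<open>Compare the Peirce components with respect to p in q q = q and in
  2 q (q p) - q p = phi q p q.\<close>

lemma two_primitives:
  assumes "primitive p" "primitive q"
  obtains h k where "q = phi p q *\<^sub>R p + h + k" "p \<odot> h = (1/2) *\<^sub>R h" "p \<odot> k = 0"
    "h \<odot> h = (phi p q - phi p q * phi p q) *\<^sub>R p + phi p q *\<^sub>R k"
    "h \<odot> k = ((1 - phi p q) / 2) *\<^sub>R h" "k \<odot> k = (1 - phi p q) *\<^sub>R k" "phi q p = phi p q"
proof -
  have pp: "p \<odot> p = p" and qq: "q \<odot> q = q" using assms primitive_idem by blast+
  note p0 = primitive_nonzero[OF assms(1)]
  define h k t where "h = peirce_half p q" and "k = peirce_zero p q" and "t = phi p q"
  have h: "p \<odot> h = (1/2) *\<^sub>R h" "h \<odot> p = (1/2) *\<^sub>R h" and k: "p \<odot> k = 0" "k \<odot> p = 0"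
    using c_peirce[OF pp, of q] comm[of h p] comm[of k p] by (simp_all add: h_def k_def)
  have q: "q = t *\<^sub>R p + h + k"
    unfolding h_def k_def t_def using peirce_sum[of q p] peirce_one_phi[OF assms(1)] by metis
  obtain a b where hh: "h \<odot> h = a *\<^sub>R p + b" and pb: "p \<odot> b = 0"
    using peirce_half_square_phi[OF assms(1) h(1)] by metis
  have hk: "p \<odot> (h \<odot> k) = (1/2) *\<^sub>R (h \<odot> k)" "k \<odot> h = h \<odot> k"
    using peirce_0[OF pp k(1) h(1)] comm[of k h] by simp_all
  have kk: "p \<odot> (k \<odot> k) = 0" using peirce_00[OF pp k(1) k(1)] .
  have "(t * t + a - t) *\<^sub>R p + (t *\<^sub>R h + 2 *\<^sub>R (h \<odot> k) - h) + (b + k \<odot> k - k) = q \<odot> q - q"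
    unfolding q using pp h k hh hk
    by - (rule vec_eqI, simp add: distribs inner_simps algebra_simps)
  also have "\<dots> = 0" using qq by simp
  finally have e: "(t * t + a - t) *\<^sub>R p + (t *\<^sub>R h + 2 *\<^sub>R (h \<odot> k) - h) + (b + k \<odot> k - k) = 0" .
  have A: "p \<odot> ((t * t + a - t) *\<^sub>R p) = (t * t + a - t) *\<^sub>R p"
    and D: "p \<odot> (b + k \<odot> k - k) = 0" using pp kk pb k(1) by (simp_all add: distribs)
  have B: "p \<odot> (t *\<^sub>R h + 2 *\<^sub>R (h \<odot> k) - h) = (1/2) *\<^sub>R (t *\<^sub>R h + 2 *\<^sub>R (h \<odot> k) - h)"
    using h(1) hk(1) by - (rule vec_eqI, simp add: distribs inner_simps algebra_simps)
  have 1: "(t * t + a - t) *\<^sub>R p = 0" and 2: "t *\<^sub>R h + 2 *\<^sub>R (h \<odot> k) - h = 0" and 3: "b + k \<odot> k - k = 0"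
    using peirce_unique[OF e A B D] .
  have a: "a = t - t * t" using 1 p0 by simp
  define s where "s = phi q p"
  have qp: "q \<odot> p = t *\<^sub>R p + (1/2) *\<^sub>R h"
    unfolding q using pp h k by (simp add: distribs)
  have qqp: "q \<odot> (q \<odot> p) = (t * t + a/2) *\<^sub>R p + (3/4 * t) *\<^sub>R h + (1/2) *\<^sub>R (h \<odot> k) + (1/2) *\<^sub>R b"
    unfolding qp unfolding q using pp h k hh hk
    by - (rule vec_eqI, simp add: distribs inner_simps algebra_simps)
  have "peirce_one q p = s *\<^sub>R q" unfolding s_def using peirce_one_phi[OF assms(2)] .
  then have "2 *\<^sub>R (q \<odot> (q \<odot> p)) - q \<odot> p - s *\<^sub>R q = 0" by (simp add: peirce_one_def)
  moreover have "(2 * t * t + a - t - s * t) *\<^sub>R p + ((3/2 * t - 1/2 - s) *\<^sub>R h + h \<odot> k) + (b - s *\<^sub>R k)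
      = 2 *\<^sub>R (q \<odot> (q \<odot> p)) - q \<odot> p - s *\<^sub>R q"
    unfolding qqp unfolding qp unfolding q
    by (rule vec_eqI) (simp add: inner_simps algebra_simps)
  ultimately have e2: "(2 * t * t + a - t - s * t) *\<^sub>R p + ((3/2 * t - 1/2 - s) *\<^sub>R h + h \<odot> k) + (b - s *\<^sub>R k) = 0"
    by simp
  have A: "p \<odot> ((2 * t * t + a - t - s * t) *\<^sub>R p) = (2 * t * t + a - t - s * t) *\<^sub>R p"
    and D: "p \<odot> (b - s *\<^sub>R k) = 0" using pp pb k(1) by (simp_all add: distribs)
  have B: "p \<odot> ((3/2 * t - 1/2 - s) *\<^sub>R h + h \<odot> k) = (1/2) *\<^sub>R ((3/2 * t - 1/2 - s) *\<^sub>R h + h \<odot> k)"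
    using h(1) hk(1) by - (rule vec_eqI, simp add: distribs inner_simps algebra_simps)
  have 4: "(2 * t * t + a - t - s * t) *\<^sub>R p = 0" and 5: "b - s *\<^sub>R k = 0"
    using peirce_unique[OF e2 A B D] by simp_all
  have "2 * t * t + a - t - s * t = 0" using 4 p0 by simp
  then have ts: "t * t = s * t" using a by simp
  \<comment> \<open>\<open>t * t = s * t\<close> leaves the case \<open>t = 0\<close>. There
    \<open>h \<odot> h\<close> has no component along \<open>p\<close>, so \<open>h\<close> vanishes
    and \<open>q\<close> is orthogonal to \<open>p\<close>.\<close>
  have st: "s = t"
  proof (cases "t = 0")
    case True
    then have "p \<odot> (h \<odot> h) = 0" using a hh pb by (simp add: distribs)
    then have "h = 0" using peirce_h_zero h by blast
    then have "q \<odot> p = 0" using True qp by simp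
    then show ?thesis unfolding s_def using phi_A0 True by simp
  qed (use ts in simp)
  have b: "b = t *\<^sub>R k" using 5 st by simp
  have "2 *\<^sub>R (h \<odot> k) = (1 - t) *\<^sub>R h" using 2 by (simp add: algebra_simps)
  then have hk2: "h \<odot> k = ((1 - t) / 2) *\<^sub>R h"
  proof -
    assume *: "2 *\<^sub>R (h \<odot> k) = (1 - t) *\<^sub>R h"
    have "(1/2) *\<^sub>R (2 *\<^sub>R (h \<odot> k)) = (1/2) *\<^sub>R ((1 - t) *\<^sub>R h)" unfolding * ..
    then show ?thesis by simp
  qed
  have kk2: "k \<odot> k = (1 - t) *\<^sub>R k" using 3 b by (simp add: algebra_simps)
  show thesis
    by (rule that[OF q[unfolded t_def] h(1) k(1)])
      (use hh b a hk2 kk2 st in \<open>simp_all add: t_def s_def\<close>)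
qed

lemma phi_symmetric: "primitive p \<Longrightarrow> primitive q \<Longrightarrow> phi q p = phi p q"
  using two_primitives by metis

text \<open>After exchanging the sums and applying \<open>phi_symmetric\<close>, the weight of
  \<open>l j\<close> is the sum of \<open>phi (q j) (p i)\<close> over a frame, which is
  \<open>phi (q j) u = 1\<close>.\<close>

lemma trace_frame:
  assumes "jframe r p" "jframe s q"
  shows "(\<Sum>i<r. phi (p i) (lc s q l)) = (\<Sum>j<s. l j)"
proof -
  have P: "primitive (p i)" if "i < r" for i using assms that by (simp add: jordan_frame_def)
  have Q: "primitive (q j)" if "j < s" for j using assms that by (simp add: jordan_frame_def)
  have "(\<Sum>i<r. phi (p i) (lc s q l)) = (\<Sum>i<r. \<Sum>j<s. l j * phi (q j) (p i))"
    using phi_symmetric[OF P Q] by (intro sum.cong) (auto simp: phi_sum phi_scale)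
  also have "\<dots> = (\<Sum>j<s. l j * (\<Sum>i<r. phi (q j) (p i)))"
    by (subst sum.swap) (simp add: sum_distrib_left)
  also have "\<dots> = (\<Sum>j<s. l j)"
  proof (rule sum.cong[OF refl])
    fix j assume "j \<in> {..<s}"
    then have "(\<Sum>i<r. phi (q j) (p i)) = 1"
      using phi_unit[OF Q] assms(1) by (simp add: phi_sum[symmetric] jordan_frame_def)
    then show "l j * (\<Sum>i<r. phi (q j) (p i)) = l j" by simp
  qed
  finally show ?thesis .
qed

lemma frame_sum_unique:
  assumes "jframe r p" "jframe s q" "lc r p k = lc s q l"
  shows "(\<Sum>i<r. k i) = (\<Sum>j<s. l j)"
  using trace_frame[OF assms(1,1), of k] trace_frame[OF assms(1,2), of l] assms(3) by simp

lemma frame_rank_unique: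
  assumes "jframe r p" "jframe s q" shows "r = s"
  using frame_sum_unique[OF assms, of "\<lambda>_. 1" "\<lambda>_. 1"] assms by (simp add: jordan_frame_def)


subsection \<open>The quadratic representation\<close>

text \<open>The quadratic representation; for the product \<open>(a b + b a) / 2\<close> of matrices
  it is the map from \<open>z\<close> to \<open>a z a\<close>.\<close>

definition U :: "'a \<Rightarrow> 'a \<Rightarrow> 'a" where
  "U a z = 2 *\<^sub>R (a \<odot> (a \<odot> z)) - (a \<odot> a) \<odot> z"

lemma U_linear: "linear (U a)"
  by (rule linearI) (simp_all add: U_def distribs algebra_simps)

lemmas U_add = linear_add[OF U_linear]
lemmas U_diff = linear_diff[OF U_linear]
lemmas U_scale = linear_scale[OF U_linear]
lemmas U_sum = linear_sum[OF U_linear]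

lemma U_idem: "e \<odot> e = e \<Longrightarrow> U e z = peirce_one e z"
  by (simp add: U_def peirce_one_def)

text \<open>The element \<open>u + b *\<^sub>R p\<close> has eigenvalue \<open>1 + b\<close> on
  \<open>p\<close> and 1 on the complement; each Peirce space is scaled by the product of the two
  eigenvalues it connects.\<close>

lemma U_unit_plus:
  assumes "p \<odot> p = p"
  shows "p \<odot> z = z \<Longrightarrow> U (u + b *\<^sub>R p) z = ((1 + b) * (1 + b)) *\<^sub>R z"
    and "p \<odot> z = (1/2) *\<^sub>R z \<Longrightarrow> U (u + b *\<^sub>R p) z = (1 + b) *\<^sub>R z"
    and "p \<odot> z = 0 \<Longrightarrow> U (u + b *\<^sub>R p) z = z"
  using assms unfolding U_def
  by - (rule vec_eqI, simp add: distribs inner_simps algebra_simps)+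

lemma sq_scale_in_C:
  assumes "y \<odot> y = t *\<^sub>R y" "0 \<le> t" shows "y \<in> C"
proof (cases "t = 0")
  case True
  then show ?thesis using assms sq_zero[of y] C_0 by simp
next
  case False
  then have "y = (1/t) *\<^sub>R (y \<odot> y)" using assms by simp
  then show ?thesis using C_scale[OF sq_in_C, of "1/t" y] assms by simp
qed

lemma phi_bounds:
  assumes "primitive p" "primitive q" shows "0 \<le> phi p q" "phi p q \<le> 1"
proof -
  have qq: "q \<odot> q = q" using assms primitive_idem by blast
  then have "(u - q) \<odot> (u - q) = u - q" by (simp add: distribs)
  then have "0 \<le> phi p (u - q)" using phi_C assms idem_in_C by blast
  then show "phi p q \<le> 1" using phi_unit assms by (simp add: phi_diff)
  show "0 \<le> phi p q" using phi_C assms idem_in_C qq by blast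
qed

text \<open>The image of q is an idempotent times a nonnegative number. This is why the quadratic
  representation is positive, without the fundamental formula.\<close>

lemma U_primitive_C:
  assumes "primitive p" "primitive q" "0 \<le> c"
  shows "U (u + (c - 1) *\<^sub>R p) q \<in> C"
proof -
  have pp: "p \<odot> p = p" using assms primitive_idem by blast
  define t where "t = phi p q"
  obtain h k where q: "q = t *\<^sub>R p + h + k" and h: "p \<odot> h = (1/2) *\<^sub>R h" and k: "p \<odot> k = 0"
    and hh: "h \<odot> h = (t - t * t) *\<^sub>R p + t *\<^sub>R k"
    and hk: "h \<odot> k = ((1 - t) / 2) *\<^sub>R h" and kk: "k \<odot> k = (1 - t) *\<^sub>R k"
    using two_primitives[OF assms(1,2)] unfolding t_def by metis
  have c: "h \<odot> p = (1/2) *\<^sub>R h" "k \<odot> p = 0" "k \<odot> h = ((1 - t) / 2) *\<^sub>R h"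
    using h k hk comm by metis+
  have Uq: "U (u + (c - 1) *\<^sub>R p) q = (c * c * t) *\<^sub>R p + c *\<^sub>R h + k"
    unfolding q using U_unit_plus[OF pp, where b = "c - 1"] pp h k by (simp add: U_add U_scale mult.commute)
  define y where "y = U (u + (c - 1) *\<^sub>R p) q"
  have "y \<odot> y = (c * c * t + (1 - t)) *\<^sub>R y"
    unfolding y_def Uq
    by (rule vec_eqI, simp add: pp h k hh hk kk c distribs inner_simps, simp add: algebra_simps)
  moreover have "0 \<le> c * c * t + (1 - t)"
    using phi_bounds[OF assms(1,2)] by (simp add: t_def)
  ultimately show ?thesis unfolding y_def by (rule sq_scale_in_C)
qed

lemma U_unit_plus_C:
  assumes "primitive p" "0 \<le> c" "x \<in> C"
  shows "U (u + (c - 1) *\<^sub>R p) x \<in> C"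
proof -
  obtain r q l where q: "jframe r q" "x = lc r q l" using jframe_exists by blast
  have "l i *\<^sub>R U (u + (c - 1) *\<^sub>R p) (q i) \<in> C" if "i < r" for i
    using U_primitive_C[OF assms(1) _ assms(2)] q assms(3) jframe_C_iff[OF q(1)] that
    by (auto intro!: C_scale simp: jordan_frame_def)
  then show ?thesis unfolding q(2) U_sum U_scale by (intro C_sum) auto
qed

text \<open>Multiplicativity of \<open>U\<close> in the special case of the factors
  \<open>u + c\<close> and \<open>u + b *\<^sub>R p\<close>, checked separately on the Peirce spaces
  of \<open>p\<close>.\<close>

lemma U_orth_product:
  assumes pp: "p \<odot> p = p" and pc: "p \<odot> c = 0"
  shows "U (u + c + b *\<^sub>R p) z = U (u + c) (U (u + b *\<^sub>R p) z)"
proof -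
  have pcc: "p \<odot> (c \<odot> c) = 0" using peirce_00[OF pp pc pc] .
  have cp: "c \<odot> p = 0" using pc comm by metis
  define x h k where "x = peirce_one p z" and "h = peirce_half p z" and "k = peirce_zero p z"
  have z: "z = x + h + k" unfolding x_def h_def k_def by (rule peirce_sum)
  have x: "p \<odot> x = x" and h: "p \<odot> h = (1/2) *\<^sub>R h" and k: "p \<odot> k = 0"
    using c_peirce[OF pp, of z] by (simp_all add: x_def h_def k_def)
  have cx: "c \<odot> x = 0" "(c \<odot> c) \<odot> x = 0"
    using peirce_10[OF pp x pc] peirce_10[OF pp x pcc] comm[of c x] comm[of "c \<odot> c" x] by simp_all
  have ph: "p \<odot> (c \<odot> h) = (1/2) *\<^sub>R (c \<odot> h)" using peirce_0[OF pp pc h] .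
  have pk: "p \<odot> (c \<odot> k) = 0" using peirce_00[OF pp pc k] .
  have hp: "h \<odot> p = (1/2) *\<^sub>R h" "(c \<odot> h) \<odot> p = (1/2) *\<^sub>R (c \<odot> h)" using h ph comm by metis+
  \<comment> \<open>On the half space, multiplication by \<open>c \<odot> c\<close> is twice the
    square of multiplication by \<open>c\<close>; this settles the case of \<open>h\<close>.\<close>
  have cch: "c \<odot> (c \<odot> h) = (1/2) *\<^sub>R ((c \<odot> c) \<odot> h)"
  proof -
    have "(1/2) *\<^sub>R ((c \<odot> c) \<odot> h) = h \<odot> ((c \<odot> c) \<odot> p) + 2 *\<^sub>R (c \<odot> ((c \<odot> h) \<odot> p))"
      using jordan_lin[of c h p] cp hp by (simp add: distribs)
    moreover have "(c \<odot> c) \<odot> p = 0" using pcc comm by metis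
    ultimately show ?thesis using hp by (simp add: distribs)
  qed
  have sq: "(u + c + b *\<^sub>R p) \<odot> (u + c + b *\<^sub>R p) = u + 2 *\<^sub>R c + c \<odot> c + (2 * b + b * b) *\<^sub>R p"
    using pp pc cp by - (rule vec_eqI, simp add: distribs inner_simps algebra_simps)
  have "U (u + c + b *\<^sub>R p) x = U (u + c) (U (u + b *\<^sub>R p) x)"
    unfolding U_unit_plus(1)[OF pp x] U_scale unfolding U_def sq
    using x cx by - (rule vec_eqI, simp add: distribs inner_simps algebra_simps)
  moreover have "U (u + c + b *\<^sub>R p) k = U (u + c) (U (u + b *\<^sub>R p) k)"
    unfolding U_unit_plus(3)[OF pp k] unfolding U_def sq
    using k pk by - (rule vec_eqI, simp add: distribs inner_simps algebra_simps)
  moreover have "U (u + c + b *\<^sub>R p) h = U (u + c) (U (u + b *\<^sub>R p) h)"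
    unfolding U_unit_plus(2)[OF pp h] U_scale unfolding U_def sq
    using h ph cch by - (rule vec_eqI, simp add: distribs inner_simps algebra_simps)
  ultimately show ?thesis unfolding z U_add by simp
qed

text \<open>\<open>a\<close> is the product of the factors
  \<open>u + (l i - 1) *\<^sub>R p i\<close>. \<open>U_orth_product\<close> peels them off one at a
  time, and each of them preserves the cone.\<close>

lemma U_C:
  assumes "a \<in> C" "x \<in> C" shows "U a x \<in> C"
proof -
  obtain r p l where p: "jframe r p" "a = lc r p l" using jframe_exists by blast
  have l: "0 \<le> l i" if "i < r" for i using assms(1) p jframe_C_iff[OF p(1)] that by simp
  have pr: "primitive (p i)" if "i < r" for i using p that by (simp add: jordan_frame_def)
  have orth: "p i \<odot> p j = 0" if "i < r" "j < r" "i \<noteq> j" for i j using p that by (simp add: jordan_frame_def)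
  have "n \<le> r \<Longrightarrow> x \<in> C \<Longrightarrow> U (u + (\<Sum>i<n. (l i - 1) *\<^sub>R p i)) x \<in> C" for n x
  proof (induction n arbitrary: x)
    case 0
    then show ?case by (simp add: U_def scaleR_2)
  next
    case (Suc n)
    have "p n \<odot> (\<Sum>i<n. (l i - 1) *\<^sub>R p i) = 0"
      using orth[of n] Suc.prems by (simp add: sum_right scaleR_right)
    then have "U (u + (\<Sum>i<Suc n. (l i - 1) *\<^sub>R p i)) x
        = U (u + (\<Sum>i<n. (l i - 1) *\<^sub>R p i)) (U (u + (l n - 1) *\<^sub>R p n) x)"
      using U_orth_product[OF primitive_idem[OF pr[of n]]] Suc.prems by (simp add: add.assoc)
    also have "\<dots> \<in> C"
      using Suc.IH U_unit_plus_C[OF pr[of n] l[of n]] Suc.prems by simp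
    finally show ?case .
  qed
  from this[of r x] have "U (u + (\<Sum>i<r. (l i - 1) *\<^sub>R p i)) x \<in> C" using assms by simp
  moreover have "u + (\<Sum>i<r. (l i - 1) *\<^sub>R p i) = a"
    using osys_unit[OF nsys_osys[OF jframe_nsys[OF p(1)]], of 1] p(2)
    by (simp add: algebra_simps sum_subtractf)
  ultimately show ?thesis by simp
qed

text \<open>The element \<open>x\<close> has distinct coefficients 0, 1, 2, ... on the members, so
  every linear combination of the members is a polynomial in \<open>x\<close>.\<close>

lemma opcomm_osys:
  assumes "osys r p" shows "opcomm (lc r p k) (lc r p l)"
proof -
  define x where "x = lc r p real"
  have "\<exists>w. lc r p k = ev x w" for k
  proof -
    obtain w where "\<forall>t\<in>real ` {..<r}. poly w t = k (nat \<lfloor>t\<rfloor>)"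
      using poly_interpolation[of "real ` {..<r}" "\<lambda>t. k (nat \<lfloor>t\<rfloor>)"] by auto
    then have "lc r p k = ev x w"
      unfolding x_def ev_osys[OF assms] by (intro sum.cong) auto
    then show ?thesis by blast
  qed
  then show ?thesis using opcomm_ev by metis
qed

text \<open>\<open>L_sq_mult\<close>, used with \<open>b\<close> squared against \<open>j\<close>
  and against \<open>j \<odot> j\<close>, computes \<open>U b\<close> on both terms of
  \<open>U j z\<close>; the multiplication operators involved commute by
  \<open>opcomm_osys\<close>.\<close>

lemma U_inverse:
  assumes p: "osys r p" and l: "\<And>i. i < r \<Longrightarrow> l i \<noteq> 0"
  shows "U (lc r p l) (U (lc r p (\<lambda>i. inverse (l i))) z) = z"
proof -
  define b j where "b = lc r p l" and "j = lc r p (\<lambda>i. inverse (l i))"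
  have lm: "lc r p f \<odot> lc r p g = lc r p h" if "\<And>i. i < r \<Longrightarrow> f i * g i = h i" for f g h
    unfolding osys_mult[OF p] using that by (intro sum.cong) auto
  have jj: "j \<odot> j = lc r p (\<lambda>i. inverse (l i) * inverse (l i))" unfolding j_def osys_mult[OF p] by simp
  have bb: "b \<odot> b = lc r p (\<lambda>i. l i * l i)" unfolding b_def osys_mult[OF p] by simp
  have u: "u = lc r p (\<lambda>_. 1)" using osys_unit[OF p, of 1] by simp
  have bj: "b \<odot> j = u" unfolding b_def j_def u using l by (intro lm) simp
  have bbj: "(b \<odot> b) \<odot> j = b" unfolding bb unfolding b_def j_def using l by (intro lm) simp
  have bjj: "b \<odot> (j \<odot> j) = j" unfolding jj unfolding b_def j_def using l by (intro lm) simp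
  have bbjj: "(b \<odot> b) \<odot> (j \<odot> j) = u" unfolding jj bb u using l by (intro lm) (simp add: field_simps)
  have c: "b \<odot> (j \<odot> w) = j \<odot> (b \<odot> w)" "b \<odot> ((j \<odot> j) \<odot> w) = (j \<odot> j) \<odot> (b \<odot> w)" for w
    unfolding jj unfolding b_def j_def by (rule opcomm_osys[OF p, unfolded opcomm_def, rule_format])+
  have 1: "U b (j \<odot> w) = b \<odot> w" for w
    using L_sq_mult[of b j w] unfolding bbj bj U_def c[symmetric]
    by (simp add: algebra_simps scaleR_2)
  have 2: "U b ((j \<odot> j) \<odot> w) = 2 *\<^sub>R (j \<odot> (b \<odot> w)) - w" for w
    using L_sq_mult[of b "j \<odot> j" w] unfolding bbjj bjj U_def c(2)[symmetric]
    by (simp add: algebra_simps)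
  have "U b (U j z) = 2 *\<^sub>R U b (j \<odot> (j \<odot> z)) - U b ((j \<odot> j) \<odot> z)"
    unfolding U_def[of j z] by (simp add: U_diff U_scale)
  also have "\<dots> = z" unfolding 1 2 c by simp
  finally show ?thesis unfolding b_def j_def .
qed

text \<open>With v = b - a, the identity U b (inverse a - inverse b) = v + U v (inverse a) exhibits the
  difference as an element of the cone.\<close>

lemma inverse_antitone:
  assumes p: "osys r p" and q: "osys s q"
    and k: "\<And>i. i < r \<Longrightarrow> 0 < k i" and l: "\<And>i. i < s \<Longrightarrow> 0 < l i"
    and le: "lc s q l - lc r p k \<in> C"
  shows "lc r p (\<lambda>i. inverse (k i)) - lc s q (\<lambda>i. inverse (l i)) \<in> C"
proof -
  define a b v where "a = lc r p k" and "b = lc s q l" and "v = b - a"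
  define ja jb where "ja = lc r p (\<lambda>i. inverse (k i))" and "jb = lc s q (\<lambda>i. inverse (l i))"
  have sq: "(a \<odot> a) \<odot> ja = a" "(b \<odot> b) \<odot> jb = b" "a \<odot> ja = u" "b \<odot> jb = u"
  proof -
    have u: "u = lc r p (\<lambda>_. 1)" "u = lc s q (\<lambda>_. 1)"
      using osys_unit[OF p, of 1] osys_unit[OF q, of 1] by simp_all
    show "a \<odot> ja = u" unfolding u(1) a_def ja_def osys_mult[OF p] using k by (intro sum.cong) force+
    show "b \<odot> jb = u" unfolding u(2) b_def jb_def osys_mult[OF q] using l by (intro sum.cong) force+
    show "(a \<odot> a) \<odot> ja = a" unfolding a_def ja_def osys_mult[OF p] using k by (intro sum.cong) force+
    show "(b \<odot> b) \<odot> jb = b" unfolding b_def jb_def osys_mult[OF q] using l by (intro sum.cong) force+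
  qed
  have Uaja: "U a ja = a" and Ubjb: "U b jb = b" unfolding U_def sq by (simp_all add: scaleR_2)
  have cm: "a \<odot> (ja \<odot> v) = ja \<odot> (a \<odot> v)"
    unfolding a_def ja_def by (rule opcomm_osys[OF p, unfolded opcomm_def, rule_format])
  have "U b ja = U a ja + 2 *\<^sub>R (a \<odot> (v \<odot> ja) + v \<odot> (a \<odot> ja) - (a \<odot> v) \<odot> ja) + U v ja"
  proof -
    have "b = a + v" by (simp add: v_def)
    then show ?thesis unfolding U_def
      using comm[of v a] by - (rule vec_eqI, simp add: distribs inner_simps algebra_simps)
  qed
  also have "a \<odot> (v \<odot> ja) = (a \<odot> v) \<odot> ja" using cm comm by metis
  finally have "U b (ja - jb) = v + U v ja"
    unfolding U_diff Ubjb Uaja sq by (simp add: v_def algebra_simps scaleR_2)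
  moreover have "v \<in> C" using le by (simp add: v_def a_def b_def)
  moreover have ja: "ja \<in> C" unfolding ja_def using k by (intro osys_C[OF p]) (simp add: less_imp_le)
  moreover have jb: "jb \<in> C" unfolding jb_def using l by (intro osys_C[OF q]) (simp add: less_imp_le)
  ultimately have "U jb (U b (ja - jb)) \<in> C" by (simp add: C_add U_C)
  moreover have "U jb (U b (ja - jb)) = ja - jb"
    using U_inverse[OF q, of "\<lambda>i. inverse (l i)" "ja - jb"] l unfolding jb_def b_def by force
  ultimately show ?thesis by (simp add: ja_def jb_def)
qed

end


lemma LIMSEQ_if_subseq:
  fixes X :: "nat \<Rightarrow> 'b::metric_space"
  assumes "\<And>s. strict_mono (s :: nat \<Rightarrow> nat) \<Longrightarrow> \<exists>t. strict_mono (t :: nat \<Rightarrow> nat) \<and> (\<lambda>n. X (s (t n))) \<longlonglongrightarrow> L"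
  shows "X \<longlonglongrightarrow> L"
proof (rule ccontr)
  assume "\<not> X \<longlonglongrightarrow> L"
  then obtain e where e: "e > 0" "\<forall>N. \<exists>n\<ge>N. \<not> dist (X n) L < e"
    unfolding lim_sequentially by blast
  have "infinite {n. \<not> dist (X n) L < e}"
    unfolding infinite_nat_iff_unbounded_le using e by auto
  then obtain s :: "nat \<Rightarrow> nat" where s: "strict_mono s" "\<And>n. s n \<in> {n. \<not> dist (X n) L < e}"
    using infinite_enumerate by blast
  then obtain t where t: "strict_mono t" "(\<lambda>n. X (s (t n))) \<longlonglongrightarrow> L" using assms by blast
  then obtain n where "dist (X (s (t n))) L < e" using e unfolding lim_sequentially by blast
  then show False using s by blast
qed

lemma finite_family_subseq:
  fixes f :: "nat \<Rightarrow> nat \<Rightarrow> 'b::heine_borel"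
  assumes "\<And>i. i < r \<Longrightarrow> bounded (range (\<lambda>n. f n i))"
  shows "\<exists>s. strict_mono (s :: nat \<Rightarrow> nat) \<and> (\<exists>q. \<forall>i<r. (\<lambda>n. f (s n) i) \<longlonglongrightarrow> q i)"
  using assms
proof (induction r)
  case 0
  show ?case by (rule exI[of _ id]) (simp add: strict_mono_def)
next
  case (Suc r)
  have "\<exists>s. strict_mono (s :: nat \<Rightarrow> nat) \<and> (\<exists>q. \<forall>i<r. (\<lambda>n. f (s n) i) \<longlonglongrightarrow> q i)"
    by (rule Suc.IH) (rule Suc.prems, simp)
  then obtain s q where s: "strict_mono (s :: nat \<Rightarrow> nat)" "\<forall>i<r. (\<lambda>n. f (s n) i) \<longlonglongrightarrow> q i" by blast
  have "bounded (range (\<lambda>n. f (s n) r))"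
    by (rule bounded_subset[OF Suc.prems[of r]]) auto
  then obtain l t where t: "strict_mono (t :: nat \<Rightarrow> nat)" "((\<lambda>n. f (s n) r) \<circ> t) \<longlonglongrightarrow> l"
    using bounded_imp_convergent_subsequence by blast
  have "(\<lambda>n. f ((s \<circ> t) n) i) \<longlonglongrightarrow> (q(r := l)) i" if "i < Suc r" for i
  proof (cases "i = r")
    case False
    then have "(\<lambda>n. f (s n) i) \<longlonglongrightarrow> q i" using s that by simp
    from LIMSEQ_subseq_LIMSEQ[OF this t(1)] show ?thesis using False by (simp add: o_def)
  qed (use t in \<open>simp add: o_def\<close>)
  moreover have "strict_mono (s \<circ> t)" using s(1) t(1) by (rule strict_mono_o)
  ultimately show ?case by blast
qed

context formally_real_jordan_algebra
begin

subsection \<open>Functional calculus\<close>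

text \<open>Any system of orthogonal idempotents may be used, zero members included;
  \<open>lc_unique\<close> makes the value independent of the choice.\<close>

definition fcalc :: "(real \<Rightarrow> real) \<Rightarrow> 'a \<Rightarrow> 'a" where
  "fcalc f x = (THE y. \<exists>r p l. osys r p \<and> x = lc r p l \<and> y = lc r p (\<lambda>i. f (l i)))"

lemma fcalc_lc: 
  assumes "osys r p" shows "fcalc f (lc r p l) = lc r p (\<lambda>i. f (l i))"
  unfolding fcalc_def
proof (rule the_equality)
  fix y assume "\<exists>s q k. osys s q \<and> lc r p l = lc s q k \<and> y = lc s q (\<lambda>i. f (k i))"
  then obtain s q k where q: "osys s q" "lc r p l = lc s q k" "y = lc s q (\<lambda>i. f (k i))" by blast
  then show "y = lc r p (\<lambda>i. f (l i))" using lc_unique[OF assms q(1,2), of f] by simp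
qed (intro exI conjI, rule assms, rule refl, rule refl)

lemma jframe_osys: "jframe r p \<Longrightarrow> osys r p"
  using jframe_nsys nsys_osys by blast

text \<open>A common length for all frames, so that frames along a sequence can be compared member
  by member.\<close>

definition jrank :: nat where "jrank = (SOME r. \<exists>p. jframe r p)"

lemma jframe_jrank: "jframe r p \<Longrightarrow> r = jrank"
proof -
  assume p: "jframe r p"
  then have "\<exists>p. jframe jrank p" unfolding jrank_def by (rule someI[of "\<lambda>r. \<exists>p. jframe r p", OF exI])
  then show ?thesis using frame_rank_unique[OF p] by blast
qed

lemma decomp: obtains p l where "jframe jrank p" "x = lc jrank p l"
proof -
  obtain r p l where p: "jframe r p" "x = lc r p l" using jframe_exists by blast
  show thesis by (rule that[of p l]) (use p jframe_jrank[OF p(1)] in simp_all)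
qed

lemma jrank_pos: "0 < jrank"
proof -
  obtain p l where "jframe jrank p" "u = lc jrank p l" by (rule decomp)
  then show ?thesis using u_nonzero by (cases "jrank = 0") auto
qed

definition fexp where "fexp = fcalc exp"
definition flog where "flog = fcalc ln"

lemma fexp_lc: "osys r p \<Longrightarrow> fexp (lc r p l) = lc r p (\<lambda>i. exp (l i))"
  by (simp add: fexp_def fcalc_lc)

lemma flog_fexp [simp]: "flog (fexp x) = x"
proof -
  obtain p l where p: "jframe jrank p" "x = lc jrank p l" by (rule decomp)
  then show ?thesis by (simp add: fexp_def flog_def fcalc_lc jframe_osys)
qed

lemma jexp_eq: "jexp m u x = fexp x"
proof -
  obtain p l where p: "jframe jrank p" "x = lc jrank p l" by (rule decomp)
  have e: "\<exists>y r p l. (jframe r p \<and> x = lc r p l) \<and> y = lc r p (\<lambda>i. exp (l i))"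
    by (intro exI conjI) (rule p(1), rule p(2), rule refl)
  show ?thesis
    unfolding jexp_def spectral_decomp_def
  proof (rule someI2_ex[OF e])
    fix y assume "\<exists>r p l. (jframe r p \<and> x = lc r p l) \<and> y = lc r p (\<lambda>i. exp (l i))"
    then obtain s q k where "jframe s q" "x = lc s q k" "y = lc s q (\<lambda>i. exp (k i))" by blast
    then show "y = fexp x" using fexp_lc[OF jframe_osys, of s q k] by simp
  qed
qed

lemma jspectrum_lc: "jframe r p \<Longrightarrow> jspectrum m u (lc r p l) = l ` {..<r}"
proof
  assume p: "jframe r p"
  show "jspectrum m u (lc r p l) \<subseteq> l ` {..<r}"
  proof
    fix c assume "c \<in> jspectrum m u (lc r p l)"
    then obtain s q k i where q: "jframe s q" "lc r p l = lc s q k" "i < s" "k i = c"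
      unfolding jspectrum_def spectral_decomp_def by blast
    then show "c \<in> l ` {..<r}" using lc_spectrum_eq[OF jframe_nsys[OF p] jframe_nsys[OF q(1)] q(2)] by auto
  qed
  show "l ` {..<r} \<subseteq> jspectrum m u (lc r p l)"
  proof
    fix c assume "c \<in> l ` {..<r}"
    then have "jframe r p \<and> lc r p l = lc r p l" "\<exists>i<r. l i = c" using p by auto
    then show "c \<in> jspectrum m u (lc r p l)" unfolding jspectrum_def spectral_decomp_def by blast
  qed
qed

lemma jtrace_lc: "jframe r p \<Longrightarrow> jtrace m u (lc r p l) = (\<Sum>i<r. l i)"
proof -
  assume p: "jframe r p"
  have e: "\<exists>t s q k. (jframe s q \<and> lc r p l = lc s q k) \<and> t = (\<Sum>i<s. k i)"
    by (intro exI conjI) (rule p, rule refl, rule refl)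
  show ?thesis
    unfolding jtrace_def spectral_decomp_def
  proof (rule someI2_ex[OF e])
    fix t assume "\<exists>s q k. (jframe s q \<and> lc r p l = lc s q k) \<and> t = (\<Sum>i<s. k i)"
    then obtain s q k where q: "jframe s q" "lc r p l = lc s q k" "t = (\<Sum>i<s. k i)" by blast
    then show "t = (\<Sum>i<r. l i)" using frame_sum_unique[OF p q(1,2)] by simp
  qed
qed

lemma jtrace_shift: "jtrace m u (x + c *\<^sub>R u) = jtrace m u x + c * real jrank"
proof -
  obtain p l where p: "jframe jrank p" "x = lc jrank p l" by (rule decomp)
  have "x + c *\<^sub>R u = lc jrank p (\<lambda>i. l i + c)"
    unfolding osys_unit[OF jframe_osys[OF p(1)], of c] p(2) by (simp add: scaleR_add_left sum.distrib)
  then show ?thesis using p by (simp add: jtrace_lc sum.distrib)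
qed

text \<open>The chosen frame of \<open>fexp x\<close> is arbitrary. Its coefficients are positive
  because they are values of \<open>exp\<close>, so their logarithms give a frame decomposition of
  \<open>x\<close>, whose trace is unique.\<close>

lemma jdet_fexp: "jdet m u (fexp x) = exp (jtrace m u x)"
  unfolding jdet_def spectral_decomp_def
proof (rule someI2_ex)
  obtain p l where p: "jframe jrank p" "x = lc jrank p l" by (rule decomp)
  have fexp: "fexp x = lc jrank p (\<lambda>i. exp (l i))" unfolding p(2) by (rule fexp_lc[OF jframe_osys[OF p(1)]])
  show "\<exists>t r p l. (jframe r p \<and> fexp x = lc r p l) \<and> t = (\<Prod>i<r. l i)"
    by (intro exI conjI) (rule p(1), rule fexp, rule refl)
  fix t assume "\<exists>r p l. (jframe r p \<and> fexp x = lc r p l) \<and> t = (\<Prod>i<r. l i)"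
  then obtain s q k where q: "jframe s q" "fexp x = lc s q k" "t = (\<Prod>i<s. k i)" by blast
  have "k ` {..<s} = (\<lambda>i. exp (l i)) ` {..<jrank}"
    using lc_spectrum_eq[OF jframe_nsys[OF q(1)] jframe_nsys[OF p(1)]] q(2) fexp by metis
  then have kpos: "0 < k i" if "i < s" for i
    using that by (metis (mono_tags, lifting) exp_gt_zero image_iff lessThan_iff)
  have "x = lc s q (\<lambda>i. ln (k i))"
    using flog_fexp[of x] unfolding q(2) flog_def fcalc_lc[OF jframe_osys[OF q(1)]] by simp
  then have "jtrace m u x = (\<Sum>i<s. ln (k i))" using jtrace_lc[OF q(1)] by simp
  then have "exp (jtrace m u x) = (\<Prod>i<s. exp (ln (k i)))" by (simp add: exp_sum)
  also have "\<dots> = t" unfolding q(3) using kpos by (intro prod.cong) auto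
  finally show "t = exp (jtrace m u x)" by simp
qed

subsection \<open>States and the largest eigenvalue\<close>

definition lam_max :: "'a \<Rightarrow> real" where "lam_max x = Max (jspectrum m u x)"

lemma lam_max_lc: "jframe jrank p \<Longrightarrow> lam_max (lc jrank p l) = Max (l ` {..<jrank})"
  by (simp add: lam_max_def jspectrum_lc)

lemma nsys_unit_diff_C_iff:
  assumes "nsys r p" shows "t *\<^sub>R u - lc r p l \<in> C \<longleftrightarrow> (\<forall>i<r. l i \<le> t)"
proof -
  have "t *\<^sub>R u - lc r p l = lc r p (\<lambda>i. t - l i)"
    unfolding osys_unit[OF nsys_osys[OF assms], of t] by (simp add: scaleR_diff_left sum_subtractf)
  then show ?thesis using nsys_C_iff[OF assms, of "\<lambda>i. t - l i"] by simp
qed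

text \<open>This order form of the largest eigenvalue yields shifts, subadditivity and monotonicity
  without comparing spectra of different elements.\<close>

lemma lam_max_le_iff: "lam_max x \<le> t \<longleftrightarrow> t *\<^sub>R u - x \<in> C"
proof -
  obtain p l where p: "jframe jrank p" "x = lc jrank p l" by (rule decomp)
  have "lam_max x \<le> t \<longleftrightarrow> (\<forall>i<jrank. l i \<le> t)"
    unfolding p(2) lam_max_lc[OF p(1)] using jrank_pos by (subst Max_le_iff) auto
  then show ?thesis using nsys_unit_diff_C_iff[OF jframe_nsys[OF p(1)]] p(2) by simp
qed

lemma lam_max_diff_C: "lam_max x *\<^sub>R u - x \<in> C"
  using lam_max_le_iff[of x "lam_max x"] by simp

lemma lam_max_nsys:
  assumes "nsys r p"
  shows "i < r \<Longrightarrow> l i \<le> lam_max (lc r p l)" and "\<exists>i<r. lam_max (lc r p l) = l i"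
proof -
  have "0 < r" using assms u_nonzero by (cases "r = 0") (auto simp: nsys_def osys_def)
  have *: "lam_max (lc r p l) \<le> t \<longleftrightarrow> (\<forall>i<r. l i \<le> t)" for t
    using lam_max_le_iff nsys_unit_diff_C_iff[OF assms] by simp
  show ge: "i < r \<Longrightarrow> l i \<le> lam_max (lc r p l)" for i using *[of "lam_max (lc r p l)"] by simp
  have "Max (l ` {..<r}) \<in> l ` {..<r}" using \<open>0 < r\<close> by (intro Max_in) auto
  then obtain i where i: "i < r" "l i = Max (l ` {..<r})" by auto
  then have "lam_max (lc r p l) \<le> l i" using * by simp
  then show "\<exists>i<r. lam_max (lc r p l) = l i" using i(1) ge by (metis order_antisym)
qed

lemma lam_max_shift: "lam_max (x + c *\<^sub>R u) = lam_max x + c"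
proof -
  have "lam_max (x + c *\<^sub>R u) \<le> t \<longleftrightarrow> lam_max x + c \<le> t" for t
    using lam_max_le_iff[of "x + c *\<^sub>R u" t] lam_max_le_iff[of x "t - c"] by (simp add: algebra_simps)
  then show ?thesis by (metis order_antisym order_refl)
qed

lemma lam_max_add: "lam_max (x + y) \<le> lam_max x + lam_max y"
  using C_add[OF lam_max_diff_C[of x] lam_max_diff_C[of y]] unfolding lam_max_le_iff by (simp add: algebra_simps)

lemma lam_max_scale:
  assumes "0 \<le> c" shows "lam_max (c *\<^sub>R x) = c * lam_max x"
proof -
  obtain p l where p: "jframe jrank p" "x = lc jrank p l" by (rule decomp)
  have cx: "c *\<^sub>R x = lc jrank p (\<lambda>i. c * l i)" unfolding p(2) by (simp add: scaleR_sum_right)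
  have "(\<lambda>i. c * l i) ` {..<jrank} = (\<lambda>t. c * t) ` (l ` {..<jrank})" by auto
  moreover have "mono (\<lambda>t. c * t)" using assms by (simp add: mono_def mult_left_mono)
  ultimately show ?thesis unfolding cx lam_max_lc[OF p(1)] unfolding p(2) lam_max_lc[OF p(1)]
    using jrank_pos mono_Max_commute[of "\<lambda>t. c * t" "l ` {..<jrank}"] by (simp add: image_image lessThan_empty_iff)
qed

lemma lam_max_0 [simp]: "lam_max 0 = 0"
  using lam_max_scale[of 0 0] by simp

lemma lam_max_mono: "y - x \<in> C \<Longrightarrow> lam_max x \<le> lam_max y"
  using C_add[of "y - x" "lam_max y *\<^sub>R u - y"] lam_max_diff_C lam_max_le_iff by simp

lemma lam_max_nonneg: "x \<in> C \<Longrightarrow> 0 \<le> lam_max x"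
  using lam_max_mono[of x 0] by simp

lemma C_iff_lam_max: "x \<in> C \<longleftrightarrow> lam_max (- x) \<le> 0"
  using lam_max_le_iff[of "- x" 0] by simp

lemma lam_max_neg: "- lam_max (- x) \<le> lam_max x"
  using lam_max_add[of x "- x"] by simp

lemma lam_max_zero_imp: "lam_max x \<le> 0 \<Longrightarrow> lam_max (- x) \<le> 0 \<Longrightarrow> x = 0"
  using C_antisym[of x] C_iff_lam_max[of x] C_iff_lam_max[of "- x"] by simp

lemma lam_max_C_zero: "x \<in> C \<Longrightarrow> lam_max x \<le> 0 \<Longrightarrow> x = 0"
  using lam_max_zero_imp C_iff_lam_max by blast

text \<open>Normalised positive functionals are represented by vectors through the ambient inner
  product, so that they form a compact subset of the algebra's own space.\<close>

definition states :: "'a set" where "states = {v. (\<forall>x\<in>C. 0 \<le> x \<bullet> v) \<and> u \<bullet> v = 1}"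

lemma states_C: "v \<in> states \<Longrightarrow> x \<in> C \<Longrightarrow> 0 \<le> x \<bullet> v"
  by (simp add: states_def)

lemma states_u [simp]: "v \<in> states \<Longrightarrow> u \<bullet> v = 1"
  by (simp add: states_def)

lemma states_represent:
  assumes "linear f" "\<And>x. x \<in> C \<Longrightarrow> 0 \<le> f x" "f u = 1"
  obtains v where "v \<in> states" "\<And>x. f x = x \<bullet> v"
proof -
  define v where "v = (\<Sum>b\<in>Basis. f b *\<^sub>R b)"
  have fx: "f x = x \<bullet> v" for x
  proof -
    have "f x = f (\<Sum>b\<in>Basis. (x \<bullet> b) *\<^sub>R b)" by (simp add: euclidean_representation)
    then show ?thesis unfolding linear_sum[OF assms(1)]
      by (simp add: linear_scale[OF assms(1)] v_def inner_sum_right mult.commute)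
  qed
  have "v \<in> states" using assms(2,3) unfolding fx states_def by blast
  then show thesis using that fx by blast
qed

lemma states_phi:
  assumes "primitive p" obtains v where "v \<in> states" "\<And>x. phi p x = x \<bullet> v"
  using states_represent[OF phi_linear] phi_C[OF assms] phi_unit[OF assms] by metis

lemma states_le_lam_max: "v \<in> states \<Longrightarrow> x \<bullet> v \<le> lam_max x"
  using states_C[OF _ lam_max_diff_C, of v x] by (simp add: inner_diff_left)

lemma states_frame:
  assumes "jframe r p" "i < r" obtains v where "v \<in> states" "\<And>l. lc r p l \<bullet> v = l i"
  using states_phi[of "p i"] phi_lc[OF assms] assms unfolding jordan_frame_def by metis

lemma lam_max_attained: "\<exists>v\<in>states. x \<bullet> v = lam_max x"
proof -
  obtain p l where p: "jframe jrank p" "x = lc jrank p l" by (rule decomp)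
  obtain i where "i < jrank" "lam_max x = l i" using lam_max_nsys(2)[OF jframe_nsys[OF p(1)]] p(2) by blast
  then show ?thesis using states_frame[OF p(1)] p(2) by metis
qed

lemma C_iff_states: "x \<in> C \<longleftrightarrow> (\<forall>v\<in>states. 0 \<le> x \<bullet> v)"
proof
  assume *: "\<forall>v\<in>states. 0 \<le> x \<bullet> v"
  obtain v where "v \<in> states" "(- x) \<bullet> v = lam_max (- x)" using lam_max_attained by blast
  then show "x \<in> C" using * C_iff_lam_max by fastforce
qed (use states_C in blast)

lemma states_compact: "compact states"
proof -
  have e: "states = (\<Inter>x\<in>C. {v. 0 \<le> x \<bullet> v}) \<inter> {v. u \<bullet> v = 1}"
    unfolding states_def by blast
  have cl: "closed ((\<Inter>x\<in>C. {v. 0 \<le> x \<bullet> v}) \<inter> {v. u \<bullet> v = 1})"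
    by (intro closed_Int closed_INT ballI closed_Collect_le closed_Collect_eq continuous_intros)
  have "norm v \<le> (\<Sum>b\<in>Basis. max (lam_max b) (lam_max (- b)))" if "v \<in> states" for v
  proof -
    have "norm v \<le> (\<Sum>b\<in>Basis. \<bar>v \<bullet> b\<bar>)" by (rule norm_le_l1)
    also have "\<dots> \<le> (\<Sum>b\<in>Basis. max (lam_max b) (lam_max (- b)))"
    proof (rule sum_mono)
      fix b :: 'a
      show "\<bar>v \<bullet> b\<bar> \<le> max (lam_max b) (lam_max (- b))"
        using states_le_lam_max[OF that, of b] states_le_lam_max[OF that, of "- b"]
        unfolding inner_commute[of v b] inner_minus_left by linarith
    qed
    finally show ?thesis .
  qed
  then have "bounded states" unfolding bounded_iff by blast
  then show ?thesis unfolding compact_eq_bounded_closed using cl[folded e] by blast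
qed

lemma states_nonempty: "states \<noteq> {}"
  using lam_max_attained by blast

lemma lam_max_bound: "\<exists>K>0. \<forall>x. lam_max x \<le> K * norm x"
proof -
  obtain K where K: "K > 0" "\<And>v. v \<in> states \<Longrightarrow> norm v \<le> K"
    using compact_imp_bounded[OF states_compact] unfolding bounded_pos by blast
  have "lam_max x \<le> K * norm x" for x
  proof -
    obtain v where v: "v \<in> states" "x \<bullet> v = lam_max x" using lam_max_attained by blast
    have "x \<bullet> v \<le> norm x * norm v" by (rule norm_cauchy_schwarz)
    also have "\<dots> \<le> norm x * K" using K v by (intro mult_left_mono) auto
    finally show ?thesis using v by (simp add: mult.commute)
  qed
  then show ?thesis using K by blast
qed

lemma lam_max_lipschitz: "\<exists>K>0. \<forall>x y. \<bar>lam_max x - lam_max y\<bar> \<le> K * norm (x - y)"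
proof -
  obtain K where K: "K > 0" "\<And>x. lam_max x \<le> K * norm x" using lam_max_bound by blast
  have "\<bar>lam_max x - lam_max y\<bar> \<le> K * norm (x - y)" for x y
    using lam_max_add[of "x - y" y] lam_max_add[of "y - x" x] K(2)[of "x - y"] K(2)[of "y - x"]
    by (simp add: norm_minus_commute)
  then show ?thesis using K by blast
qed

lemma lam_max_continuous: "continuous_on S lam_max"
proof -
  obtain K where K: "K > 0" "\<And>x y. \<bar>lam_max x - lam_max y\<bar> \<le> K * norm (x - y)" using lam_max_lipschitz by blast
  have "lipschitz_on K S lam_max"
    using K by (intro lipschitz_onI) (auto simp: dist_real_def dist_norm)
  then show ?thesis by (rule lipschitz_on_continuous_on)
qed

lemma lam_max_tendsto: "(f \<longlongrightarrow> x) F \<Longrightarrow> ((\<lambda>n. lam_max (f n)) \<longlongrightarrow> lam_max x) F"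
  using lam_max_continuous[of UNIV] continuous_on_tendsto_compose by force

text \<open>The maximum on the right is continuous, positively homogeneous and positive away from 0,
  so it has a positive minimum on the unit sphere.\<close>

lemma norm_le_lam_max: "\<exists>K>0. \<forall>x. norm x \<le> K * max (lam_max x) (lam_max (- x))"
proof -
  define N where "N x = max (lam_max x) (lam_max (- x))" for x
  have Npos: "0 < N x" if "x \<noteq> 0" for x
    using lam_max_zero_imp[of x] that unfolding N_def by fastforce
  have "continuous_on (sphere 0 1) N" unfolding N_def
    by (intro continuous_intros lam_max_continuous continuous_on_compose2[OF lam_max_continuous[of UNIV]]) auto
  moreover have "sphere (0::'a) 1 \<noteq> {}" using nonempty_Basis norm_Basis by force
  ultimately obtain z where z: "z \<in> sphere 0 1" "\<And>y. y \<in> sphere 0 1 \<Longrightarrow> N z \<le> N y"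
    using continuous_attains_inf[OF compact_sphere] by metis
  have zp: "0 < N z" using z(1) by (intro Npos) auto
  have "norm x \<le> (1 / N z) * N x" for x
  proof (cases "x = 0")
    case False
    have e: "- x /\<^sub>R norm x = (1 / norm x) *\<^sub>R (- x)" "x /\<^sub>R norm x = (1 / norm x) *\<^sub>R x" by (simp_all add: divide_inverse)
    have "N z \<le> N (x /\<^sub>R norm x)" using False by (intro z(2)) simp
    also have "\<dots> = (1 / norm x) * N x"
      unfolding N_def using lam_max_scale[of "1 / norm x"] 
      by (simp add: max_mult_distrib_left e(2) flip: scaleR_minus_right)
    finally show ?thesis using False zp by (simp add: field_simps)
  qed (simp add: N_def)
  moreover have "0 < 1 / N z" using zp by simp
  ultimately show ?thesis unfolding N_def by blast
qed

text \<open>The order interval from 0 to \<open>u\<close>; both components of every parameter lie in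
  it.\<close>

abbreviation B where "B \<equiv> {Y. Y \<in> C \<and> u - Y \<in> C}"

lemma B_compact: "compact B"
proof -
  obtain K where K: "K > 0" "\<And>x. norm x \<le> K * max (lam_max x) (lam_max (- x))" using norm_le_lam_max by blast
  have "norm Y \<le> K" if "Y \<in> B" for Y
  proof -
    have "max (lam_max Y) (lam_max (- Y)) \<le> 1"
      using that lam_max_le_iff[of Y 1] C_iff_lam_max[of Y] by auto
    then have "K * max (lam_max Y) (lam_max (- Y)) \<le> K * 1" using K(1) by (intro mult_left_mono) auto
    then show ?thesis using K(2)[of Y] by simp
  qed
  then have "bounded B" unfolding bounded_iff by blast
  have e: "B = C \<inter> (\<lambda>Y. u - Y) -` C" by blast
  have "closed ((\<lambda>Y. u - Y) -` C)"
    by (intro continuous_closed_vimage C_closed continuous_intros)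
  then have "closed B" unfolding e using C_closed by (intro closed_Int)
  with \<open>bounded B\<close> show ?thesis unfolding compact_eq_bounded_closed by blast
qed

subsection \<open>Compactness of spectral decompositions\<close>

lemma idem_in_B: "e \<odot> e = e \<Longrightarrow> e \<in> B"
  using idem_in_C[of e] idem_in_C[of "u - e"] by (simp add: distribs)

text \<open>Idempotents lie in the compact order interval, and the defining equations pass to
  limits. So does nonvanishing, because \<open>norm e \<le> norm e * norm e * M\<close> bounds the
  norms of nonzero idempotents from below.\<close>

lemma nsys_compact:
  fixes l :: "nat \<Rightarrow> nat \<Rightarrow> real"
  assumes p: "\<And>n. nsys r (p n)" and l: "\<And>n i. i < r \<Longrightarrow> \<bar>l n i\<bar> \<le> K"
  shows "\<exists>s q k. strict_mono (s :: nat \<Rightarrow> nat) \<and> nsys r q \<and> (\<forall>i<r. (\<lambda>n. p (s n) i) \<longlonglongrightarrow> q i)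
    \<and> (\<forall>i<r. (\<lambda>n. l (s n) i) \<longlonglongrightarrow> k i)"
proof -
  have idem: "p n i \<odot> p n i = p n i" if "i < r" for n i
    using p that by (auto simp: nsys_def osys_def)
  have "bounded (range (\<lambda>n. p n i))" if "i < r" for i
    using compact_imp_bounded[OF B_compact] by (rule bounded_subset) (use idem idem_in_B that in blast)
  then obtain s q where s: "strict_mono (s :: nat \<Rightarrow> nat)" "\<forall>i<r. (\<lambda>n. p (s n) i) \<longlonglongrightarrow> q i"
    using finite_family_subseq[of r p] by blast
  have "bounded (range (\<lambda>n. l (s n) i))" if "i < r" for i
    using l[OF that] by (auto simp: bounded_iff)
  then obtain t k where t: "strict_mono (t :: nat \<Rightarrow> nat)" "\<forall>i<r. (\<lambda>n. l (s (t n)) i) \<longlonglongrightarrow> k i"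
    using finite_family_subseq[of r "\<lambda>n. l (s n)"] by blast
  have pq: "(\<lambda>n. p (s (t n)) i) \<longlonglongrightarrow> q i" if "i < r" for i
    using LIMSEQ_subseq_LIMSEQ[OF s(2)[rule_format, OF that] t(1)] by (simp add: o_def)
  obtain M where M: "M > 0" "\<And>x y. norm (x \<odot> y) \<le> norm x * norm y * M"
    using pos_bounded by blast
  have "nsys r q"
    unfolding nsys_def osys_def
  proof (intro conjI allI impI)
    fix i assume i: "i < r"
    show "q i \<odot> q i = q i"
      using LIMSEQ_unique[OF tendsto[OF pq[OF i] pq[OF i]]] pq[OF i] idem[OF i] by simp
    have "1 / M \<le> norm (p (s (t n)) i)" for n
    proof -
      have n0: "p (s (t n)) i \<noteq> 0" using p i by (auto simp: nsys_def)
      have "norm (p (s (t n)) i) \<le> norm (p (s (t n)) i) * norm (p (s (t n)) i) * M"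
        using M(2)[of "p (s (t n)) i" "p (s (t n)) i"] idem[OF i] by simp
      then show ?thesis using n0 M(1) by (simp add: field_simps)
    qed
    then have "1 / M \<le> norm (q i)"
      using tendsto_norm[OF pq[OF i]] by (intro LIMSEQ_le_const) auto
    then show "q i \<noteq> 0" using M(1) by auto
  next
    fix i j assume ij: "i < r" "j < r" "i \<noteq> j"
    then have "p n i \<odot> p n j = 0" for n using p by (auto simp: nsys_def osys_def)
    then show "q i \<odot> q j = 0"
      using LIMSEQ_unique[OF tendsto[OF pq[OF ij(1)] pq[OF ij(2)]]] by simp
  next
    have "(\<lambda>n. \<Sum>i<r. p (s (t n)) i) \<longlonglongrightarrow> (\<Sum>i<r. q i)" using pq by (intro tendsto_sum) auto
    moreover have "(\<Sum>i<r. p n i) = u" for n using p by (auto simp: nsys_def osys_def)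
    ultimately show "(\<Sum>i<r. q i) = u" by (simp add: LIMSEQ_const_iff)
  qed
  moreover have "strict_mono (s \<circ> t)" using s t strict_mono_o by blast
  ultimately show ?thesis using pq t by (intro exI[of _ "s \<circ> t"]) auto
qed

lemma tendsto_lc:
  assumes "\<And>i. i < r \<Longrightarrow> (\<lambda>n. p n i) \<longlonglongrightarrow> q i" "\<And>i. i < r \<Longrightarrow> (\<lambda>n. l n i) \<longlonglongrightarrow> k i"
  shows "(\<lambda>n. lc r (p n) (l n)) \<longlonglongrightarrow> lc r q k"
  using assms by (intro tendsto_sum tendsto_scaleR) auto

lemma eigenvalue_bound:
  assumes "nsys r p" "i < r" shows "\<bar>l i\<bar> \<le> max (lam_max (lc r p l)) (lam_max (- lc r p l))"
proof -
  have "- lc r p l = lc r p (\<lambda>i. - l i)" by (simp add: sum_negf)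
  then show ?thesis
    using lam_max_nsys(1)[OF assms, of l] lam_max_nsys(1)[OF assms, of "\<lambda>i. - l i"] by fastforce
qed

text \<open>Frames need not vary continuously with the element. Instead, every subsequence has a
  further one along which frames and eigenvalues converge, and the limit decomposes
  \<open>a\<close>.\<close>

lemma fcalc_sequentially:
  assumes f: "continuous_on UNIV f" and x: "x \<longlonglongrightarrow> a"
  shows "(\<lambda>n. fcalc f (x n)) \<longlonglongrightarrow> fcalc f a"
proof (rule LIMSEQ_if_subseq)
  fix s :: "nat \<Rightarrow> nat" assume s: "strict_mono s"
  have "\<exists>p l. jframe jrank p \<and> x (s n) = lc jrank p l" for n using decomp by metis
  then obtain p l where p: "\<And>n. jframe jrank (p n)" "\<And>n. x (s n) = lc jrank (p n) (l n)" by metis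
  have xs: "(\<lambda>n. x (s n)) \<longlonglongrightarrow> a" using LIMSEQ_subseq_LIMSEQ[OF x s] by (simp add: o_def)
  note cv = tendsto_max[OF lam_max_tendsto[OF xs] lam_max_tendsto[OF tendsto_minus[OF xs]]]
  obtain K where K: "\<And>n. norm (max (lam_max (x (s n))) (lam_max (- x (s n)))) \<le> K"
    using convergent_imp_bounded[OF cv] unfolding bounded_iff by blast
  have lK: "\<bar>l n i\<bar> \<le> K" if "i < jrank" for n i
    using eigenvalue_bound[OF jframe_nsys[OF p(1)[of n]] that, where l = "l n"] K[of n]
    unfolding p(2)[symmetric] real_norm_def by linarith
  then obtain t q k where t: "strict_mono (t :: nat \<Rightarrow> nat)" "nsys jrank q"
    "\<And>i. i < jrank \<Longrightarrow> (\<lambda>n. p (t n) i) \<longlonglongrightarrow> q i" "\<And>i. i < jrank \<Longrightarrow> (\<lambda>n. l (t n) i) \<longlonglongrightarrow> k i"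
    using nsys_compact[of jrank p l K, OF jframe_nsys[OF p(1)] lK] by blast
  have "(\<lambda>n. x (s (t n))) \<longlonglongrightarrow> lc jrank q k" unfolding p(2) using t by (intro tendsto_lc) auto
  moreover have "(\<lambda>n. x (s (t n))) \<longlonglongrightarrow> a" using LIMSEQ_subseq_LIMSEQ[OF xs t(1)] by (simp add: o_def)
  ultimately have a: "a = lc jrank q k" using LIMSEQ_unique by blast
  have "(\<lambda>n. f (l (t n) i)) \<longlonglongrightarrow> f (k i)" if "i < jrank" for i
    using continuous_on_tendsto_compose[OF f t(4)[OF that]] by simp
  then have "(\<lambda>n. lc jrank (p (t n)) (\<lambda>i. f (l (t n) i))) \<longlonglongrightarrow> lc jrank q (\<lambda>i. f (k i))"
    using t by (intro tendsto_lc) auto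
  then have "(\<lambda>n. fcalc f (x (s (t n)))) \<longlonglongrightarrow> fcalc f a"
    unfolding p(2) a fcalc_lc[OF jframe_osys[OF p(1)]] fcalc_lc[OF nsys_osys[OF t(2)]] .
  then show "\<exists>t. strict_mono t \<and> (\<lambda>n. fcalc f (x (s (t n)))) \<longlonglongrightarrow> fcalc f a" using t(1) by blast
qed

lemma fcalc_continuous: "continuous_on UNIV f \<Longrightarrow> continuous_on S (fcalc f)"
  by (rule continuous_on_sequentiallyI) (use fcalc_sequentially in blast)


subsection \<open>The interior of the cone\<close>

lemma interior_C_iff: "x \<in> interior C \<longleftrightarrow> (\<exists>e>0. x - e *\<^sub>R u \<in> C)"
proof
  assume "x \<in> interior C"
  then obtain d where d: "d > 0" "ball x d \<subseteq> C" using mem_interior by blast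
  define e where "e = d / (2 * norm u)"
  have "e > 0" using d u_nonzero by (simp add: e_def)
  moreover have "dist x (x - e *\<^sub>R u) < d" using d u_nonzero by (simp add: dist_norm e_def)
  ultimately show "\<exists>e>0. x - e *\<^sub>R u \<in> C" using d(2) mem_ball by blast
next
  assume "\<exists>e>0. x - e *\<^sub>R u \<in> C"
  then obtain e where e: "e > 0" "x - e *\<^sub>R u \<in> C" by blast
  obtain K where K: "K > 0" "\<And>x. lam_max x \<le> K * norm x" using lam_max_bound by blast
  have "y \<in> C" if "y \<in> ball x (e / K)" for y
  proof -
    have "lam_max (x - y) \<le> K * norm (x - y)" by (rule K)
    also have "\<dots> \<le> e" using that K(1) by (simp add: dist_norm field_simps)
    finally have "e *\<^sub>R u - (x - y) \<in> C" using lam_max_le_iff by blast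
    from C_add[OF e(2) this] show ?thesis by simp
  qed
  moreover have "e / K > 0" using e K by simp
  ultimately show "x \<in> interior C" unfolding mem_interior by blast
qed

lemma fexp_unit_lower: "\<exists>e>0. fexp x - e *\<^sub>R u \<in> C"
proof -
  obtain p l where p: "jframe jrank p" "x = lc jrank p l" by (rule decomp)
  have o: "osys jrank p" using p jframe_osys by blast
  define e where "e = exp (- lam_max (- x))"
  have le: "e \<le> exp (l i)" if "i < jrank" for i
  proof -
    have "- x = lc jrank p (\<lambda>i. - l i)" unfolding p(2) by (simp add: sum_negf)
    then have "- l i \<le> lam_max (- x)" using lam_max_nsys(1)[OF jframe_nsys[OF p(1)] that, of "\<lambda>i. - l i"] by simp
    then show ?thesis unfolding e_def by simp
  qed
  have "fexp x - e *\<^sub>R u = lc jrank p (\<lambda>i. exp (l i) - e)"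
    unfolding p(2) fexp_lc[OF o] osys_unit[OF o, of e] by (simp add: scaleR_diff_left sum_subtractf)
  also have "\<dots> \<in> C" using le by (intro osys_C[OF o]) simp
  finally show ?thesis unfolding e_def using exp_gt_zero by blast
qed

lemma fexp_C: "fexp x \<in> C"
proof -
  obtain e where e: "e > 0" "fexp x - e *\<^sub>R u \<in> C" using fexp_unit_lower by blast
  from C_add[OF e(2) C_scale[OF u_in_C, of e]] e(1) show ?thesis by simp
qed

lemma fexp_flog_pos:
  assumes "x - e *\<^sub>R u \<in> C" "e > 0" shows "fexp (flog x) = x"
proof -
  obtain p l where p: "jframe jrank p" "x = lc jrank p l" by (rule decomp)
  have o: "osys jrank p" using p jframe_osys by blast
  have "x - e *\<^sub>R u = lc jrank p (\<lambda>i. l i - e)"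
    unfolding p(2) osys_unit[OF o, of e] by (simp add: scaleR_diff_left sum_subtractf)
  then have "\<forall>i<jrank. 0 \<le> l i - e" using assms(1) jframe_C_iff[OF p(1)] by metis
  then have "0 < l i" if "i < jrank" for i using that assms(2) by force
  then show ?thesis unfolding p(2) flog_def fexp_def fcalc_lc[OF o] by (intro sum.cong) auto
qed

lemma interior_C_fexp: "interior C = range fexp"
proof
  show "interior C \<subseteq> range fexp" using interior_C_iff fexp_flog_pos by (metis rangeI subsetI)
  show "range fexp \<subseteq> interior C" using interior_C_iff fexp_unit_lower by blast
qed

lemma jcone_int_fexp: "jcone_int m = range fexp"
  unfolding jcone_int_def by (rule interior_C_fexp)

lemma fexp_flog: "x \<in> range fexp \<Longrightarrow> fexp (flog x) = x"
  by auto

lemma fexp_0: "fexp 0 = u"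
proof -
  obtain p l where p: "jframe jrank p" "(0::'a) = lc jrank p l" by (rule decomp)
  have o: "osys jrank p" using p jframe_osys by blast
  have z: "0 = lc jrank p (\<lambda>_. 0)" by simp
  show ?thesis unfolding z fexp_lc[OF o] using o by (simp add: osys_def)
qed

lemma fexp_shift: "fexp (x + c *\<^sub>R u) = exp c *\<^sub>R fexp x"
proof -
  obtain p l where p: "jframe jrank p" "x = lc jrank p l" by (rule decomp)
  have o: "osys jrank p" using p jframe_osys by blast
  have "x + c *\<^sub>R u = lc jrank p (\<lambda>i. l i + c)"
    unfolding osys_unit[OF o, of c] p(2) by (simp add: scaleR_add_left sum.distrib)
  then show ?thesis unfolding p(2) fexp_lc[OF o]
    using fexp_lc[OF o, of "\<lambda>i. l i + c"] by (simp add: scaleR_sum_right exp_add mult.commute)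
qed

lemma fexp_antitone:
  assumes "fexp y - fexp x \<in> C" shows "fexp (- x) - fexp (- y) \<in> C"
proof -
  obtain p l where p: "jframe jrank p" "x = lc jrank p l" by (rule decomp)
  obtain q k where q: "jframe jrank q" "y = lc jrank q k" by (rule decomp)
  note o = jframe_osys[OF p(1)] jframe_osys[OF q(1)]
  have neg: "- x = lc jrank p (\<lambda>i. - l i)" "- y = lc jrank q (\<lambda>i. - k i)"
    unfolding p(2) q(2) by (simp_all add: sum_negf)
  have "lc jrank p (\<lambda>i. inverse (exp (l i))) - lc jrank q (\<lambda>i. inverse (exp (k i))) \<in> C"
    using assms unfolding p(2) q(2) fexp_lc[OF o(1)] fexp_lc[OF o(2)]
    by (intro inverse_antitone[OF o]) auto
  then show ?thesis unfolding neg fexp_lc[OF o(1)] fexp_lc[OF o(2)] by (simp add: exp_minus)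
qed

lemma fexp_le_unit:
  assumes "- y \<in> C" shows "fexp y \<in> B"
proof -
  obtain p l where p: "jframe jrank p" "y = lc jrank p l" by (rule decomp)
  have "- y = lc jrank p (\<lambda>i. - l i)" unfolding p(2) by (simp add: sum_negf)
  then have "\<forall>i<jrank. l i \<le> 0" using assms jframe_C_iff[OF p(1)] by (metis neg_0_le_iff_le)
  then have "1 *\<^sub>R u - fexp y \<in> C"
    unfolding p(2) fexp_lc[OF jframe_osys[OF p(1)]] nsys_unit_diff_C_iff[OF jframe_nsys[OF p(1)]] by simp
  then show ?thesis using fexp_C by simp
qed

text \<open>The infimum is attained: the admissible \<open>t\<close> form a closed, upward closed
  set, nonempty because \<open>fexp z\<close> is interior and bounded below by evaluation at a
  state. From here on \<open>Mfun\<close> is handled through membership in the cone.\<close>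

lemma Mfun_le_iff: "Mfun m Y (fexp z) \<le> t \<longleftrightarrow> t *\<^sub>R fexp z - Y \<in> C"
proof -
  define S where "S = {t. t *\<^sub>R fexp z - Y \<in> C}"
  obtain e where e: "e > 0" "fexp z - e *\<^sub>R u \<in> C" using fexp_unit_lower by blast
  have up: "t \<in> S" if "s \<in> S" "s \<le> t" for s t
  proof -
    have "(t - s) *\<^sub>R fexp z + (s *\<^sub>R fexp z - Y) \<in> C"
      using that fexp_C by (intro C_add C_scale) (auto simp: S_def)
    then show ?thesis by (simp add: S_def algebra_simps)
  qed
  have "closed S"
  proof -
    have "S = (\<lambda>t. t *\<^sub>R fexp z - Y) -` C" by (auto simp: S_def)
    moreover have "closed ((\<lambda>t. t *\<^sub>R fexp z - Y) -` C)"
      by (intro continuous_closed_vimage C_closed continuous_intros)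
    ultimately show ?thesis by metis
  qed
  moreover have "S \<noteq> {}"
  proof -
    define t where "t = max 0 (lam_max Y)"
    have "t *\<^sub>R u - Y \<in> C" using lam_max_le_iff[of Y t] by (simp add: t_def)
    moreover have "(t / e) *\<^sub>R (fexp z - e *\<^sub>R u) \<in> C" using e by (intro C_scale) (auto simp: t_def)
    ultimately have "(t / e) *\<^sub>R (fexp z - e *\<^sub>R u) + (t *\<^sub>R u - Y) \<in> C" using C_add by blast
    then have "t / e \<in> S" using e(1) by (simp add: S_def algebra_simps)
    then show ?thesis by blast
  qed
  moreover have "bdd_below S"
  proof -
    obtain v where v: "v \<in> states" using states_nonempty by blast
    have "0 \<le> (fexp z - e *\<^sub>R u) \<bullet> v" using states_C[OF v e(2)] .
    then have w: "0 < fexp z \<bullet> v" using e v by (simp add: inner_diff_left)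
    have "(Y \<bullet> v) / (fexp z \<bullet> v) \<le> t" if "t \<in> S" for t
      using states_C[OF v, of "t *\<^sub>R fexp z - Y"] that w by (simp add: S_def inner_diff_left field_simps)
    then show ?thesis unfolding bdd_below_def by blast
  qed
  ultimately have "Inf S \<in> S" using closed_contains_Inf by blast
  moreover have "Mfun m Y (fexp z) = Inf S" unfolding Mfun_def jle_def S_def ..
  moreover have "Inf S \<le> t" if "t \<in> S" for t using that \<open>bdd_below S\<close> by (rule cInf_lower)
  ultimately have "Mfun m Y (fexp z) \<le> t \<longleftrightarrow> t \<in> S" using up by metis
  then show ?thesis by (simp add: S_def)
qed

lemma Mfun_pos: "Y \<in> C \<Longrightarrow> Y \<noteq> 0 \<Longrightarrow> 0 < Mfun m Y (fexp z)"
  using Mfun_le_iff[of Y z 0] C_antisym[of Y] by fastforce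

lemma Mfun_nonneg: "Y \<in> C \<Longrightarrow> 0 \<le> Mfun m Y (fexp z)"
proof -
  assume "Y \<in> C"
  show ?thesis
  proof (cases "Y = 0")
    case True
    show ?thesis
    proof (rule ccontr)
      assume *: "\<not> 0 \<le> Mfun m Y (fexp z)"
      then have "Mfun m Y (fexp z) *\<^sub>R fexp z \<in> C" using True Mfun_le_iff[of Y z "Mfun m Y (fexp z)"] by simp
      from C_scale[OF this, of "- 1 / Mfun m Y (fexp z)"] have "- fexp z \<in> C"
        using * by (simp add: divide_nonpos_neg)
      then have "fexp z = 0" using C_antisym fexp_C by blast
      moreover obtain e where "e > 0" "fexp z - e *\<^sub>R u \<in> C" using fexp_unit_lower by blast
      ultimately have "- (e *\<^sub>R u) \<in> C" "e *\<^sub>R u \<in> C" using C_scale u_in_C by auto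
      then have "e *\<^sub>R u = 0" using C_antisym by blast
      then show False using \<open>e > 0\<close> by simp
    qed
  qed (use Mfun_pos \<open>Y \<in> C\<close> less_imp_le in blast)
qed

lemma real_eq_by_le: "(\<And>t. (a::real) \<le> t \<longleftrightarrow> b \<le> t) \<Longrightarrow> a = b"
  by (metis order_antisym order_refl)

lemma fexp_nonzero: "fexp x \<noteq> 0"
proof
  assume z: "fexp x = 0"
  obtain e where e: "e > 0" "fexp x - e *\<^sub>R u \<in> C" using fexp_unit_lower by blast
  then have "- (e *\<^sub>R u) \<in> C" "e *\<^sub>R u \<in> C" using C_scale[OF u_in_C, of e] z by auto
  then have "e *\<^sub>R u = 0" using C_antisym by blast
  then show False using e by simp
qed

text \<open>For positive \<open>t\<close> the left bound compares \<open>fexp x\<close> with an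
  exponential shifted by \<open>ln t\<close>, and inversion reverses this comparison. It supplies
  the assumption \<open>g_sym\<close> for the cone metrics.\<close>

lemma Mfun_fexp_sym: "Mfun m (fexp x) (fexp z) = Mfun m (fexp (- z)) (fexp (- x))"
proof (rule real_eq_by_le)
  have le: "Mfun m (fexp (- z)) (fexp (- x)) \<le> t" if "0 < t" "Mfun m (fexp x) (fexp z) \<le> t" for x z t
  proof -
    have "fexp (z + ln t *\<^sub>R u) - fexp x \<in> C" using that Mfun_le_iff by (simp add: fexp_shift)
    then have "fexp (- x) - fexp (- (z + ln t *\<^sub>R u)) \<in> C" by (rule fexp_antitone)
    moreover have "- (z + ln t *\<^sub>R u) = - z + (- ln t) *\<^sub>R u" by simp
    ultimately have "fexp (- x) - inverse t *\<^sub>R fexp (- z) \<in> C"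
      using that by (simp only: fexp_shift exp_minus exp_ln)
    then have "t *\<^sub>R (fexp (- x) - inverse t *\<^sub>R fexp (- z)) \<in> C" using that by (intro C_scale) auto
    then show ?thesis unfolding Mfun_le_iff using that by (simp add: algebra_simps)
  qed
  fix t
  show "Mfun m (fexp x) (fexp z) \<le> t \<longleftrightarrow> Mfun m (fexp (- z)) (fexp (- x)) \<le> t"
    using le[of t x z] le[of t "- z" "- x"] Mfun_pos[OF fexp_C fexp_nonzero, of x z]
      Mfun_pos[OF fexp_C fexp_nonzero, of "- z" "- x"] by fastforce
qed

text \<open>Y \<le> exp y within one system of idempotents, for which both gauges are monotone.\<close>

definition dominates :: "'a \<Rightarrow> 'a \<Rightarrow> bool" where
  "dominates Y y \<longleftrightarrow> (\<exists>p h z. nsys jrank p \<and> Y = lc jrank p h \<and> y = lc jrank p z \<and> (\<forall>i<jrank. 0 \<le> h i \<and> h i \<le> exp (z i)))"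

end

text \<open>The relation rel b Y Y' is the limit of g Y y \<le> b as exp y tends to Y'. By the last
  assumption the existence of such a b does not depend on the gauge.\<close>

locale gauge = formally_real_jordan_algebra m u for m :: "'a::euclidean_space \<Rightarrow> 'a \<Rightarrow> 'a" and u +
  fixes g :: "'a \<Rightarrow> 'a \<Rightarrow> real" and rel :: "real \<Rightarrow> 'a \<Rightarrow> 'a \<Rightarrow> bool"
  assumes g_cont: "continuous_on B (\<lambda>Y. g Y z)"
    and g_nonneg: "Y \<in> C \<Longrightarrow> 0 \<le> g Y z"
    and g_pos: "Y \<in> C \<Longrightarrow> Y \<noteq> 0 \<Longrightarrow> 0 < g Y z"
    and g_scale: "Y \<in> C \<Longrightarrow> 0 < c \<Longrightarrow> g (c *\<^sub>R Y) z = c * g Y z"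
    and g_shift: "Y \<in> C \<Longrightarrow> g Y (z + c *\<^sub>R u) = exp (- c) * g Y z"
    and g_zero: "Y \<in> C \<Longrightarrow> g Y 0 = lam_max Y"
    and g_sym: "g (fexp x) z = g (fexp (- z)) (- x)"
    and g_ge: "Y \<in> C \<Longrightarrow> - y \<in> C \<Longrightarrow> lam_max Y \<le> g Y y"
    and g_close: "Y \<in> B \<Longrightarrow> 0 < b \<Longrightarrow> (\<lambda>n. fexp (ys n)) \<longlonglongrightarrow> Y' \<Longrightarrow> Y' \<in> B \<Longrightarrow> (\<And>n. g Y (ys n) \<le> b) \<Longrightarrow> rel b Y Y'"
    and rel_refl: "rel 1 Y Y"
    and rel_antisym: "Y \<in> B \<Longrightarrow> Y' \<in> B \<Longrightarrow> rel 1 Y Y' \<Longrightarrow> rel 1 Y' Y \<Longrightarrow> Y = Y'"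
    and g_dom: "Y \<in> B \<Longrightarrow> dominates Y' y \<Longrightarrow> 0 < b \<Longrightarrow> rel b Y Y' \<Longrightarrow> g Y y \<le> b"
    and rel_supp: "Y \<in> B \<Longrightarrow> Y' \<in> B \<Longrightarrow> (\<exists>b>0. rel b Y Y') \<longleftrightarrow> (\<exists>b>0. b *\<^sub>R Y' - Y \<in> C)"

context formally_real_jordan_algebra
begin

text \<open>\<open>Mfun\<close> makes sense for every \<open>Y\<close> in the cone, so its extension
  to the boundary is given by the same formula and \<open>rel\<close> is the order itself. The
  numbered cases follow the assumptions of \<open>gauge\<close>; those not listed are closed at the
  end.\<close>

lemma gauge_Thompson: "gauge m u (\<lambda>Y z. Mfun m Y (fexp z)) (\<lambda>b Y Y'. b *\<^sub>R Y' - Y \<in> C)"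
proof (unfold_locales, goal_cases)
  case (1 z)
  obtain e where e: "e > 0" "fexp z - e *\<^sub>R u \<in> C" using fexp_unit_lower by blast
  obtain K where K: "K > 0" "\<And>x. lam_max x \<le> K * norm x" using lam_max_bound by blast
  \<comment> \<open>Since \<open>fexp z\<close> lies above \<open>e *\<^sub>R u\<close>, an error of
    at most \<open>t *\<^sub>R u\<close> in \<open>Y\<close> is compensated by
    \<open>(t / e) *\<^sub>R fexp z\<close>.\<close>
  have le: "Mfun m Y (fexp z) \<le> Mfun m Y' (fexp z) + K / e * norm (Y - Y')" for Y Y'
  proof -
    define t where "t = K * norm (Y - Y')"
    have "t *\<^sub>R u - (Y - Y') \<in> C" using K(2)[of "Y - Y'"] by (simp add: t_def flip: lam_max_le_iff)
    moreover have "(t / e) *\<^sub>R (fexp z - e *\<^sub>R u) \<in> C" using e K by (intro C_scale) (auto simp: t_def)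
    moreover have "Mfun m Y' (fexp z) *\<^sub>R fexp z - Y' \<in> C" using Mfun_le_iff by blast
    ultimately have "(t *\<^sub>R u - (Y - Y')) + (t / e) *\<^sub>R (fexp z - e *\<^sub>R u) + (Mfun m Y' (fexp z) *\<^sub>R fexp z - Y') \<in> C"
      by (intro C_add)
    then have "(Mfun m Y' (fexp z) + t / e) *\<^sub>R fexp z - Y \<in> C" using e(1) by (simp add: algebra_simps)
    then show ?thesis unfolding Mfun_le_iff[symmetric] t_def by simp
  qed
  have "lipschitz_on (K / e) B (\<lambda>Y. Mfun m Y (fexp z))"
  proof (rule lipschitz_onI)
    fix Y Y'
    show "dist (Mfun m Y (fexp z)) (Mfun m Y' (fexp z)) \<le> K / e * dist Y Y'"
      using le[of Y Y'] le[of Y' Y] by (simp add: dist_real_def dist_norm norm_minus_commute abs_le_iff)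
  qed (use K e in simp)
  then show ?case by (rule lipschitz_on_continuous_on)
next
  case (4 Y c z)
  show ?case
  proof (rule real_eq_by_le)
    fix t
    have "t *\<^sub>R fexp z - c *\<^sub>R Y = c *\<^sub>R ((t / c) *\<^sub>R fexp z - Y)" using 4 by (simp add: algebra_simps)
    moreover have "(t / c) *\<^sub>R fexp z - Y = inverse c *\<^sub>R (t *\<^sub>R fexp z - c *\<^sub>R Y)"
      using 4 by (simp add: algebra_simps divide_inverse)
    ultimately have "Mfun m (c *\<^sub>R Y) (fexp z) \<le> t \<longleftrightarrow> Mfun m Y (fexp z) \<le> t / c"
      unfolding Mfun_le_iff using 4 C_scale[of "t *\<^sub>R fexp z - c *\<^sub>R Y" "inverse c"]
        C_scale[of "(t / c) *\<^sub>R fexp z - Y" c] by auto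
    then show "Mfun m (c *\<^sub>R Y) (fexp z) \<le> t \<longleftrightarrow> c * Mfun m Y (fexp z) \<le> t"
      using 4 by (simp add: pos_le_divide_eq mult.commute)
  qed
next
  case (5 Y z c)
  show ?case
  proof (rule real_eq_by_le)
    fix t
    have "Mfun m Y (fexp (z + c *\<^sub>R u)) \<le> t \<longleftrightarrow> Mfun m Y (fexp z) \<le> t * exp c"
      using Mfun_le_iff[of Y "z + c *\<^sub>R u" t] Mfun_le_iff[of Y z "t * exp c"] by (simp add: fexp_shift)
    then show "Mfun m Y (fexp (z + c *\<^sub>R u)) \<le> t \<longleftrightarrow> exp (- c) * Mfun m Y (fexp z) \<le> t"
      by (simp add: exp_minus field_simps)
  qed
next
  case (6 Y)
  show ?case using Mfun_le_iff[of Y 0] lam_max_le_iff[of Y] by (intro real_eq_by_le) (simp add: fexp_0)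
next
  case (8 Y y)
  define t where "t = Mfun m Y (fexp y)"
  have "t *\<^sub>R fexp y - Y \<in> C" using Mfun_le_iff unfolding t_def by blast
  moreover have "t *\<^sub>R (u - fexp y) \<in> C" using 8 fexp_le_unit Mfun_nonneg by (intro C_scale) (auto simp: t_def)
  ultimately have "t *\<^sub>R (u - fexp y) + (t *\<^sub>R fexp y - Y) \<in> C" using C_add by blast
  then show ?case unfolding lam_max_le_iff t_def by (simp add: algebra_simps)
next
  case (9 Y b y Y')
  have "b *\<^sub>R fexp (y n) - Y \<in> C" for n using 9(5) Mfun_le_iff by blast
  moreover have "(\<lambda>n. b *\<^sub>R fexp (y n) - Y) \<longlonglongrightarrow> b *\<^sub>R Y' - Y" using 9(3) by (intro tendsto_intros)
  ultimately show ?case by (rule closed_sequentially[OF C_closed])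
next
  case (11 Y Y')
  then show ?case using C_antisym[of "Y' - Y"] by simp
next
  case (12 Y Y' y b)
  obtain p h z where p: "nsys jrank p" "Y' = lc jrank p h" "y = lc jrank p z" "\<And>i. i < jrank \<Longrightarrow> h i \<le> exp (z i)"
    using 12(2) unfolding dominates_def by blast
  have "fexp y - Y' = lc jrank p (\<lambda>i. exp (z i) - h i)"
    unfolding p(2,3) fexp_lc[OF nsys_osys[OF p(1)]] by (simp add: scaleR_diff_left sum_subtractf)
  also have "\<dots> \<in> C" using p(4) by (intro osys_C[OF nsys_osys[OF p(1)]]) simp
  finally have "b *\<^sub>R (fexp y - Y') \<in> C" using 12 by (intro C_scale) auto
  from C_add[OF this 12(4)] show ?case unfolding Mfun_le_iff by (simp add: algebra_simps)
qed (use Mfun_nonneg Mfun_pos Mfun_fexp_sym C_0 in \<open>auto\<close>)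

end


lemma positive_lower_bound:
  fixes h :: "nat \<Rightarrow> real"
  obtains c where "0 < c" "\<And>i. i < r \<Longrightarrow> 0 < h i \<Longrightarrow> c \<le> h i"
proof -
  \<comment> \<open>The number 1 keeps the minimum defined when no \<open>h i\<close> is
    positive.\<close>
  define c where "c = Min (insert 1 (h ` {i. i < r \<and> 0 < h i}))"
  have "finite (insert 1 (h ` {i. i < r \<and> 0 < h i}))" by simp
  then have "0 < c" "\<And>i. i < r \<Longrightarrow> 0 < h i \<Longrightarrow> c \<le> h i" unfolding c_def by auto
  then show thesis by (rule that)
qed

context formally_real_jordan_algebra
begin

subsection \<open>Compressing states\<close>

lemma U_lc:
  assumes "osys r p" shows "U (lc r p k) (lc r p l) = lc r p (\<lambda>i. k i * k i * l i)"
  unfolding U_def osys_mult[OF assms]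
  by (simp add: scaleR_sum_right mult.assoc flip: sum_subtractf scaleR_diff_left)

text \<open>The positive functional sending \<open>x\<close> to \<open>U a x \<bullet> v\<close> has
  the value \<open>(a \<odot> a) \<bullet> v\<close> at \<open>u\<close>; dividing by it gives a
  state, the analogue of a conditional probability.\<close>

lemma state_compress:
  assumes v: "v \<in> states" and a: "a \<in> C" and pos: "0 < (a \<odot> a) \<bullet> v"
  obtains w where "w \<in> states" "\<And>x. U a x \<bullet> v = ((a \<odot> a) \<bullet> v) * (x \<bullet> w)"
proof -
  define t where "t = (a \<odot> a) \<bullet> v"
  have t: "t > 0" using pos by (simp add: t_def)
  have "linear (\<lambda>x. (U a x \<bullet> v) / t)"
    by (rule linearI) (simp_all add: U_add U_scale inner_simps add_divide_distrib)
  moreover have "0 \<le> (U a x \<bullet> v) / t" if "x \<in> C" for x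
    using states_C[OF v U_C[OF a that]] t by simp
  moreover have "(U a u \<bullet> v) / t = 1"
  proof -
    have "U a u = a \<odot> a" by (simp add: U_def scaleR_2)
    then show ?thesis using t by (simp add: t_def)
  qed
  ultimately obtain w where w: "w \<in> states" "\<And>x. (U a x \<bullet> v) / t = x \<bullet> w"
    using states_represent[of "\<lambda>x. (U a x \<bullet> v) / t"] by metis
  have "U a x \<bullet> v = t * (x \<bullet> w)" for x using w(2)[of x, symmetric] t by simp
  then show thesis using that w(1) unfolding t_def by blast
qed

text \<open>By positivity of \<open>U a\<close>, the bound of \<open>x\<close> by
  \<open>lam_max x *\<^sub>R u\<close> makes the value nonpositive, and the same holds for
  \<open>- x\<close>. This covers the states that cannot be compressed.\<close>

lemma U_null:
  assumes v: "v \<in> states" and a: "a \<in> C" and z: "(a \<odot> a) \<bullet> v = 0"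
  shows "U a x \<bullet> v = 0"
proof -
  have Uu: "U a u = a \<odot> a" by (simp add: U_def scaleR_2)
  have le: "U a x \<bullet> v \<le> 0" for x
  proof -
    have "0 \<le> U a (lam_max x *\<^sub>R u - x) \<bullet> v" using states_C[OF v U_C[OF a lam_max_diff_C]] .
    then show ?thesis using z Uu by (simp add: U_diff U_scale inner_diff_left)
  qed
  have "- (U a x \<bullet> v) \<le> 0" using le[of "- x"] linear_neg[OF U_linear, of a x] by simp
  then show ?thesis using le[of x] by simp
qed

lemma zero_by_states: "(\<And>v. v \<in> states \<Longrightarrow> x \<bullet> v = 0) \<Longrightarrow> x = 0"
  using C_iff_states[of x] C_iff_states[of "- x"] C_antisym[of x] by simp

text \<open>With \<open>f = u - e\<close>, evaluate \<open>v\<close> on the square of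
  \<open>t *\<^sub>R f + z\<close>. The coefficient of \<open>t * t\<close> is
  \<open>f \<bullet> v = 0\<close>, so a nonnegative affine function of \<open>t\<close> remains,
  and its slope must vanish.\<close>

lemma state_unit_mult:
  assumes v: "v \<in> states" and e: "e \<odot> e = e" and ev: "e \<bullet> v = 1"
  shows "(e \<odot> z) \<bullet> v = z \<bullet> v" and "U e z \<bullet> v = z \<bullet> v"
proof -
  define f where "f = u - e"
  have ff: "f \<odot> f = f" using e by (simp add: f_def distribs)
  have fv: "f \<bullet> v = 0" using ev v by (simp add: f_def inner_diff_left)
  have "(f \<odot> z) \<bullet> v = 0" for z
  proof -
    define a b where "a = (f \<odot> z) \<bullet> v" and "b = (z \<odot> z) \<bullet> v"
    have q: "0 \<le> 2 * t * a + b" for t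
    proof -
      have "(t *\<^sub>R f + z) \<odot> (t *\<^sub>R f + z) = (t * t) *\<^sub>R f + (2 * t) *\<^sub>R (f \<odot> z) + z \<odot> z"
        using comm[of z f] ff by - (rule vec_eqI, simp add: distribs inner_simps algebra_simps)
      then have "0 \<le> ((t * t) *\<^sub>R f + (2 * t) *\<^sub>R (f \<odot> z) + z \<odot> z) \<bullet> v"
        using states_C[OF v sq_in_C, of "t *\<^sub>R f + z"] by simp
      then show ?thesis using fv by (simp add: inner_add_left a_def b_def)
    qed
    show ?thesis
    proof (rule ccontr)
      assume "(f \<odot> z) \<bullet> v \<noteq> 0"
      then have "a \<noteq> 0" by (simp add: a_def)
      then have "2 * (- (b + 1) / (2 * a)) * a + b = - 1" by (simp add: field_simps)
      then show False using q[of "- (b + 1) / (2 * a)"] by simp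
    qed
  qed
  then have *: "(e \<odot> z) \<bullet> v = z \<bullet> v" for z by (simp add: f_def distribs inner_diff_left)
  then show "(e \<odot> z) \<bullet> v = z \<bullet> v" by simp
  show "U e z \<bullet> v = z \<bullet> v" unfolding U_def using * e by (simp add: inner_simps)
qed

text \<open>Without a 1-component, \<open>f = h + k\<close>. The 1-component of
  \<open>f \<odot> f = f\<close> is that of \<open>h \<odot> h\<close>, so it vanishes and
  \<open>peirce_h_zero\<close> gives \<open>h = 0\<close>.\<close>

lemma U_idem_zero:
  assumes e: "e \<odot> e = e" and f: "f \<odot> f = f" and z: "U e f = 0"
  shows "e \<odot> f = 0"
proof -
  define h k where "h = peirce_half e f" and "k = peirce_zero e f"
  have hk: "e \<odot> h = (1/2) *\<^sub>R h" "e \<odot> k = 0" using c_peirce[OF e, of f] by (simp_all add: h_def k_def)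
  have fe: "f = h + k" using peirce_sum[of f e] z U_idem[OF e, of f] by (simp add: h_def k_def)
  have 1: "e \<odot> (e \<odot> (h \<odot> h)) = e \<odot> (h \<odot> h)" using peirce_hh[OF e hk(1) hk(1)] .
  have 2: "e \<odot> (k \<odot> h) = (1/2) *\<^sub>R (k \<odot> h)" using peirce_0[OF e hk(2) hk(1)] .
  have 3: "e \<odot> (k \<odot> k) = 0" using peirce_00[OF e hk(2) hk(2)] .
  have "f = h \<odot> h + 2 *\<^sub>R (k \<odot> h) + k \<odot> k"
  proof -
    have "f = f \<odot> f" using f by simp
    also have "\<dots> = h \<odot> h + 2 *\<^sub>R (k \<odot> h) + k \<odot> k"
      unfolding fe using comm[of h k] by (simp add: distribs scaleR_2)
    finally show ?thesis .
  qed
  then have "peirce_one e f = peirce_one e (h \<odot> h) + 2 *\<^sub>R peirce_one e (k \<odot> h) + peirce_one e (k \<odot> k)"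
    by (metis linear_add[OF peirce_one_linear] linear_scale[OF peirce_one_linear])
  then have "e \<odot> (h \<odot> h) = 0"
    using z U_idem[OF e, of f] 1 2 3 by (simp add: peirce_one_def distribs scaleR_2)
  then have "h = 0" using peirce_h_zero hk(1) by blast
  then show ?thesis using fe hk by simp
qed

text \<open>Compressing any state by \<open>U f\<close> gives a state concentrated on
  \<open>f\<close>, at which \<open>u - e\<close> vanishes by assumption. Hence
  \<open>U f (u - e) = 0\<close>, and \<open>f\<close> is orthogonal to
  \<open>u - e\<close>.\<close>

lemma idem_le_by_states:
  assumes e: "e \<odot> e = e" and f: "f \<odot> f = f" and le: "\<And>v. v \<in> states \<Longrightarrow> f \<bullet> v = 1 \<Longrightarrow> e \<bullet> v = 1"
  shows "e \<odot> f = f"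
proof -
  have fC: "f \<in> C" using idem_in_C f by blast
  have Uff: "U f f = f" using f by (simp add: U_def scaleR_2)
  have "U f (u - e) = 0"
  proof (rule zero_by_states)
    fix v assume v: "v \<in> states"
    show "U f (u - e) \<bullet> v = 0"
    proof (cases "0 < (f \<odot> f) \<bullet> v")
      case True
      then obtain w where w: "w \<in> states" "\<And>x. U f x \<bullet> v = ((f \<odot> f) \<bullet> v) * (x \<bullet> w)"
        using state_compress[OF v fC] by metis
      have "f \<bullet> w = 1" using w(2)[of f] Uff f True by simp
      then have "e \<bullet> w = 1" using le w by blast
      then show ?thesis using w by (simp add: inner_diff_left)
    next
      case False
      then have "(f \<odot> f) \<bullet> v = 0" using states_C[OF v] fC f by (metis antisym_conv2)
      then show ?thesis using U_null[OF v fC] by blast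
    qed
  qed
  moreover have "(u - e) \<odot> (u - e) = u - e" using e by (simp add: distribs)
  ultimately have "f \<odot> (u - e) = 0" using U_idem_zero[OF f] by blast
  then show ?thesis using comm[of f e] by (simp add: distribs)
qed

subsection \<open>Supports\<close>

definition supp :: "'a \<Rightarrow> 'a" where "supp = fcalc (\<lambda>t. if 0 < t then 1 else 0)"

lemma supp_lc: "osys r p \<Longrightarrow> supp (lc r p h) = lc r p (\<lambda>i. if 0 < h i then 1 else 0)"
  by (simp add: supp_def fcalc_lc)

lemma flog_lc: "osys r p \<Longrightarrow> flog (lc r p h) = lc r p (\<lambda>i. ln (h i))"
  by (simp add: flog_def fcalc_lc)

lemma decomp_C:
  assumes "Y \<in> C" obtains p h where "jframe jrank p" "Y = lc jrank p h" "\<And>i. i < jrank \<Longrightarrow> 0 \<le> h i"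
proof -
  obtain p l where p: "jframe jrank p" "Y = lc jrank p l" by (rule decomp)
  then show thesis using that[OF p] assms jframe_C_iff[OF p(1)] by blast
qed

lemma supp_idem: "supp Y \<odot> supp Y = supp Y"
proof -
  obtain p h where p: "jframe jrank p" "Y = lc jrank p h" by (rule decomp)
  show ?thesis unfolding p(2) supp_lc[OF jframe_osys[OF p(1)]] osys_mult[OF jframe_osys[OF p(1)]]
    by (intro sum.cong) auto
qed

lemma state_osys_weights:
  assumes "osys r p" "v \<in> states"
  shows "\<And>i. i < r \<Longrightarrow> 0 \<le> p i \<bullet> v" "(\<Sum>i<r. p i \<bullet> v) = 1"
proof -
  show "0 \<le> p i \<bullet> v" if "i < r" for i
    using assms that idem_in_C states_C by (simp add: osys_def)
  have "(\<Sum>i<r. p i \<bullet> v) = (\<Sum>i<r. p i) \<bullet> v" by (simp add: inner_sum_left)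
  then show "(\<Sum>i<r. p i \<bullet> v) = 1" using assms by (simp add: osys_def)
qed

lemma lc_inner: "lc r p l \<bullet> v = (\<Sum>i<r. l i * (p i \<bullet> v))"
  by (simp add: inner_sum_left)

lemma supp_state_iff:
  assumes o: "osys r p" and v: "v \<in> states" and h: "\<And>i. i < r \<Longrightarrow> 0 \<le> h i"
  shows "supp (lc r p h) \<bullet> v = 1 \<longleftrightarrow> (\<forall>i<r. h i = 0 \<longrightarrow> p i \<bullet> v = 0)"
proof -
  note w = state_osys_weights[OF o v]
  have "1 - supp (lc r p h) \<bullet> v = (\<Sum>i<r. p i \<bullet> v) - (\<Sum>i<r. (if 0 < h i then 1 else 0) * (p i \<bullet> v))"
    unfolding supp_lc[OF o] lc_inner w(2) by simp
  also have "\<dots> = (\<Sum>i<r. if h i = 0 then p i \<bullet> v else 0)"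
    unfolding sum_subtractf[symmetric] using h by (intro sum.cong) (auto simp: order_less_le)
  finally have "supp (lc r p h) \<bullet> v = 1 \<longleftrightarrow> (\<Sum>i<r. if h i = 0 then p i \<bullet> v else 0) = 0" by linarith
  also have "\<dots> \<longleftrightarrow> (\<forall>i<r. h i = 0 \<longrightarrow> p i \<bullet> v = 0)"
    using w(1) by (subst sum_nonneg_eq_0_iff) auto
  finally show ?thesis .
qed

lemma supp_bounds:
  assumes "Y \<in> B"
  shows "supp Y - Y \<in> C" "\<exists>c>0. Y - c *\<^sub>R supp Y \<in> C"
proof -
  obtain p h where p: "jframe jrank p" "Y = lc jrank p h" "\<And>i. i < jrank \<Longrightarrow> 0 \<le> h i"
    using decomp_C assms by blast
  note o = jframe_osys[OF p(1)]
  have "1 *\<^sub>R u - Y \<in> C" using assms by simp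
  then have h1: "h i \<le> 1" if "i < jrank" for i
    using that unfolding p(2) nsys_unit_diff_C_iff[OF jframe_nsys[OF p(1)]] by blast
  have "supp Y - Y = lc jrank p (\<lambda>i. (if 0 < h i then 1 else 0) - h i)"
    unfolding p(2) supp_lc[OF o] by (simp add: scaleR_diff_left sum_subtractf)
  also have "\<dots> \<in> C" using p(3) h1 by (intro osys_C[OF o]) (auto simp: not_less)
  finally show "supp Y - Y \<in> C" .
  obtain c where c: "0 < c" "\<And>i. i < jrank \<Longrightarrow> 0 < h i \<Longrightarrow> c \<le> h i"
    using positive_lower_bound[of jrank h] by metis
  have "Y - c *\<^sub>R supp Y = lc jrank p (\<lambda>i. h i - c * (if 0 < h i then 1 else 0))"
    unfolding p(2) supp_lc[OF o] by (simp add: scaleR_diff_left sum_subtractf scaleR_sum_right)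
  also have "\<dots> \<in> C" using p(3) c by (intro osys_C[OF o]) auto
  finally show "\<exists>c>0. Y - c *\<^sub>R supp Y \<in> C" using c(1) by blast
qed

lemma idem_diff:
  assumes "e \<odot> e = e" "f \<odot> f = f" "e \<odot> f = f"
  shows "(e - f) \<odot> (e - f) = e - f" "e - f \<in> C"
proof -
  show "(e - f) \<odot> (e - f) = e - f" using assms comm[of f e] by (simp add: distribs)
  then show "e - f \<in> C" by (rule idem_in_C)
qed

text \<open>Up to constants each element can be replaced by its support idempotent. The forward
  direction compresses the inequality by \<open>u - supp Y'\<close>, which leaves only the negative
  term.\<close>

lemma order_supp_iff:
  assumes "Y \<in> B" "Y' \<in> B"
  shows "(\<exists>b>0. b *\<^sub>R Y' - Y \<in> C) \<longleftrightarrow> supp Y' \<odot> supp Y = supp Y"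
proof
  let ?e = "supp Y" and ?f = "supp Y'"
  obtain c where c: "c > 0" "Y - c *\<^sub>R ?e \<in> C" using supp_bounds(2)[OF assms(1)] by blast
  obtain d where d: "d > 0" "Y' - d *\<^sub>R ?f \<in> C" using supp_bounds(2)[OF assms(2)] by blast
  {
    assume "\<exists>b>0. b *\<^sub>R Y' - Y \<in> C"
    then obtain b where b: "b > 0" "b *\<^sub>R Y' - Y \<in> C" by blast
    have "b *\<^sub>R (?f - Y') \<in> C" using supp_bounds(1)[OF assms(2)] b by (intro C_scale) auto
    from C_add[OF C_add[OF this b(2)] c(2)] have le: "b *\<^sub>R ?f - c *\<^sub>R ?e \<in> C" by (simp add: algebra_simps)
    define f' where "f' = u - ?f"
    have f': "f' \<odot> f' = f'" "f' \<odot> ?f = 0" using supp_idem by (simp_all add: f'_def distribs)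
    have "U f' ?f = 0" unfolding U_idem[OF f'(1)] peirce_one_def using f' by simp
    moreover have "U f' (b *\<^sub>R ?f - c *\<^sub>R ?e) \<in> C" using U_C[OF idem_in_C[OF f'(1)] le] .
    ultimately have "- (c *\<^sub>R U f' ?e) \<in> C" by (simp add: U_diff U_scale)
    moreover have "c *\<^sub>R U f' ?e \<in> C"
      using U_C[OF idem_in_C[OF f'(1)] idem_in_C[OF supp_idem]] c by (intro C_scale) auto
    ultimately have "c *\<^sub>R U f' ?e = 0" using C_antisym by blast
    then have "U f' ?e = 0" using c by simp
    then have "f' \<odot> ?e = 0" using U_idem_zero f' supp_idem by blast
    then show "?f \<odot> ?e = ?e" by (simp add: f'_def distribs)
  next
    assume fe: "?f \<odot> ?e = ?e"
    have "(1 / d) *\<^sub>R (Y' - d *\<^sub>R ?f) \<in> C" using d by (intro C_scale) auto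
    from C_add[OF C_add[OF this idem_diff(2)[OF supp_idem supp_idem fe]] supp_bounds(1)[OF assms(1)]]
    have "(1 / d) *\<^sub>R Y' - Y \<in> C" using d(1) by (simp add: algebra_simps)
    then show "\<exists>b>0. b *\<^sub>R Y' - Y \<in> C" using d(1) by (intro exI[of _ "1 / d"]) auto
  }
qed

subsection \<open>The gauge of the normed space\<close>

text \<open>The exponential of v applied to log Y, which is 0 if v charges the kernel of Y. On that
  kernel flog Y vanishes since ln 0 = 0.\<close>

definition Q :: "'a \<Rightarrow> 'a \<Rightarrow> real" where
  "Q v Y = (if supp Y \<bullet> v = 1 then exp (flog Y \<bullet> v) else 0)"

text \<open>A continuous substitute for the logarithm, which is discontinuous at the boundary;
  \<open>max t 0\<close> gives a function continuous on all reals. On the cone \<open>Q v Y\<close>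
  is the infimum of \<open>exp (reg_log e Y \<bullet> v)\<close> over positive \<open>e\<close>, the
  source of upper semicontinuity.\<close>

definition reg_log :: "real \<Rightarrow> 'a \<Rightarrow> 'a" where
  "reg_log e = fcalc (\<lambda>t. ln (max t 0 + e))"

lemma reg_log_continuous: "0 < e \<Longrightarrow> continuous_on S (reg_log e)"
  unfolding reg_log_def by (rule fcalc_continuous) (auto intro!: continuous_intros simp: add_nonneg_eq_0_iff)

lemma Q_nonneg: "0 \<le> Q v Y"
  by (simp add: Q_def)

lemma Q_fexp: "v \<in> states \<Longrightarrow> Q v (fexp y) = exp (y \<bullet> v)"
proof -
  assume v: "v \<in> states"
  obtain p l where p: "jframe jrank p" "y = lc jrank p l" by (rule decomp)
  note o = jframe_osys[OF p(1)]
  have "supp (fexp y) = u" unfolding p(2) fexp_lc[OF o] supp_lc[OF o] using o by (simp add: osys_def)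
  then show ?thesis using v by (simp add: Q_def)
qed

lemma Q_le_reg_log:
  assumes "v \<in> states" "Y \<in> C" "0 < e" shows "Q v Y \<le> exp (reg_log e Y \<bullet> v)"
proof (cases "supp Y \<bullet> v = 1")
  case True
  obtain p h where p: "jframe jrank p" "Y = lc jrank p h" "\<And>i. i < jrank \<Longrightarrow> 0 \<le> h i"
    using decomp_C assms by blast
  note o = jframe_osys[OF p(1)]
  have z: "p i \<bullet> v = 0" if "i < jrank" "h i = 0" for i
    using that True supp_state_iff[OF o assms(1), of h] p by simp
  have "flog Y \<bullet> v \<le> reg_log e Y \<bullet> v"
    unfolding p(2) flog_lc[OF o] reg_log_def fcalc_lc[OF o] lc_inner
  proof (rule sum_mono)
    fix i assume "i \<in> {..<jrank}"
    then show "ln (h i) * (p i \<bullet> v) \<le> ln (max (h i) 0 + e) * (p i \<bullet> v)"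
      using z[of i] p(3)[of i] state_osys_weights(1)[OF o assms(1), of i] assms(3)
      by (cases "h i = 0") (auto intro!: mult_right_mono)
  qed
  then show ?thesis using True by (simp add: Q_def)
qed (simp add: Q_def)

lemma Q_reg_log_limit:
  assumes "v \<in> states" "Y \<in> C" "0 < d" shows "\<exists>e>0. exp (reg_log e Y \<bullet> v) < Q v Y + d"
proof -
  obtain p h where p: "jframe jrank p" "Y = lc jrank p h" "\<And>i. i < jrank \<Longrightarrow> 0 \<le> h i"
    using decomp_C assms by blast
  note o = jframe_osys[OF p(1)]
  note w = state_osys_weights[OF o assms(1)]
  have rg: "reg_log e Y \<bullet> v = (\<Sum>i<jrank. ln (h i + e) * (p i \<bullet> v))" for e
    unfolding p(2) reg_log_def fcalc_lc[OF o] lc_inner using p(3) by (intro sum.cong) auto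
  show ?thesis
  proof (cases "supp Y \<bullet> v = 1")
    case True
    have z: "p i \<bullet> v = 0" if "i < jrank" "h i = 0" for i
      using that True supp_state_iff[OF o assms(1), of h] p by simp
    have "((\<lambda>e. \<Sum>i<jrank. ln (h i + e) * (p i \<bullet> v)) \<longlongrightarrow> (\<Sum>i<jrank. ln (h i) * (p i \<bullet> v))) (at_right 0)"
    proof (rule tendsto_sum)
      fix i assume i: "i \<in> {..<jrank}"
      show "((\<lambda>e. ln (h i + e) * (p i \<bullet> v)) \<longlongrightarrow> ln (h i) * (p i \<bullet> v)) (at_right 0)"
      proof (cases "h i = 0")
        case False
        then have "((\<lambda>e. ln (h i + e) * (p i \<bullet> v)) \<longlongrightarrow> ln (h i + 0) * (p i \<bullet> v)) (at_right 0)"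
          by (intro tendsto_intros) auto
        then show ?thesis by simp
      qed (use z i in simp)
    qed
    then have "((\<lambda>e. exp (reg_log e Y \<bullet> v)) \<longlongrightarrow> exp (flog Y \<bullet> v)) (at_right 0)"
      unfolding rg unfolding p(2) flog_lc[OF o] lc_inner by (rule tendsto_exp)
    then have "\<forall>\<^sub>F e in at_right 0. exp (reg_log e Y \<bullet> v) < Q v Y + d"
      by (rule order_tendstoD(2)) (use True assms(3) in \<open>simp add: Q_def\<close>)
    moreover have "\<forall>\<^sub>F e::real in at_right 0. e > 0" by (rule eventually_at_right_less)
    ultimately have "\<forall>\<^sub>F e in at_right 0. e > 0 \<and> exp (reg_log e Y \<bullet> v) < Q v Y + d"
      by (rule eventually_elim2) auto
    then show ?thesis using eventually_happens'[OF trivial_limit_at_right_real] by blast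
  next
    case False
    then obtain j where j: "j < jrank" "h j = 0" "p j \<bullet> v \<noteq> 0"
      using supp_state_iff[OF o assms(1), of h] p by auto
    then have wj: "0 < p j \<bullet> v" using w(1)[of j] by linarith
    define M where "M = (\<Sum>i\<in>{..<jrank}-{j}. ln (h i + 1) * (p i \<bullet> v))"
    \<comment> \<open>For \<open>e \<le> 1\<close> the other members contribute at most
      \<open>M\<close>; \<open>e\<close> is so small that \<open>p j\<close>, a kernel member
      charged by \<open>v\<close>, brings the exponent down to at most
      \<open>ln d - 1\<close>.\<close>
    define e where "e = min 1 (exp ((ln d - 1 - M) / (p j \<bullet> v)))"
    have e: "0 < e" "e \<le> 1" "e \<le> exp ((ln d - 1 - M) / (p j \<bullet> v))"
      by (simp_all add: e_def)
    then have e3: "ln e \<le> (ln d - 1 - M) / (p j \<bullet> v)" by (metis exp_gt_zero ln_exp ln_le_cancel_iff)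
    have "reg_log e Y \<bullet> v = ln e * (p j \<bullet> v) + (\<Sum>i\<in>{..<jrank}-{j}. ln (h i + e) * (p i \<bullet> v))"
      unfolding rg using j by (subst sum.remove[of _ j]) auto
    also have "\<dots> \<le> (ln d - 1 - M) + M"
    proof (rule add_mono)
      show "ln e * (p j \<bullet> v) \<le> ln d - 1 - M" using e3 wj by (simp add: pos_le_divide_eq)
      show "(\<Sum>i\<in>{..<jrank}-{j}. ln (h i + e) * (p i \<bullet> v)) \<le> M"
        unfolding M_def
      proof (rule sum_mono)
        fix i assume i: "i \<in> {..<jrank}-{j}"
        then have "0 \<le> h i" using p(3) by simp
        then have "ln (h i + e) \<le> ln (h i + 1)" using e by (subst ln_le_cancel_iff) auto
        then show "ln (h i + e) * (p i \<bullet> v) \<le> ln (h i + 1) * (p i \<bullet> v)"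
          using w(1)[of i] i by (intro mult_right_mono) auto
      qed
    qed
    finally have "exp (reg_log e Y \<bullet> v) \<le> exp (ln d - 1)" by simp
    also have "\<dots> < exp (ln d)" by simp
    also have "\<dots> = d" using assms by simp
    finally show ?thesis using e(1) False by (auto simp: Q_def)
  qed
qed

text \<open>For a state that does not charge the kernel, \<open>flog Y \<bullet> v\<close> is a
  weighted mean of logarithms of positive eigenvalues.\<close>

lemma Q_le_lam_max:
  assumes "v \<in> states" "Y \<in> C" shows "Q v Y \<le> lam_max Y"
proof (cases "supp Y \<bullet> v = 1")
  case True
  obtain p h where p: "jframe jrank p" "Y = lc jrank p h" "\<And>i. i < jrank \<Longrightarrow> 0 \<le> h i"
    using decomp_C assms by blast
  note o = jframe_osys[OF p(1)]
  note w = state_osys_weights[OF o assms(1)]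
  have z: "p i \<bullet> v = 0" if "i < jrank" "h i = 0" for i
    using that True supp_state_iff[OF o assms(1), of h] p by simp
  have hL: "h i \<le> lam_max Y" if "i < jrank" for i using lam_max_nsys(1)[OF jframe_nsys[OF p(1)] that] p(2) by simp
  have "\<exists>i<jrank. h i \<noteq> 0"
  proof (rule ccontr)
    assume "\<not> ?thesis"
    then have "(\<Sum>i<jrank. p i \<bullet> v) = 0" using z by (intro sum.neutral) auto
    then show False using w(2) by simp
  qed
  then have Lp: "0 < lam_max Y" using p(3) hL by (metis order_less_le order_less_le_trans)
  have "flog Y \<bullet> v \<le> (\<Sum>i<jrank. ln (lam_max Y) * (p i \<bullet> v))"
    unfolding p(2) flog_lc[OF o] lc_inner unfolding p(2)[symmetric]
  proof (rule sum_mono)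
    fix i assume i: "i \<in> {..<jrank}"
    show "ln (h i) * (p i \<bullet> v) \<le> ln (lam_max Y) * (p i \<bullet> v)"
    proof (cases "h i = 0")
      case False
      then have "ln (h i) \<le> ln (lam_max Y)" using p(3)[of i] hL[of i] i by simp
      then show ?thesis using w(1)[of i] i by (intro mult_right_mono) auto
    qed (use z i in simp)
  qed
  also have "\<dots> = ln (lam_max Y)" unfolding sum_distrib_left[symmetric] w(2) by simp
  finally have "exp (flog Y \<bullet> v) \<le> exp (ln (lam_max Y))" by simp
  then show ?thesis using True Lp by (simp add: Q_def)
qed (use lam_max_nonneg assms in \<open>simp add: Q_def\<close>)

lemma Q_eigen:
  assumes "Y \<in> C" "Y \<noteq> 0" shows "\<exists>v\<in>states. Q v Y = lam_max Y"
proof -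
  obtain p h where p: "jframe jrank p" "Y = lc jrank p h" "\<And>i. i < jrank \<Longrightarrow> 0 \<le> h i"
    using decomp_C assms by blast
  note o = jframe_osys[OF p(1)]
  obtain i where i: "i < jrank" "lam_max Y = h i" using lam_max_nsys(2)[OF jframe_nsys[OF p(1)]] p(2) by blast
  have "0 < lam_max Y" using lam_max_C_zero assms by fastforce
  then have hp: "0 < h i" using i by simp
  obtain v where v: "v \<in> states" "\<And>l. lc jrank p l \<bullet> v = l i" using states_frame[OF p(1) i(1)] by blast
  have "supp Y \<bullet> v = 1" unfolding p(2) supp_lc[OF o] v(2) using hp by simp
  moreover have "flog Y \<bullet> v = ln (h i)" unfolding p(2) flog_lc[OF o] v(2) ..
  ultimately show ?thesis using hp i by (intro bexI[OF _ v(1)]) (simp add: Q_def)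
qed

lemma Q_scale:
  assumes "Y \<in> C" "0 < c" "v \<in> states" shows "Q v (c *\<^sub>R Y) = c * Q v Y"
proof -
  obtain p h where p: "jframe jrank p" "Y = lc jrank p h" "\<And>i. i < jrank \<Longrightarrow> 0 \<le> h i"
    using decomp_C assms by blast
  note o = jframe_osys[OF p(1)]
  have cY: "c *\<^sub>R Y = lc jrank p (\<lambda>i. c * h i)" unfolding p(2) by (simp add: scaleR_sum_right)
  have s: "supp (c *\<^sub>R Y) = supp Y" unfolding cY unfolding p(2) supp_lc[OF o]
    using assms(2) by (simp add: zero_less_mult_iff)
  have "flog (c *\<^sub>R Y) \<bullet> v = flog Y \<bullet> v + ln c" if "supp Y \<bullet> v = 1"
  proof -
    have "flog (c *\<^sub>R Y) = flog Y + ln c *\<^sub>R supp Y"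
    proof -
      have "flog Y + ln c *\<^sub>R supp Y = lc jrank p (\<lambda>i. ln (h i) + ln c * (if 0 < h i then 1 else 0))"
        unfolding p(2) flog_lc[OF o] supp_lc[OF o] by (simp add: scaleR_sum_right scaleR_add_left sum.distrib)
      also have "\<dots> = flog (c *\<^sub>R Y)"
        unfolding cY flog_lc[OF o]
      proof (rule sum.cong[OF refl])
        fix i assume "i \<in> {..<jrank}"
        then show "(ln (h i) + ln c * (if 0 < h i then 1 else 0)) *\<^sub>R p i = ln (c * h i) *\<^sub>R p i"
          using p(3)[of i] assms(2) by (cases "h i = 0") (auto simp: ln_mult)
      qed
      finally show ?thesis by simp
    qed
    then show ?thesis using that by (simp add: inner_add_left)
  qed
  then show ?thesis using s assms(2) by (simp add: Q_def exp_add)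
qed

lemma Q_dominates:
  assumes "v \<in> states" "dominates Y y" shows "Q v Y \<le> exp (y \<bullet> v)"
proof (cases "supp Y \<bullet> v = 1")
  case True
  obtain p h z where p: "nsys jrank p" "Y = lc jrank p h" "y = lc jrank p z"
    "\<And>i. i < jrank \<Longrightarrow> 0 \<le> h i \<and> h i \<le> exp (z i)"
    using assms(2) unfolding dominates_def by blast
  note o = nsys_osys[OF p(1)]
  have w0: "p i \<bullet> v = 0" if "i < jrank" "h i = 0" for i
    using that True supp_state_iff[OF o assms(1), of h] p by simp
  have "flog Y \<bullet> v \<le> y \<bullet> v"
    unfolding p(2,3) flog_lc[OF o] lc_inner
  proof (rule sum_mono)
    fix i assume i: "i \<in> {..<jrank}"
    show "ln (h i) * (p i \<bullet> v) \<le> z i * (p i \<bullet> v)"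
    proof (cases "h i = 0")
      case False
      then have "0 < h i" using p(4)[of i] i by force
      then have "ln (h i) \<le> z i" using p(4)[of i] i by (metis lessThan_iff ln_exp ln_le_cancel_iff exp_gt_zero)
      then show ?thesis using state_osys_weights(1)[OF o assms(1), of i] i by (intro mult_right_mono) auto
    qed (use w0 i in simp)
  qed
  then show ?thesis using True by (simp add: Q_def)
qed (simp add: Q_def)

lemma supp_eqI:
  assumes "\<And>v. v \<in> states \<Longrightarrow> (supp Y \<bullet> v = 1) = (supp Y' \<bullet> v = 1)"
  shows "supp Y = supp Y'"
  using idem_le_by_states[OF supp_idem supp_idem, of Y' Y] idem_le_by_states[OF supp_idem supp_idem, of Y Y']
    assms comm by metis

lemma U_supp_flog:
  assumes "Y \<in> C" shows "U (supp Y) (flog Y) = flog Y"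
proof -
  obtain p h where p: "jframe jrank p" "Y = lc jrank p h" "\<And>i. i < jrank \<Longrightarrow> 0 \<le> h i"
    using decomp_C assms by blast
  note o = jframe_osys[OF p(1)]
  show ?thesis unfolding p(2) supp_lc[OF o] flog_lc[OF o] U_lc[OF o]
    using p(3) by (intro sum.cong) (auto simp: order_less_le)
qed

lemma fexp_flog_supp:
  assumes "Y \<in> C" shows "fexp (flog Y) = Y + (u - supp Y)"
proof -
  obtain p h where p: "jframe jrank p" "Y = lc jrank p h" "\<And>i. i < jrank \<Longrightarrow> 0 \<le> h i"
    using decomp_C assms by blast
  note o = jframe_osys[OF p(1)]
  have "u = lc jrank p (\<lambda>_. 1)" using osys_unit[OF o, of 1] by simp
  then have "Y + (u - supp Y) = lc jrank p (\<lambda>i. h i + (1 - (if 0 < h i then 1 else 0)))"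
    unfolding p(2) supp_lc[OF o] by (simp add: scaleR_add_left scaleR_diff_left sum.distrib sum_subtractf)
  also have "\<dots> = fexp (flog Y)" unfolding p(2) flog_lc[OF o] fexp_lc[OF o]
    using p(3) by (intro sum.cong) (auto simp: order_less_le)
  finally show ?thesis ..
qed

text \<open>The zeros of \<open>Q\<close> determine the support. On it, states compressed by the
  support idempotent recover \<open>flog Y\<close>, and \<open>fexp_flog_supp\<close> recovers
  \<open>Y\<close> from its logarithm and its support.\<close>

lemma Q_injective:
  assumes Y: "Y \<in> C" "Y' \<in> C" and eq: "\<And>v. v \<in> states \<Longrightarrow> Q v Y = Q v Y'"
  shows "Y = Y'"
proof -
  have "(supp Y \<bullet> v = 1) = (supp Y' \<bullet> v = 1)" if "v \<in> states" for v
    using eq[OF that] unfolding Q_def by (metis exp_not_eq_zero)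
  then have s: "supp Y = supp Y'" by (rule supp_eqI)
  have lgv: "flog Y \<bullet> v = flog Y' \<bullet> v" if "v \<in> states" "supp Y \<bullet> v = 1" for v
    using eq[OF that(1)] that(2) s by (simp add: Q_def)
  have "flog Y - flog Y' = 0"
  proof (rule zero_by_states)
    fix v assume v: "v \<in> states"
    let ?e = "supp Y"
    have U: "U ?e (flog Y - flog Y') = flog Y - flog Y'"
      using U_supp_flog[OF Y(1)] U_supp_flog[OF Y(2)] s by (simp add: U_diff)
    have eC: "?e \<in> C" using idem_in_C supp_idem by blast
    have Uee: "U ?e ?e = ?e" using supp_idem by (simp add: U_def scaleR_2)
    show "(flog Y - flog Y') \<bullet> v = 0"
    proof (cases "0 < (?e \<odot> ?e) \<bullet> v")
      case True
      then obtain w where w: "w \<in> states" "\<And>x. U ?e x \<bullet> v = ((?e \<odot> ?e) \<bullet> v) * (x \<bullet> w)"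
        using state_compress[OF v eC] by metis
      have "?e \<bullet> w = 1" using w(2)[of ?e] Uee supp_idem[of Y] True by simp
      then have "(flog Y - flog Y') \<bullet> w = 0" using lgv w(1) by (simp add: inner_diff_left)
      then show ?thesis using w(2)[of "flog Y - flog Y'"] U by simp
    next
      case False
      then have "(?e \<odot> ?e) \<bullet> v = 0" using states_C[OF v] eC supp_idem by (metis antisym_conv2)
      then show ?thesis using U_null[OF v eC, of "flog Y - flog Y'"] U by simp
    qed
  qed
  then have "fexp (flog Y) = fexp (flog Y')" by simp
  then show ?thesis using fexp_flog_supp[OF Y(1)] fexp_flog_supp[OF Y(2)] s by simp
qed


text \<open>For \<open>Y = fexp x\<close> this is \<open>exp (lam_max (x - z))\<close>, see
  \<open>norm_gauge_fexp\<close>; the form with states still makes sense when \<open>Y\<close> has a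
  kernel.\<close>

definition norm_gauge :: "'a \<Rightarrow> 'a \<Rightarrow> real" where
  "norm_gauge Y z = (SUP v\<in>states. exp (- (z \<bullet> v)) * Q v Y)"

lemma norm_gauge_le_iff:
  assumes "Y \<in> C" shows "norm_gauge Y z \<le> t \<longleftrightarrow> (\<forall>v\<in>states. exp (- (z \<bullet> v)) * Q v Y \<le> t)"
proof -
  have "exp (- (z \<bullet> v)) * Q v Y \<le> exp (lam_max (- z)) * lam_max Y" if "v \<in> states" for v
    using states_le_lam_max[OF that, of "- z"] Q_le_lam_max[OF that assms] Q_nonneg by (intro mult_mono) auto
  then have "bdd_above ((\<lambda>v. exp (- (z \<bullet> v)) * Q v Y) ` states)"
    by (intro bdd_aboveI2)
  then show ?thesis unfolding norm_gauge_def using states_nonempty by (intro cSUP_le_iff)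
qed

lemma norm_gauge_upper: "Y \<in> C \<Longrightarrow> v \<in> states \<Longrightarrow> exp (- (z \<bullet> v)) * Q v Y \<le> norm_gauge Y z"
  using norm_gauge_le_iff[of Y z "norm_gauge Y z"] by blast

lemma norm_gauge_nonneg: "Y \<in> C \<Longrightarrow> 0 \<le> norm_gauge Y z"
proof -
  assume Y: "Y \<in> C"
  obtain v where v: "v \<in> states" using states_nonempty by blast
  have "0 \<le> exp (- (z \<bullet> v)) * Q v Y" using Q_nonneg by simp
  then show ?thesis using norm_gauge_upper[OF Y v, of z] by linarith
qed

lemma le_Q_by_reg_log:
  assumes v: "v \<in> states" and Y: "Y \<in> C" and le: "\<And>e. 0 < e \<Longrightarrow> t \<le> c * exp (reg_log e Y \<bullet> v)" and c: "0 < c"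
  shows "t \<le> c * Q v Y"
proof (rule ccontr)
  assume "\<not> t \<le> c * Q v Y"
  then have "0 < t / c - Q v Y" using c by (simp add: field_simps)
  then obtain e where e: "e > 0" "exp (reg_log e Y \<bullet> v) < Q v Y + (t / c - Q v Y)"
    using Q_reg_log_limit[OF v Y] by blast
  then have "c * exp (reg_log e Y \<bullet> v) < t" using c by (simp add: field_simps)
  then show False using le[OF e(1)] by simp
qed

lemma fcalc_C: 
  assumes "\<And>t. 0 \<le> f t" shows "fcalc f x \<in> C"
proof -
  obtain p l where p: "jframe jrank p" "x = lc jrank p l" by (rule decomp)
  show ?thesis unfolding p(2) fcalc_lc[OF jframe_osys[OF p(1)]]
    using assms by (intro osys_C[OF jframe_osys[OF p(1)]]) simp
qed

lemma reg_log_tendsto: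
  assumes "0 < e" "Ys \<longlonglongrightarrow> Y" shows "(\<lambda>n. reg_log e (Ys n)) \<longlonglongrightarrow> reg_log e Y"
  using continuous_on_tendsto_compose[OF reg_log_continuous[OF assms(1), of UNIV] assms(2)] by simp

text \<open>If the claim failed, nearly maximising states would accumulate at a state
  \<open>w\<close>. Their lower bound passes to \<open>w\<close> for each fixed \<open>e\<close>
  through the continuous \<open>reg_log e\<close>, and then to \<open>Q w Y\<close>.\<close>

lemma norm_gauge_usc:
  assumes Ys: "\<And>n. Ys n \<in> C" "Y \<in> C" "Ys \<longlonglongrightarrow> Y" and a: "norm_gauge Y z < a"
  shows "\<forall>\<^sub>F n in sequentially. norm_gauge (Ys n) z < a"
proof (rule ccontr)
  assume *: "\<not> (\<forall>\<^sub>F n in sequentially. norm_gauge (Ys n) z < a)"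
  obtain a' where a': "norm_gauge Y z < a'" "a' < a" using a dense by blast
  have "infinite {n. \<not> norm_gauge (Ys n) z < a}"
    using * unfolding eventually_sequentially infinite_nat_iff_unbounded_le by auto
  then obtain s :: "nat \<Rightarrow> nat" where s: "strict_mono s" "\<And>n. s n \<in> {n. \<not> norm_gauge (Ys n) z < a}"
    using infinite_enumerate by blast
  have "\<exists>v\<in>states. a' < exp (- (z \<bullet> v)) * Q v (Ys (s n))" for n
  proof -
    have "\<not> norm_gauge (Ys (s n)) z \<le> a'" using s(2)[of n] a'(2) by auto
    then show ?thesis unfolding norm_gauge_le_iff[OF Ys(1)] by force
  qed
  then obtain v where v: "\<And>n. v n \<in> states" "\<And>n. a' < exp (- (z \<bullet> v n)) * Q (v n) (Ys (s n))" by metis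
  obtain w t where w: "w \<in> states" "strict_mono (t :: nat \<Rightarrow> nat)" "(v \<circ> t) \<longlonglongrightarrow> w"
    using states_compact v(1) unfolding compact_def by blast
  have vt: "(\<lambda>n. v (t n)) \<longlonglongrightarrow> w" using w(3) by (simp add: o_def)
  have Yt: "(\<lambda>n. Ys (s (t n))) \<longlonglongrightarrow> Y"
    using LIMSEQ_subseq_LIMSEQ[OF LIMSEQ_subseq_LIMSEQ[OF Ys(3) s(1)] w(2)] by (simp add: o_def)
  have "a' \<le> exp (- (z \<bullet> w)) * Q w Y"
  proof (rule le_Q_by_reg_log[OF w(1) Ys(2)])
    fix e :: real assume e: "0 < e"
    have "(\<lambda>n. exp (- (z \<bullet> v (t n))) * exp (reg_log e (Ys (s (t n))) \<bullet> v (t n)))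
        \<longlonglongrightarrow> exp (- (z \<bullet> w)) * exp (reg_log e Y \<bullet> w)"
      by (intro tendsto_intros vt reg_log_tendsto[OF e Yt])
    moreover have "a' \<le> exp (- (z \<bullet> v (t n))) * exp (reg_log e (Ys (s (t n))) \<bullet> v (t n))" for n
    proof -
      have "exp (- (z \<bullet> v (t n))) * Q (v (t n)) (Ys (s (t n))) \<le> exp (- (z \<bullet> v (t n))) * exp (reg_log e (Ys (s (t n))) \<bullet> v (t n))"
        using Q_le_reg_log[OF v(1) Ys(1) e] by (intro mult_left_mono) auto
      then show ?thesis using v(2)[of "t n"] by linarith
    qed
    ultimately show "a' \<le> exp (- (z \<bullet> w)) * exp (reg_log e Y \<bullet> w)"
      by (intro LIMSEQ_le_const) auto
  qed simp
  then show False using norm_gauge_upper[OF Ys(2) w(1), of z] a'(1) by linarith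
qed

text \<open>A nearly maximising state v for Y need not have finite entropy for Ys n. It is compressed by
  the cut-off f (Ys n), which removes the small eigenvalues and converges to the support of Y.\<close>

lemma norm_gauge_lsc:
  assumes Ys: "\<And>n. Ys n \<in> C" "Y \<in> C" "Ys \<longlonglongrightarrow> Y" and a: "a < norm_gauge Y z"
  shows "\<forall>\<^sub>F n in sequentially. a < norm_gauge (Ys n) z"
proof (cases "a < 0")
  case True
  have "a < norm_gauge (Ys n) z" for n using norm_gauge_nonneg[OF Ys(1), of n z] True by linarith
  then show ?thesis by simp
next
  case a0: False
  have "\<not> norm_gauge Y z \<le> a" using a by simp
  then obtain v where v: "v \<in> states" "a < exp (- (z \<bullet> v)) * Q v Y"
    unfolding norm_gauge_le_iff[OF Ys(2)] by force
  have sv: "supp Y \<bullet> v = 1"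
  proof (rule ccontr)
    assume "supp Y \<bullet> v \<noteq> 1"
    then have "Q v Y = 0" by (simp add: Q_def)
    then show False using v(2) a0 by simp
  qed
  obtain p h where p: "jframe jrank p" "Y = lc jrank p h" "\<And>i. i < jrank \<Longrightarrow> 0 \<le> h i"
    using decomp_C Ys(2) by blast
  note o = jframe_osys[OF p(1)]
  obtain c where c: "0 < c" "\<And>i. i < jrank \<Longrightarrow> 0 < h i \<Longrightarrow> c \<le> h i"
    using positive_lower_bound[of jrank h] by metis
  \<comment> \<open>No eigenvalue of \<open>Y\<close> lies strictly between 0 and \<open>c\<close>,
    so the ramp from \<open>c / 2\<close> to \<open>c\<close> makes \<open>f\<close> continuous
    while \<open>f\<close> of \<open>Y\<close> is exactly its support.\<close>
  define f where "f t = max 0 (min 1 (2 * t / c - 1))" for t :: real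
  \<comment> \<open>Stands for \<open>f t * f t * ln t\<close>, the logarithm after compression.
    Where \<open>max\<close> alters the argument \<open>f\<close> vanishes, so the value is
    unchanged and \<open>F\<close> is continuous.\<close>
  define F where "F t = f t * f t * ln (max t (c/2))" for t :: real
  have f0: "0 \<le> f t" for t by (simp add: f_def)
  have f_low: "f t = 0" if "t \<le> c/2" for t using that c(1) by (simp add: f_def field_simps)
  have f_high: "f t = 1" if "c \<le> t" for t using that c(1) by (simp add: f_def field_simps)
  have cf: "continuous_on UNIV f" unfolding f_def using c(1) by (intro continuous_intros) auto
  have cF: "continuous_on UNIV F" unfolding F_def using c(1)
    by (intro continuous_intros cf) (auto simp: max_def)
  have hcases: "h i = 0 \<or> c \<le> h i" if "i < jrank" for i using p(3)[OF that] c(2)[OF that] by linarith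
  have fY: "fcalc f Y = supp Y" unfolding p(2) fcalc_lc[OF o] supp_lc[OF o]
  proof (rule sum.cong[OF refl])
    fix i assume "i \<in> {..<jrank}"
    then have "h i = 0 \<or> c \<le> h i" using hcases by simp
    then show "f (h i) *\<^sub>R p i = (if 0 < h i then 1 else 0) *\<^sub>R p i"
      using f_low[of 0] f_high[of "h i"] c(1) by auto
  qed
  have FY: "fcalc F Y = flog Y" unfolding p(2) fcalc_lc[OF o] flog_lc[OF o]
  proof (rule sum.cong[OF refl])
    fix i assume "i \<in> {..<jrank}"
    then have "h i = 0 \<or> c \<le> h i" using hcases by simp
    then show "F (h i) *\<^sub>R p i = ln (h i) *\<^sub>R p i"
      using f_low[of 0] f_high[of "h i"] c(1) by (auto simp: F_def max_def)
  qed
  define A where "A n = fcalc f (Ys n)" for n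
  define t where "t n = (A n \<odot> A n) \<bullet> v" for n
  \<comment> \<open>The value at the state compressed from \<open>v\<close> by \<open>A n\<close>,
    expressed through \<open>v\<close> so that its limit can be computed before that state is
    constructed.\<close>
  define r where "r n = exp (- ((U (A n) z \<bullet> v) / t n)) * exp ((fcalc F (Ys n) \<bullet> v) / t n)" for n
  have A: "A \<longlonglongrightarrow> supp Y" unfolding A_def fY[symmetric] by (rule fcalc_sequentially[OF cf Ys(3)])
  have AA: "(\<lambda>n. A n \<odot> A n) \<longlonglongrightarrow> supp Y" using tendsto[OF A A] by (simp add: supp_idem)
  have tl: "t \<longlonglongrightarrow> 1" unfolding t_def using tendsto_inner[OF AA tendsto_const, of v] sv by simp
  have Fl: "(\<lambda>n. fcalc F (Ys n)) \<longlonglongrightarrow> flog Y" unfolding FY[symmetric] by (rule fcalc_sequentially[OF cF Ys(3)])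
  have Ul: "(\<lambda>n. U (A n) z) \<longlonglongrightarrow> U (supp Y) z"
    unfolding U_def by (intro tendsto_intros tendsto A)
  have "r \<longlonglongrightarrow> exp (- ((U (supp Y) z \<bullet> v) / 1)) * exp ((flog Y \<bullet> v) / 1)"
    unfolding r_def by (intro tendsto_intros tl Fl Ul) auto
  moreover have "exp (- ((U (supp Y) z \<bullet> v) / 1)) * exp ((flog Y \<bullet> v) / 1) = exp (- (z \<bullet> v)) * Q v Y"
    using state_unit_mult(2)[OF v(1) supp_idem sv, of z] sv by (simp add: Q_def)
  ultimately have "r \<longlonglongrightarrow> exp (- (z \<bullet> v)) * Q v Y" by simp
  then have "\<forall>\<^sub>F n in sequentially. a < r n" using v(2) by (rule order_tendstoD(1))
  moreover have "\<forall>\<^sub>F n in sequentially. 0 < t n" using tl by (rule order_tendstoD(1)) simp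
  ultimately show ?thesis
  proof (rule eventually_elim2)
    fix n assume an: "a < r n" and tn: "0 < t n"
    have AC: "A n \<in> C" unfolding A_def using f0 by (rule fcalc_C)
    obtain w where w: "w \<in> states" "\<And>x. U (A n) x \<bullet> v = t n * (x \<bullet> w)"
      using state_compress[OF v(1) AC] tn unfolding t_def by metis
    obtain q k where q: "jframe jrank q" "Ys n = lc jrank q k" "\<And>i. i < jrank \<Longrightarrow> 0 \<le> k i"
      using decomp_C Ys(1) by blast
    note oq = jframe_osys[OF q(1)]
    have "U (A n) (supp (Ys n)) = A n \<odot> A n"
      unfolding A_def q(2) fcalc_lc[OF oq] supp_lc[OF oq] U_lc[OF oq] osys_mult[OF oq]
    proof (rule sum.cong[OF refl])
      fix i assume "i \<in> {..<jrank}"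
      then show "(f (k i) * f (k i) * (if 0 < k i then 1 else 0)) *\<^sub>R q i = (f (k i) * f (k i)) *\<^sub>R q i"
        using q(3)[of i] f_low[of "k i"] c(1) by (cases "k i = 0") auto
    qed
    then have "t n = t n * (supp (Ys n) \<bullet> w)" using w(2)[of "supp (Ys n)"] by (simp add: t_def)
    then have shift1: "supp (Ys n) \<bullet> w = 1" using tn by simp
    have "U (A n) (flog (Ys n)) = fcalc F (Ys n)"
      unfolding A_def q(2) fcalc_lc[OF oq] flog_lc[OF oq] U_lc[OF oq]
    proof (rule sum.cong[OF refl])
      fix i assume "i \<in> {..<jrank}"
      show "(f (k i) * f (k i) * ln (k i)) *\<^sub>R q i = F (k i) *\<^sub>R q i"
        using f_low[of "k i"] by (cases "k i \<le> c/2") (auto simp: F_def)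
    qed
    then have "flog (Ys n) \<bullet> w = (fcalc F (Ys n) \<bullet> v) / t n" "z \<bullet> w = (U (A n) z \<bullet> v) / t n"
      using w(2)[of "flog (Ys n)"] w(2)[of z] tn by simp_all
    then have "r n = exp (- (z \<bullet> w)) * Q w (Ys n)" using shift1 by (simp add: r_def Q_def)
    then show "a < norm_gauge (Ys n) z" using norm_gauge_upper[OF Ys(1) w(1), of z n] an by linarith
  qed
qed

lemma norm_gauge_continuous: "continuous_on B (\<lambda>Y. norm_gauge Y z)"
proof (rule continuous_on_sequentiallyI)
  fix Ys Y assume Ys: "\<forall>n. Ys n \<in> B" "Y \<in> B" "Ys \<longlonglongrightarrow> Y"
  have Y: "\<And>n. Ys n \<in> C" "Y \<in> C" using Ys by auto
  show "(\<lambda>n. norm_gauge (Ys n) z) \<longlonglongrightarrow> norm_gauge Y z"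
    by (rule order_tendstoI) (use norm_gauge_lsc[OF Y Ys(3)] norm_gauge_usc[OF Y Ys(3)] in blast)+
qed

text \<open>One direction compares zeros of \<open>Q\<close>. For the other, a state concentrated on
  the smaller support has \<open>Q v Y \<le> 1\<close> and \<open>c \<le> Q v Y'\<close>, where
  \<open>c\<close> bounds the positive eigenvalues of \<open>Y'\<close> from below; hence the
  constant \<open>1 / c\<close>.\<close>

lemma Q_rel_supp_iff:
  assumes B: "Y \<in> B" "Y' \<in> B"
  shows "(\<exists>b>0. \<forall>v\<in>states. Q v Y \<le> b * Q v Y') \<longleftrightarrow> supp Y' \<odot> supp Y = supp Y"
proof
  have YC: "Y \<in> C" "Y' \<in> C" using B by auto
  {
    assume "\<exists>b>0. \<forall>v\<in>states. Q v Y \<le> b * Q v Y'"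
    then obtain b where b: "b > 0" "\<And>v. v \<in> states \<Longrightarrow> Q v Y \<le> b * Q v Y'" by blast
    show "supp Y' \<odot> supp Y = supp Y"
    proof (rule idem_le_by_states[OF supp_idem supp_idem])
      fix v assume v: "v \<in> states" "supp Y \<bullet> v = 1"
      then have "0 < Q v Y" by (simp add: Q_def)
      then have "Q v Y' \<noteq> 0" using b(2)[OF v(1)] by auto
      then show "supp Y' \<bullet> v = 1" unfolding Q_def by metis
    qed
  next
    assume le: "supp Y' \<odot> supp Y = supp Y"
    obtain p h where p: "jframe jrank p" "Y' = lc jrank p h" "\<And>i. i < jrank \<Longrightarrow> 0 \<le> h i"
      using decomp_C YC(2) by blast
    note o = jframe_osys[OF p(1)]
    obtain c where c: "0 < c" "\<And>i. i < jrank \<Longrightarrow> 0 < h i \<Longrightarrow> c \<le> h i"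
      using positive_lower_bound[of jrank h] by metis
    have "Q v Y \<le> (1 / c) * Q v Y'" if v: "v \<in> states" for v
    proof (cases "supp Y \<bullet> v = 1")
      case True
      have "0 \<le> (supp Y' - supp Y) \<bullet> v" using states_C[OF v idem_diff(2)[OF supp_idem supp_idem le]] .
      moreover have "0 \<le> (u - supp Y') \<bullet> v" using states_C[OF v] idem_in_B[OF supp_idem] by blast
      ultimately have s': "supp Y' \<bullet> v = 1" using True v by (simp add: inner_diff_left)
      note w = state_osys_weights[OF o v]
      have z: "p i \<bullet> v = 0" if "i < jrank" "h i = 0" for i
        using that s' supp_state_iff[OF o v, of h] p by simp
      have "ln c = (\<Sum>i<jrank. ln c * (p i \<bullet> v))" unfolding sum_distrib_left[symmetric] w(2) by simp
      also have "\<dots> \<le> flog Y' \<bullet> v"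
        unfolding p(2) flog_lc[OF o] lc_inner
      proof (rule sum_mono)
        fix i assume i: "i \<in> {..<jrank}"
        show "ln c * (p i \<bullet> v) \<le> ln (h i) * (p i \<bullet> v)"
        proof (cases "h i = 0")
          case False
          then have "ln c \<le> ln (h i)" using c(1) c(2)[of i] p(3)[of i] i by force
          then show ?thesis using w(1)[of i] i by (intro mult_right_mono) auto
        qed (use z i in simp)
      qed
      finally have "c \<le> Q v Y'" using s' c(1) by (metis Q_def exp_le_cancel_iff exp_ln)
      moreover have "Q v Y \<le> 1" using Q_le_lam_max[OF v YC(1)] lam_max_le_iff[of Y 1] B by simp
      moreover have "c * Q v Y \<le> c * 1" using c(1) \<open>Q v Y \<le> 1\<close> by (intro mult_left_mono) auto
      ultimately have "c * Q v Y \<le> Q v Y'" by linarith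
      then show ?thesis using c(1) by (simp add: field_simps)
    qed (use Q_nonneg c in \<open>simp add: Q_def\<close>)
    then show "\<exists>b>0. \<forall>v\<in>states. Q v Y \<le> b * Q v Y'" using c(1) by (intro exI[of _ "1 / c"]) auto
  }
qed

lemma norm_gauge_fexp: "norm_gauge (fexp x) z = exp (lam_max (x - z))"
proof -
  have q: "exp (- (z \<bullet> v)) * Q v (fexp x) = exp ((x - z) \<bullet> v)" if "v \<in> states" for v
    using Q_fexp[OF that, of x] by (simp add: exp_diff exp_minus inner_diff_left field_simps)
  have "norm_gauge (fexp x) z \<le> exp (lam_max (x - z))"
    unfolding norm_gauge_le_iff[OF fexp_C] using q states_le_lam_max by simp
  moreover obtain v where v: "v \<in> states" "(x - z) \<bullet> v = lam_max (x - z)" using lam_max_attained by blast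
  then have "exp (lam_max (x - z)) \<le> norm_gauge (fexp x) z" using norm_gauge_upper[OF fexp_C v(1), of z x] q[OF v(1)] by simp
  ultimately show ?thesis by simp
qed

text \<open>In case 9 the points may run to the boundary, so \<open>Q\<close> is bounded through
  \<open>reg_log\<close> before the limit is taken. Case 13 holds because both comparisons amount to
  inclusion of supports.\<close>

lemma gauge_norm: "gauge m u norm_gauge (\<lambda>b Y Y'. \<forall>v\<in>states. Q v Y \<le> b * Q v Y')"
proof (unfold_locales, goal_cases)
  case (1 z)
  show ?case by (rule norm_gauge_continuous)
next
  case (2 Y z)
  then show ?case by (rule norm_gauge_nonneg)
next
  case (3 Y z)
  obtain v where v: "v \<in> states" "Q v Y = lam_max Y" using Q_eigen 3 by blast
  have "0 < lam_max Y" using lam_max_C_zero 3 by fastforce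
  then have "0 < exp (- (z \<bullet> v)) * Q v Y" using v by simp
  then show ?case using norm_gauge_upper[OF 3(1) v(1), of z] by linarith
next
  case (4 Y c z)
  have "c *\<^sub>R Y \<in> C" using 4 C_scale by simp
  show ?case
  proof (rule real_eq_by_le)
    fix t
    have "exp (- (z \<bullet> v)) * Q v (c *\<^sub>R Y) \<le> t \<longleftrightarrow> exp (- (z \<bullet> v)) * Q v Y \<le> t / c" if "v \<in> states" for v
      using Q_scale[OF 4 that] 4(2) by (simp add: pos_le_divide_eq mult_ac)
    then have "norm_gauge (c *\<^sub>R Y) z \<le> t \<longleftrightarrow> norm_gauge Y z \<le> t / c"
      unfolding norm_gauge_le_iff[OF \<open>c *\<^sub>R Y \<in> C\<close>] norm_gauge_le_iff[OF 4(1)] by simp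
    then show "norm_gauge (c *\<^sub>R Y) z \<le> t \<longleftrightarrow> c * norm_gauge Y z \<le> t"
      using 4(2) by (simp add: pos_le_divide_eq mult.commute)
  qed
next
  case (5 Y z c)
  show ?case
  proof (rule real_eq_by_le)
    fix t
    have "exp (- ((z + c *\<^sub>R u) \<bullet> v)) * Q v Y \<le> t \<longleftrightarrow> exp (- (z \<bullet> v)) * Q v Y \<le> t * exp c" if "v \<in> states" for v
    proof -
      have "- ((z + c *\<^sub>R u) \<bullet> v) = - (z \<bullet> v) - c" using that by (simp add: inner_add_left)
      then show ?thesis by (simp add: exp_diff pos_divide_le_eq)
    qed
    then have "norm_gauge Y (z + c *\<^sub>R u) \<le> t \<longleftrightarrow> norm_gauge Y z \<le> t * exp c" unfolding norm_gauge_le_iff[OF 5] by simp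
    then show "norm_gauge Y (z + c *\<^sub>R u) \<le> t \<longleftrightarrow> exp (- c) * norm_gauge Y z \<le> t" by (simp add: exp_minus field_simps)
  qed
next
  case (6 Y)
  show ?case
  proof (cases "Y = 0")
    case True
    have "Q v 0 = 0" if "v \<in> states" for v
      using Q_le_lam_max[OF that C_0] Q_nonneg[of v 0] by simp
    then have "norm_gauge Y 0 \<le> 0" unfolding norm_gauge_le_iff[OF 6] using True by simp
    then show ?thesis using norm_gauge_nonneg[OF 6, of 0] True by simp
  next
    case False
    then obtain v where v: "v \<in> states" "Q v Y = lam_max Y" using Q_eigen 6 by blast
    have "norm_gauge Y 0 \<le> lam_max Y" unfolding norm_gauge_le_iff[OF 6] using Q_le_lam_max 6 by simp
    then show ?thesis using norm_gauge_upper[OF 6 v(1), of 0] v(2) by simp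
  qed
next
  case (7 x z)
  show ?case by (simp add: norm_gauge_fexp)
next
  case (8 Y y)
  show ?case
  proof (cases "Y = 0")
    case True
    then show ?thesis using norm_gauge_nonneg[OF 8(1)] by simp
  next
    case False
    then obtain v where v: "v \<in> states" "Q v Y = lam_max Y" using Q_eigen 8 by blast
    have "0 \<le> (- y) \<bullet> v" using states_C[OF v(1) 8(2)] .
    then have "1 * lam_max Y \<le> exp (- (y \<bullet> v)) * Q v Y" unfolding v(2)
      using lam_max_nonneg[OF 8(1)] by (intro mult_right_mono) auto
    then show ?thesis using norm_gauge_upper[OF 8(1) v(1), of y] by simp
  qed
next
  case (9 Y b ys Y')
  then have YC: "Y \<in> C" "Y' \<in> C" by auto
  show ?case
  proof
    fix v assume v: "v \<in> states"
    show "Q v Y \<le> b * Q v Y'"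
    proof (rule le_Q_by_reg_log[OF v YC(2) _ 9(2)])
      fix e :: real assume e: "0 < e"
      have "Q v Y \<le> b * exp (reg_log e (fexp (ys n)) \<bullet> v)" for n
      proof -
        have "exp (- (ys n \<bullet> v)) * Q v Y \<le> b" using norm_gauge_upper[OF YC(1) v, of "ys n"] 9(5)[of n] by linarith
        then have "Q v Y \<le> b * exp (ys n \<bullet> v)" by (simp add: exp_minus field_simps)
        also have "\<dots> \<le> b * exp (reg_log e (fexp (ys n)) \<bullet> v)"
          using Q_le_reg_log[OF v fexp_C e, of "ys n"] Q_fexp[OF v, of "ys n"] 9(2) by simp
        finally show ?thesis .
      qed
      moreover have "(\<lambda>n. b * exp (reg_log e (fexp (ys n)) \<bullet> v)) \<longlonglongrightarrow> b * exp (reg_log e Y' \<bullet> v)"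
        by (intro tendsto_intros reg_log_tendsto[OF e 9(3)])
      ultimately show "Q v Y \<le> b * exp (reg_log e Y' \<bullet> v)" by (intro LIMSEQ_le_const) auto
    qed
  qed
next
  case (10 Y)
  show ?case by simp
next
  case (11 Y Y')
  then show ?case by (intro Q_injective) (auto intro: order_antisym)
next
  case (12 Y Y' y b)
  have YC: "Y \<in> C" using 12 by auto
  show ?case unfolding norm_gauge_le_iff[OF YC]
  proof
    fix v assume v: "v \<in> states"
    have "Q v Y \<le> b * Q v Y'" using 12 v by blast
    also have "\<dots> \<le> b * exp (y \<bullet> v)" using Q_dominates[OF v 12(2)] 12(3) by simp
    finally show "exp (- (y \<bullet> v)) * Q v Y \<le> b" by (simp add: exp_minus field_simps)
  qed
next
  case (13 Y Y')
  then show ?case using Q_rel_supp_iff order_supp_iff by simp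
qed


subsection \<open>The common compactification\<close>

text \<open>The flag hil selects part (b), with the variation norm and the Hilbert distance.\<close>

definition shift1 :: "bool \<Rightarrow> 'a \<Rightarrow> real" where
  "shift1 hil x = (if hil then lam_max x else max (lam_max x) (lam_max (- x)))"

definition shift2 :: "bool \<Rightarrow> 'a \<Rightarrow> real" where
  "shift2 hil x = (if hil then lam_max (- x) else max (lam_max x) (lam_max (- x)))"

definition combine :: "bool \<Rightarrow> real \<Rightarrow> real \<Rightarrow> real" where
  "combine hil a b = (if hil then a * b else max a b)"

definition radius :: "bool \<Rightarrow> 'a \<Rightarrow> real" where
  "radius hil x = (if hil then lam_max x + lam_max (- x) else max (lam_max x) (lam_max (- x)))"

definition embed :: "bool \<Rightarrow> 'a \<Rightarrow> 'a \<times> 'a" where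
  "embed hil x = (fexp (x - shift1 hil x *\<^sub>R u), fexp (- x - shift2 hil x *\<^sub>R u))"

definition K :: "bool \<Rightarrow> ('a \<times> 'a) set" where
  "K hil = closure (range (embed hil))"

lemma fexp_shift_diff: "fexp (x - c *\<^sub>R u) = exp (- c) *\<^sub>R fexp x"
  using fexp_shift[of x "- c"] by simp

lemma lam_max_fexp: "lam_max (fexp x) = exp (lam_max x)"
proof -
  obtain p l where p: "jframe jrank p" "x = lc jrank p l" by (rule decomp)
  note n = jframe_nsys[OF p(1)] and e = fexp_lc[OF jframe_osys[OF p(1)], of l]
  obtain i where i: "i < jrank" "lam_max x = l i" using lam_max_nsys(2)[OF n, of l] p(2) by blast
  obtain j where j: "j < jrank" "lam_max (fexp x) = exp (l j)"
    using lam_max_nsys(2)[OF n, of "\<lambda>i. exp (l i)"] p(2) e by auto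
  have "exp (l i) \<le> lam_max (fexp x)" using lam_max_nsys(1)[OF n i(1), of "\<lambda>i. exp (l i)"] p(2) e by simp
  moreover have "l j \<le> lam_max x" using lam_max_nsys(1)[OF n j(1), of l] p(2) by simp
  ultimately show ?thesis using i j by simp
qed

lemma s_ge: "lam_max x \<le> shift1 hil x" "lam_max (- x) \<le> shift2 hil x"
  by (simp_all add: shift1_def shift2_def)

lemma embed_le: "- (x - shift1 hil x *\<^sub>R u) \<in> C" "- (- x - shift2 hil x *\<^sub>R u) \<in> C"
  using s_ge[of x hil] lam_max_le_iff[of x "shift1 hil x"] lam_max_le_iff[of "- x" "shift2 hil x"] by simp_all

lemma embed_B: "embed hil x \<in> B \<times> B"
  using fexp_le_unit[OF embed_le(1)] fexp_le_unit[OF embed_le(2)] by (simp add: embed_def)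

lemma K_B: "K hil \<subseteq> B \<times> B"
  unfolding K_def using embed_B compact_imp_closed[OF compact_Times[OF B_compact B_compact]]
  by (intro closure_minimal) blast+

lemma K_mem: "k \<in> K hil \<Longrightarrow> fst k \<in> B" "k \<in> K hil \<Longrightarrow> snd k \<in> B"
  using K_B by fastforce+

lemma K_compact: "compact (K hil)"
proof -
  have "compact (B \<times> B)" by (intro compact_Times B_compact)
  then have "compact ((B \<times> B) \<inter> K hil)" by (rule compact_Int_closed) (simp add: K_def)
  moreover have "(B \<times> B) \<inter> K hil = K hil" using K_B by blast
  ultimately show ?thesis by simp
qed

lemma embed_K: "embed hil x \<in> K hil"
  unfolding K_def by (rule subsetD[OF closure_subset rangeI])

lemma K_sequence: "k \<in> K hil \<Longrightarrow> \<exists>x. (\<lambda>n. embed hil (x n)) \<longlonglongrightarrow> k"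
proof -
  assume "k \<in> K hil"
  then obtain y where y: "\<And>n. y n \<in> range (embed hil)" "y \<longlonglongrightarrow> k"
    unfolding K_def closure_sequential by blast
  have "\<exists>x. y n = embed hil x" for n using y(1)[of n] by blast
  then obtain x where "\<And>n. y n = embed hil (x n)" by metis
  then have "y = (\<lambda>n. embed hil (x n))" by blast
  then show ?thesis using y(2) by blast
qed

text \<open>The normalisation of \<open>embed\<close> is an equation between continuous functions
  and survives the closure. It keeps both components nonzero in part (b) and at least one in part
  (a), so \<open>Theta\<close> is the logarithm of a positive number.\<close>

lemma K_norm:
  assumes "k \<in> K hil"
  shows "combine hil (lam_max (fst k)) (lam_max (snd k)) = 1" "hil \<Longrightarrow> lam_max (fst k) = 1" "hil \<Longrightarrow> lam_max (snd k) = 1"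
proof -
  obtain x where x: "(\<lambda>n. embed hil (x n)) \<longlonglongrightarrow> k" using K_sequence[OF assms] by blast
  have L: "(\<lambda>n. lam_max (fst (embed hil (x n)))) \<longlonglongrightarrow> lam_max (fst k)"
    "(\<lambda>n. lam_max (snd (embed hil (x n)))) \<longlonglongrightarrow> lam_max (snd k)"
    by (intro lam_max_tendsto tendsto_fst[OF x], intro lam_max_tendsto tendsto_snd[OF x])
  have e: "lam_max (fst (embed hil y)) = exp (lam_max y - shift1 hil y)" "lam_max (snd (embed hil y)) = exp (lam_max (- y) - shift2 hil y)" for y
    using lam_max_shift[of y "- shift1 hil y"] lam_max_shift[of "- y" "- shift2 hil y"] by (simp_all add: embed_def lam_max_fexp)
  show h1: "hil \<Longrightarrow> lam_max (fst k) = 1" using L(1) unfolding e by (simp add: shift1_def LIMSEQ_const_iff)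
  show h2: "hil \<Longrightarrow> lam_max (snd k) = 1" using L(2) unfolding e by (simp add: shift2_def LIMSEQ_const_iff)
  show "combine hil (lam_max (fst k)) (lam_max (snd k)) = 1"
  proof (cases hil)
    case False
    then have "max (lam_max (fst (embed hil y))) (lam_max (snd (embed hil y))) = 1" for y
      unfolding e by (simp add: shift1_def shift2_def max_def)
    then have "(\<lambda>n. 1) \<longlonglongrightarrow> max (lam_max (fst k)) (lam_max (snd k))"
      using tendsto_max[OF L] by simp
    then show ?thesis using False by (simp add: combine_def LIMSEQ_const_iff)
  qed (use h1 h2 in \<open>simp add: combine_def\<close>)
qed

lemma fdomI:
  "nsys jrank p \<Longrightarrow> (\<And>i. i < jrank \<Longrightarrow> 0 \<le> h i) \<Longrightarrow> (\<And>i. i < jrank \<Longrightarrow> h i \<le> exp (z i)) \<Longrightarrow> dominates (lc jrank p h) (lc jrank p z)"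
  unfolding dominates_def by blast

lemma dominates_refl: "dominates (fexp y) y"
proof -
  obtain p l where p: "jframe jrank p" "y = lc jrank p l" by (rule decomp)
  show ?thesis unfolding dominates_def
    by (rule exI[of _ p], rule exI[of _ "\<lambda>i. exp (l i)"], rule exI[of _ l])
      (use p fexp_lc[OF jframe_osys[OF p(1)]] jframe_nsys in simp)
qed

text \<open>The two components of \<open>embed hil x\<close> are diagonal in a frame of
  \<open>x\<close>, and the product of their eigenvalues is the same for every member because
  \<open>x\<close> and \<open>- x\<close> cancel. Both facts pass to the limit along a
  subsequence.\<close>

lemma K_system:
  assumes "k \<in> K hil"
  shows "\<exists>p h w c. nsys jrank p \<and> fst k = lc jrank p h \<and> snd k = lc jrank p w
    \<and> (\<forall>i<jrank. 0 \<le> h i \<and> 0 \<le> w i \<and> h i * w i = c)"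
proof -
  obtain x where x: "(\<lambda>n. embed hil (x n)) \<longlonglongrightarrow> k" using K_sequence[OF assms] by blast
  have "\<exists>p l. jframe jrank p \<and> x n = lc jrank p l" for n using decomp by metis
  then obtain p l where p: "\<And>n. jframe jrank (p n)" "\<And>n. x n = lc jrank (p n) (l n)" by metis
  define a b where "a n i = exp (l n i - shift1 hil (x n))" and "b n i = exp (- l n i - shift2 hil (x n))" for n i
  have kp: "embed hil (x n) = (lc jrank (p n) (a n), lc jrank (p n) (b n))" for n
  proof -
    note o = jframe_osys[OF p(1)[of n]]
    have sh: "lc jrank (p n) k - c *\<^sub>R u = lc jrank (p n) (\<lambda>i. k i - c)" for k c
      unfolding osys_unit[OF o, of c] by (simp add: scaleR_diff_left sum_subtractf)
    have "x n - shift1 hil (x n) *\<^sub>R u = lc jrank (p n) (\<lambda>i. l n i - shift1 hil (x n))"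
      using sh[of "l n" "shift1 hil (x n)"] unfolding p(2)[of n, symmetric] .
    moreover have "- x n - shift2 hil (x n) *\<^sub>R u = lc jrank (p n) (\<lambda>i. - l n i - shift2 hil (x n))"
      using sh[of "\<lambda>i. - l n i" "shift2 hil (x n)"] by (simp add: sum_negf flip: p(2)[of n])
    ultimately show ?thesis unfolding embed_def by (simp only: fexp_lc[OF o] a_def b_def)
  qed
  have bd: "\<bar>a n i\<bar> \<le> 1" "\<bar>b n i\<bar> \<le> 1" if i: "i < jrank" for n i
  proof -
    have B: "1 *\<^sub>R u - lc jrank (p n) (a n) \<in> C" "1 *\<^sub>R u - lc jrank (p n) (b n) \<in> C"
      using embed_B[of hil "x n"] unfolding kp by simp_all
    show "\<bar>a n i\<bar> \<le> 1" "\<bar>b n i\<bar> \<le> 1"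
      using B i unfolding nsys_unit_diff_C_iff[OF jframe_nsys[OF p(1)]] by (simp_all add: a_def b_def)
  qed
  obtain s q' h where s: "strict_mono (s :: nat \<Rightarrow> nat)"
    "\<And>i. i < jrank \<Longrightarrow> (\<lambda>n. a (s n) i) \<longlonglongrightarrow> h i"
    using nsys_compact[of jrank p a 1, OF jframe_nsys[OF p(1)] bd(1)] by blast
  obtain t q w where t: "strict_mono (t :: nat \<Rightarrow> nat)" "nsys jrank q"
    "\<And>i. i < jrank \<Longrightarrow> (\<lambda>n. p (s (t n)) i) \<longlonglongrightarrow> q i"
    "\<And>i. i < jrank \<Longrightarrow> (\<lambda>n. b (s (t n)) i) \<longlonglongrightarrow> w i"
    using nsys_compact[of jrank "\<lambda>n. p (s n)" "\<lambda>n. b (s n)" 1, OF jframe_nsys[OF p(1)] bd(2)] by blast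
  have at: "(\<lambda>n. a (s (t n)) i) \<longlonglongrightarrow> h i" if "i < jrank" for i
    using LIMSEQ_subseq_LIMSEQ[OF s(2)[OF that] t(1)] by (simp add: o_def)
  have kt: "(\<lambda>n. embed hil (x (s (t n)))) \<longlonglongrightarrow> k"
    using LIMSEQ_subseq_LIMSEQ[OF LIMSEQ_subseq_LIMSEQ[OF x s(1)] t(1)] by (simp add: o_def)
  have "(\<lambda>n. embed hil (x (s (t n)))) \<longlonglongrightarrow> (lc jrank q h, lc jrank q w)"
    unfolding kp using at t by (intro tendsto_Pair tendsto_lc) auto
  then have k: "k = (lc jrank q h, lc jrank q w)" using kt LIMSEQ_unique by blast
  have hn: "0 \<le> h i" if "i < jrank" for i using at[OF that] by (rule LIMSEQ_le_const) (simp add: a_def)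
  have wn: "0 \<le> w i" if "i < jrank" for i using t(4)[OF that] by (rule LIMSEQ_le_const) (simp add: b_def)
  have hw: "h i * w i = h 0 * w 0" if i: "i < jrank" for i
  proof -
    have ab: "a n j * b n j = exp (- shift1 hil (x n) - shift2 hil (x n))" for n j
      by (simp add: a_def b_def flip: exp_add)
    have "(\<lambda>n. a (s (t n)) i * b (s (t n)) i) \<longlonglongrightarrow> h i * w i" using at[OF i] t(4)[OF i] by (intro tendsto_mult)
    moreover have "(\<lambda>n. a (s (t n)) 0 * b (s (t n)) 0) \<longlonglongrightarrow> h 0 * w 0"
      using at[OF jrank_pos] t(4)[OF jrank_pos] by (intro tendsto_mult)
    ultimately show ?thesis unfolding ab by (rule LIMSEQ_unique)
  qed
  have "\<forall>i<jrank. 0 \<le> h i \<and> 0 \<le> w i \<and> h i * w i = h 0 * w 0" using hn wn hw by blast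
  moreover have "fst k = lc jrank q h" "snd k = lc jrank q w" by (simp_all add: k)
  ultimately show ?thesis using t(2) by blast
qed

text \<open>The approximating points form an almost geodesic: on the common system of idempotents the
  spectrum of the n-th one is \<plusminus>n up to a bounded error, or 0.\<close>

lemma K_special:
  assumes k: "k \<in> K hil"
  shows "\<exists>x. (\<lambda>n. embed hil (x n)) \<longlonglongrightarrow> k \<and>
    (\<forall>n. dominates (fst k) (x n - shift1 hil (x n) *\<^sub>R u) \<and> dominates (snd k) (- x n - shift2 hil (x n) *\<^sub>R u))"
proof -
  obtain p h w c where p: "nsys jrank p" and fk: "fst k = lc jrank p h" and sk: "snd k = lc jrank p w"
    and h: "\<And>i. i < jrank \<Longrightarrow> 0 \<le> h i" and w: "\<And>i. i < jrank \<Longrightarrow> 0 \<le> w i"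
    and hw: "\<And>i. i < jrank \<Longrightarrow> h i * w i = c"
    using K_system[OF k] by blast
  note o = nsys_osys[OF p]
  note kn = K_norm[OF k]
  have le1: "h i \<le> 1" "w i \<le> 1" if "i < jrank" for i
  proof -
    have "1 *\<^sub>R u - lc jrank p h \<in> C" "1 *\<^sub>R u - lc jrank p w \<in> C"
      using K_mem[OF k] unfolding fk sk by simp_all
    then show "h i \<le> 1" "w i \<le> 1" using that unfolding nsys_unit_diff_C_iff[OF p] by auto
  qed
  have cn: "0 \<le> c" using hw[OF jrank_pos] h[OF jrank_pos] w[OF jrank_pos] by (metis mult_nonneg_nonneg)
  show ?thesis
  \<comment> \<open>For nonzero \<open>c\<close> both components are invertible and \<open>k\<close>
    is the image of a single point, so a constant sequence suffices.\<close>
  proof (cases "c = 0")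
    case False
    then have pos: "0 < h i" "0 < w i" if "i < jrank" for i
      using hw[OF that] h[OF that] w[OF that] by (auto simp: order_less_le)
    define y z where "y = lc jrank p (\<lambda>i. ln (h i))" and "z = lc jrank p (\<lambda>i. ln (w i))"
    have Y: "fst k = fexp y" unfolding fk y_def fexp_lc[OF o] using pos by (intro sum.cong) auto
    have W: "snd k = fexp z" unfolding sk z_def fexp_lc[OF o] using pos by (intro sum.cong) auto
    have "ln (h i) + ln (w i) = ln c" if "i < jrank" for i
      using pos[OF that] hw[OF that] by (metis ln_mult_pos)
    then have "y + z = lc jrank p (\<lambda>_. ln c)"
      unfolding y_def z_def sum.distrib[symmetric] scaleR_add_left[symmetric] by (intro sum.cong) auto
    then have yz: "y + z = ln c *\<^sub>R u" using osys_unit[OF o, of "ln c"] by simp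
    \<comment> \<open>The sum \<open>y + z\<close> is \<open>ln c *\<^sub>R u\<close>; subtracting
      half of it from each makes the two opposite.\<close>
    define d where "d = ln c / 2"
    define x where "x = y - d *\<^sub>R u"
    have mx: "- x = z - d *\<^sub>R u"
    proof -
      have "- x = (y + z) - y - z + d *\<^sub>R u - y" by (simp add: x_def)
      also have "\<dots> = z - d *\<^sub>R u" 
      proof -
        have "z = (2 * d) *\<^sub>R u - y" using yz by (simp add: d_def algebra_simps)
        then show ?thesis by (simp add: algebra_simps flip: scaleR_add_left)
      qed
      finally show ?thesis .
    qed
    have L: "lam_max x = lam_max y - d" "lam_max (- x) = lam_max z - d"
      using lam_max_shift[of y "- d"] lam_max_shift[of z "- d"] unfolding mx by (simp_all add: x_def)
    have "shift1 hil x = - d" "shift2 hil x = - d"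
      using kn unfolding Y W lam_max_fexp shift1_def shift2_def L combine_def by (auto simp: max_def split: if_splits)
    then have kx: "embed hil x = k" unfolding embed_def mx using Y W by (simp add: x_def prod_eq_iff)
    have "dominates (fst k) (x - shift1 hil x *\<^sub>R u) \<and> dominates (snd k) (- x - shift2 hil x *\<^sub>R u)"
      unfolding kx[symmetric] unfolding embed_def fst_conv snd_conv using dominates_refl by blast
    then show ?thesis by (intro exI[of _ "\<lambda>_. x"]) (simp add: kx)
  next
    case True
    have z: "h i = 0 \<or> w i = 0" if "i < jrank" for i using hw[OF that] True by simp
    \<comment> \<open>The added logarithm makes the eigenvalue after the shift by \<open>n\<close>
      exactly \<open>h i\<close> or \<open>w i\<close>; the default 0 serves the members on which
      both vanish.\<close>
    define xi where "xi n i = (if 0 < h i then real n + ln (h i) else if 0 < w i then - real n - ln (w i) else 0)" for n i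
    define M where "M = (\<Sum>i<jrank. \<bar>ln (h i)\<bar> + \<bar>ln (w i)\<bar>)"
    \<comment> \<open>From \<open>N\<close> on all \<open>xi n i\<close> lie between
      \<open>- n\<close> and \<open>n\<close>, which together with the normalisation of
      \<open>k\<close> makes both shifts exactly \<open>n\<close>; the sequence starts
      there.\<close>
    obtain N :: nat where N: "M \<le> real N" using real_arch_simple by blast
    have lnM: "\<bar>ln (h i)\<bar> \<le> M" "\<bar>ln (w i)\<bar> \<le> M" if "i < jrank" for i
      using member_le_sum[of i "{..<jrank}" "\<lambda>i. \<bar>ln (h i)\<bar> + \<bar>ln (w i)\<bar>"] that unfolding M_def by fastforce+
    have lnle0: "ln t \<le> 0" if "0 \<le> t" "t \<le> 1" for t :: real
      using that by (cases "t = 0") auto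
    have ln0: "ln (h i) \<le> 0" "ln (w i) \<le> 0" if "i < jrank" for i
      using lnle0 le1[OF that] h[OF that] w[OF that] by auto
    have xb: "\<bar>xi n i\<bar> \<le> real n" if "i < jrank" "N \<le> n" for n i
    proof -
      have "M \<le> real n" using N that by simp
      then show ?thesis using lnM[OF that(1)] ln0[OF that(1)] by (auto simp: xi_def)
    qed
    define X where "X n = lc jrank p (xi n)" for n
    have mX: "- X n = lc jrank p (\<lambda>i. - xi n i)" for n by (simp add: X_def sum_negf)
    have Lle: "lam_max (X n) \<le> real n" "lam_max (- X n) \<le> real n" if "N \<le> n" for n
      using xb[OF _ that] unfolding lam_max_le_iff mX unfolding X_def nsys_unit_diff_C_iff[OF p] by fastforce+
    have Lh: "real n \<le> lam_max (X n)" if L: "lam_max (fst k) = 1" for n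
    proof -
      obtain i where i: "i < jrank" "h i = 1" using lam_max_nsys(2)[OF p, of h] L fk by auto
      then have "xi n i = real n" by (simp add: xi_def)
      then show ?thesis using lam_max_nsys(1)[OF p i(1), of "xi n"] by (simp add: X_def)
    qed
    have Lw: "real n \<le> lam_max (- X n)" if L: "lam_max (snd k) = 1" for n
    proof -
      obtain i where i: "i < jrank" "w i = 1" using lam_max_nsys(2)[OF p, of w] L sk by auto
      then have "h i = 0" using z by force
      then have "- xi n i = real n" using i by (simp add: xi_def)
      then show ?thesis using lam_max_nsys(1)[OF p i(1), of "\<lambda>i. - xi n i"] by (simp add: mX)
    qed
    have s: "shift1 hil (X n) = real n" "shift2 hil (X n) = real n" if "N \<le> n" for n
      using kn Lle[OF that] Lh[of n] Lw[of n] unfolding shift1_def shift2_def combine_def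
      by (auto simp: max_def split: if_splits)
    have ed: "X n - real n *\<^sub>R u = lc jrank p (\<lambda>i. xi n i - real n)"
      "- X n - real n *\<^sub>R u = lc jrank p (\<lambda>i. - xi n i - real n)" for n
      unfolding osys_unit[OF o, of "real n"] mX unfolding X_def by (simp_all add: scaleR_diff_left sum_subtractf)
    have kX: "embed hil (X n) = (lc jrank p (\<lambda>i. exp (xi n i - real n)), lc jrank p (\<lambda>i. exp (- xi n i - real n)))" if "N \<le> n" for n
      unfolding embed_def s[OF that] ed fexp_lc[OF o] ..
    have dh: "h i \<le> exp (xi n i - real n)" "w i \<le> exp (- xi n i - real n)" if "i < jrank" for n i
      using h[OF that] w[OF that] z[OF that] by (auto simp: xi_def)
    have e1: "(\<lambda>n. exp (- real n)) \<longlonglongrightarrow> 0"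
      by (rule filterlim_compose[OF exp_at_bot filterlim_compose[OF filterlim_uminus_at_bot_at_top filterlim_real_sequentially]])
    have e2: "(\<lambda>n. exp (- real n) * exp (- real n) * c') \<longlonglongrightarrow> 0" for c'
      using tendsto_mult[OF tendsto_mult[OF e1 e1] tendsto_const[of c']] by simp
    have lim: "(\<lambda>n. exp (xi n i - real n)) \<longlonglongrightarrow> h i" "(\<lambda>n. exp (- xi n i - real n)) \<longlonglongrightarrow> w i"
      if i: "i < jrank" for i
    proof -
      have ee: "exp (- real n - a - real n) = exp (- real n) * exp (- real n) * exp (- a)" for n a
        by (simp flip: exp_add)
      consider "0 < h i" "w i = 0" | "h i = 0" "0 < w i" | "h i = 0" "w i = 0"
        using h[OF i] w[OF i] z[OF i] by fastforce
      then have "(\<lambda>n. exp (xi n i - real n)) \<longlonglongrightarrow> h i \<and> (\<lambda>n. exp (- xi n i - real n)) \<longlonglongrightarrow> w i"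
      proof cases
        case 1
        then have "exp (xi n i - real n) = h i" "exp (- xi n i - real n) = exp (- real n) * exp (- real n) * exp (- ln (h i))" for n
          using ee[of n "ln (h i)"] by (simp_all add: xi_def algebra_simps)
        then show ?thesis using e2 1 by simp
      next
        case 2
        then have "exp (- xi n i - real n) = w i" "exp (xi n i - real n) = exp (- real n) * exp (- real n) * exp (- ln (w i))" for n
          using ee[of n "ln (w i)"] by (simp_all add: xi_def algebra_simps)
        then show ?thesis using e2 2 by simp
      next
        case 3
        then show ?thesis using e1 by (simp add: xi_def)
      qed
      then show "(\<lambda>n. exp (xi n i - real n)) \<longlonglongrightarrow> h i" "(\<lambda>n. exp (- xi n i - real n)) \<longlonglongrightarrow> w i" by auto
    qed
    have kk: "k = (lc jrank p h, lc jrank p w)" using fk sk by (simp add: prod_eq_iff)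
    have "(\<lambda>n. (lc jrank p (\<lambda>i. exp (xi n i - real n)), lc jrank p (\<lambda>i. exp (- xi n i - real n)))) \<longlonglongrightarrow> (lc jrank p h, lc jrank p w)"
      using lim by (intro tendsto_Pair tendsto_sum tendsto_scaleR tendsto_const) auto
    then have "(\<lambda>n. (lc jrank p (\<lambda>i. exp (xi (n + N) i - real (n + N))), lc jrank p (\<lambda>i. exp (- xi (n + N) i - real (n + N))))) \<longlonglongrightarrow> k"
      unfolding kk by (rule LIMSEQ_ignore_initial_segment[where k = N])
    then have kl: "(\<lambda>n. embed hil (X (n + N))) \<longlonglongrightarrow> k" using kX by simp
    have fd: "dominates (fst k) (X n - real n *\<^sub>R u)" "dominates (snd k) (- X n - real n *\<^sub>R u)" for n
      unfolding ed fk sk using h w dh by (intro fdomI[OF p]; simp)+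
    have "dominates (fst k) (X (n + N) - shift1 hil (X (n + N)) *\<^sub>R u)"
      "dominates (snd k) (- X (n + N) - shift2 hil (X (n + N)) *\<^sub>R u)" for n
      unfolding s[OF le_add2] by (rule fd)+
    with kl show ?thesis by (intro exI[of _ "\<lambda>n. X (n + N)"]) blast
  qed
qed

end

section \<open>Horofunctions of a gauge\<close>

context gauge
begin

definition Theta :: "bool \<Rightarrow> 'a \<times> 'a \<Rightarrow> 'a \<Rightarrow> real" where
  "Theta hil k z = ln (combine hil (g (fst k) z) (g (snd k) (- z)))"

definition gdist :: "bool \<Rightarrow> 'a \<Rightarrow> 'a \<Rightarrow> real" where
  "gdist hil x z = ln (combine hil (g (fexp x) z) (g (fexp z) x))"

lemma K_C: "k \<in> K hil \<Longrightarrow> fst k \<in> C" "k \<in> K hil \<Longrightarrow> snd k \<in> C"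
  using K_mem by auto

lemma combine_pos:
  assumes "k \<in> K hil" shows "0 < combine hil (g (fst k) z) (g (snd k) y)"
proof -
  note kn = K_norm[OF assms] and kc = K_C[OF assms]
  show ?thesis
  proof (cases hil)
    case True
    then have "fst k \<noteq> 0" "snd k \<noteq> 0" using kn by auto
    then show ?thesis using g_pos kc True by (simp add: combine_def)
  next
    case False
    then have "fst k \<noteq> 0 \<or> snd k \<noteq> 0" using kn by (auto simp: combine_def)
    then show ?thesis using g_pos kc False by (auto simp: combine_def less_max_iff_disj)
  qed
qed

lemma Theta_continuous: "continuous_on (K hil) (\<lambda>k. Theta hil k z)"
proof -
  have "continuous_on (K hil) (\<lambda>k. g (fst k) z)" for z
    by (rule continuous_on_compose2[OF g_cont continuous_on_fst[OF continuous_on_id]]) (use K_mem in auto)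
  moreover have "continuous_on (K hil) (\<lambda>k. g (snd k) z)" for z
    by (rule continuous_on_compose2[OF g_cont continuous_on_snd[OF continuous_on_id]]) (use K_mem in auto)
  ultimately have "continuous_on (K hil) (\<lambda>k. combine hil (g (fst k) z) (g (snd k) (- z)))"
    unfolding combine_def by (cases hil) (auto intro!: continuous_intros)
  then show ?thesis unfolding Theta_def
    by (intro continuous_on_ln ballI) (metis combine_pos less_irrefl)+
qed

lemma g_embed:
  "g (fexp x) z = exp (shift1 hil x) * g (fst (embed hil x)) z"
  "g (fexp (- x)) z = exp (shift2 hil x) * g (snd (embed hil x)) z"
proof -
  have "exp c *\<^sub>R fexp (y - c *\<^sub>R u) = fexp y" for c y by (simp add: fexp_shift_diff flip: exp_add)
  then show "g (fexp x) z = exp (shift1 hil x) * g (fst (embed hil x)) z"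
    "g (fexp (- x)) z = exp (shift2 hil x) * g (snd (embed hil x)) z"
    unfolding embed_def fst_conv snd_conv using g_scale[OF fexp_C, of "exp _"] by (metis exp_gt_zero)+
qed

lemma combine_exp:
  "combine hil (exp (shift1 hil x) * a) (exp (shift2 hil x) * b) = exp (radius hil x) * combine hil a b"
  by (simp add: combine_def shift1_def shift2_def radius_def exp_add max_mult_distrib_left)

lemma combine_commute: "combine hil a b = combine hil b a"
  by (simp add: combine_def mult.commute max.commute)

text \<open>\<open>g_sym\<close> puts \<open>y\<close> into the first argument of both gauges, where
  it enters only through \<open>embed hil y\<close> up to factors that combine to
  \<open>exp (radius hil y)\<close>. Subtracting the radius leaves the horofunction of
  \<open>y\<close>.\<close>

lemma gdist_Theta: "gdist hil z y = radius hil y + Theta hil (embed hil y) z"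
proof -
  have "combine hil (g (fexp z) y) (g (fexp y) z) = combine hil (g (fexp y) z) (g (fexp (- y)) (- z))"
    using g_sym[of z y] by (simp add: combine_commute)
  also have "\<dots> = exp (radius hil y) * combine hil (g (fst (embed hil y)) z) (g (snd (embed hil y)) (- z))"
    unfolding g_embed(1)[of y z hil] g_embed(2)[of y "- z" hil] combine_exp ..
  finally show ?thesis using combine_pos[OF embed_K, of hil y z "- z"]
    unfolding gdist_def Theta_def by (simp add: ln_mult_pos)
qed

lemma gdist_0: "gdist hil 0 y = radius hil y"
  using K_norm(1)[OF embed_K, of hil y] by (simp add: gdist_Theta Theta_def g_zero K_C[OF embed_K])

lemma gdist_plus_Theta:
  assumes "k \<in> K hil"
  shows "gdist hil 0 x + Theta hil k x
    = ln (combine hil (g (fst k) (x - shift1 hil x *\<^sub>R u)) (g (snd k) (- x - shift2 hil x *\<^sub>R u)))"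
proof -
  have "g (fst k) (x - shift1 hil x *\<^sub>R u) = exp (shift1 hil x) * g (fst k) x"
    using g_shift[OF K_C(1)[OF assms], of x "- shift1 hil x"] by simp
  moreover have "g (snd k) (- x - shift2 hil x *\<^sub>R u) = exp (shift2 hil x) * g (snd k) (- x)"
    using g_shift[OF K_C(2)[OF assms], of "- x" "- shift2 hil x"] by simp
  ultimately show ?thesis using combine_pos[OF assms, of x "- x"]
    unfolding gdist_0 Theta_def by (simp add: combine_exp ln_mult_pos)
qed

text \<open>In part (b) each factor is at least 1, by \<open>g_ge\<close> and the normalisation in
  \<open>K\<close>, so a bound on the product bounds both.\<close>

lemma combine_le_imp:
  assumes k: "k \<in> K hil"
    and le: "combine hil (g (fst k) (x - shift1 hil x *\<^sub>R u)) (g (snd k) (- x - shift2 hil x *\<^sub>R u)) \<le> c"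
  shows "g (fst k) (x - shift1 hil x *\<^sub>R u) \<le> c" "g (snd k) (- x - shift2 hil x *\<^sub>R u) \<le> c"
proof -
  define a b where "a = g (fst k) (x - shift1 hil x *\<^sub>R u)" and "b = g (snd k) (- x - shift2 hil x *\<^sub>R u)"
  have L: "lam_max (fst k) \<le> a" "lam_max (snd k) \<le> b"
    unfolding a_def b_def by (rule g_ge[OF K_C(1)[OF k] embed_le(1)], rule g_ge[OF K_C(2)[OF k] embed_le(2)])
  have "a \<le> c \<and> b \<le> c"
  proof (cases hil)
    case True
    then have ab: "1 \<le> a" "1 \<le> b" using L K_norm[OF k] by simp_all
    then have "a * 1 \<le> a * b" "1 * b \<le> a * b" by (intro mult_left_mono mult_right_mono; simp)+
    then show ?thesis using le True unfolding combine_def a_def[symmetric] b_def[symmetric] by simp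
  qed (use le in \<open>simp add: combine_def a_def b_def\<close>)
  then show "g (fst k) (x - shift1 hil x *\<^sub>R u) \<le> c" "g (snd k) (- x - shift2 hil x *\<^sub>R u) \<le> c"
    by (simp_all add: a_def b_def)
qed

lemma rel_of_bounded:
  assumes k: "k \<in> K hil" and k': "k' \<in> K hil" and x: "(\<lambda>n. embed hil (x n)) \<longlonglongrightarrow> k'"
    and le: "\<And>n. gdist hil 0 (x n) + Theta hil k (x n) \<le> c"
  shows "rel (exp c) (fst k) (fst k')" "rel (exp c) (snd k) (snd k')"
proof -
  have "combine hil (g (fst k) (x n - shift1 hil (x n) *\<^sub>R u)) (g (snd k) (- x n - shift2 hil (x n) *\<^sub>R u)) \<le> exp c" for n
    using le[of n] combine_pos[OF k] unfolding gdist_plus_Theta[OF k] by (metis exp_le_cancel_iff exp_ln)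
  note b = combine_le_imp[OF k this]
  have l: "(\<lambda>n. fexp (x n - shift1 hil (x n) *\<^sub>R u)) \<longlonglongrightarrow> fst k'" "(\<lambda>n. fexp (- x n - shift2 hil (x n) *\<^sub>R u)) \<longlonglongrightarrow> snd k'"
    using tendsto_fst[OF x] tendsto_snd[OF x] by (simp_all add: embed_def)
  show "rel (exp c) (fst k) (fst k')"
    by (rule g_close[OF K_mem(1)[OF k] exp_gt_zero l(1) K_mem(1)[OF k'] b(1)])
  show "rel (exp c) (snd k) (snd k')"
    by (rule g_close[OF K_mem(2)[OF k] exp_gt_zero l(2) K_mem(2)[OF k'] b(2)])
qed

text \<open>\<open>X\<close> stands for the part of the algebra that carries the metric, such as the
  trace-zero subspace. Points with equal image have equal shifted logarithms because
  \<open>flog\<close> inverts \<open>fexp\<close>, so domination carries over.\<close>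

lemma K_special_on:
  assumes k: "k \<in> K hil" and X: "embed hil ` X = range (embed hil)"
  shows "\<exists>x. (\<forall>n. x n \<in> X) \<and> (\<lambda>n. embed hil (x n)) \<longlonglongrightarrow> k \<and>
    (\<forall>n. dominates (fst k) (x n - shift1 hil (x n) *\<^sub>R u) \<and> dominates (snd k) (- x n - shift2 hil (x n) *\<^sub>R u))"
proof -
  obtain y where y: "(\<lambda>n. embed hil (y n)) \<longlonglongrightarrow> k"
    "\<And>n. dominates (fst k) (y n - shift1 hil (y n) *\<^sub>R u)" "\<And>n. dominates (snd k) (- y n - shift2 hil (y n) *\<^sub>R u)"
    using K_special[OF k] by blast
  have "\<exists>x\<in>X. embed hil x = embed hil (y n)" for n
  proof -
    have "embed hil (y n) \<in> embed hil ` X" unfolding X by simp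
    then show ?thesis by (metis imageE)
  qed
  then obtain x where x: "\<And>n. x n \<in> X" "\<And>n. embed hil (x n) = embed hil (y n)" by metis
  have "x n - shift1 hil (x n) *\<^sub>R u = y n - shift1 hil (y n) *\<^sub>R u" "- x n - shift2 hil (x n) *\<^sub>R u = - y n - shift2 hil (y n) *\<^sub>R u" for n
    using x(2)[of n] unfolding embed_def prod.inject by (metis flog_fexp)+
  then show ?thesis using x y by (intro exI[of _ x]) simp
qed

lemma special_bound:
  assumes k: "k \<in> K hil" and k': "k' \<in> K hil" and b: "0 < b1" "0 < b2"
    and r: "rel b1 (fst k) (fst k')" "rel b2 (snd k) (snd k')"
    and f: "dominates (fst k') (x - shift1 hil x *\<^sub>R u)" "dominates (snd k') (- x - shift2 hil x *\<^sub>R u)"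
  shows "gdist hil 0 x + Theta hil k x \<le> ln (combine hil b1 b2)"
proof -
  have a: "g (fst k) (x - shift1 hil x *\<^sub>R u) \<le> b1" "g (snd k) (- x - shift2 hil x *\<^sub>R u) \<le> b2"
    by (rule g_dom[OF K_mem(1)[OF k] f(1) b(1) r(1)], rule g_dom[OF K_mem(2)[OF k] f(2) b(2) r(2)])
  have "combine hil (g (fst k) (x - shift1 hil x *\<^sub>R u)) (g (snd k) (- x - shift2 hil x *\<^sub>R u)) \<le> combine hil b1 b2"
    unfolding combine_def using a b g_nonneg K_C[OF k] by (auto intro: mult_mono)
  then show ?thesis unfolding gdist_plus_Theta[OF k] using combine_pos[OF k] by (intro ln_mono) auto
qed

text \<open>Along the special sequence of \<open>k'\<close>, distance plus
  \<open>Theta hil k'\<close> is at most \<open>ln 1 = 0\<close>. Equality of the two functions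
  transfers this bound to \<open>k\<close> and gives \<open>rel 1\<close>; the reverse relation
  follows by symmetry.\<close>

lemma Theta_inj:
  assumes k: "k \<in> K hil" and k': "k' \<in> K hil" and X: "embed hil ` X = range (embed hil)"
    and eq: "\<And>x. x \<in> X \<Longrightarrow> Theta hil k x = Theta hil k' x"
  shows "k = k'"
proof -
  have r: "rel 1 (fst k) (fst k') \<and> rel 1 (snd k) (snd k')"
    if k: "k \<in> K hil" and k': "k' \<in> K hil" and eq: "\<And>x. x \<in> X \<Longrightarrow> Theta hil k x = Theta hil k' x" for k k'
  proof -
    obtain x where x: "\<And>n. x n \<in> X" "(\<lambda>n. embed hil (x n)) \<longlonglongrightarrow> k'"
      "\<And>n. dominates (fst k') (x n - shift1 hil (x n) *\<^sub>R u)" "\<And>n. dominates (snd k') (- x n - shift2 hil (x n) *\<^sub>R u)"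
      using K_special_on[OF k' X] by blast
    have "gdist hil 0 (x n) + Theta hil k (x n) \<le> 0" for n
      using special_bound[OF k' k' zero_less_one zero_less_one rel_refl rel_refl x(3,4), of n] eq[OF x(1)[of n]]
      by (simp add: combine_def split: if_splits)
    then show ?thesis using rel_of_bounded[OF k k' x(2), of 0] by simp
  qed
  have "fst k = fst k'" "snd k = snd k'"
    using rel_antisym K_mem[OF k] K_mem[OF k'] r[OF k k' eq] r[OF k' k eq[symmetric]] by blast+
  then show ?thesis by (simp add: prod_eq_iff)
qed

lemma bounded_iff_order:
  assumes k: "k \<in> K hil" and k': "k' \<in> K hil" and X: "embed hil ` X = range (embed hil)"
  shows "(\<exists>c x. (\<forall>n. x n \<in> X) \<and> (\<lambda>n. embed hil (x n)) \<longlonglongrightarrow> k' \<and> (\<forall>n. gdist hil 0 (x n) + Theta hil k (x n) \<le> c))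
    \<longleftrightarrow> (\<exists>b>0. b *\<^sub>R fst k' - fst k \<in> C) \<and> (\<exists>b>0. b *\<^sub>R snd k' - snd k \<in> C)"
proof
  assume "\<exists>c x. (\<forall>n. x n \<in> X) \<and> (\<lambda>n. embed hil (x n)) \<longlonglongrightarrow> k' \<and> (\<forall>n. gdist hil 0 (x n) + Theta hil k (x n) \<le> c)"
  then obtain c x where "(\<lambda>n. embed hil (x n)) \<longlonglongrightarrow> k'" "\<And>n. gdist hil 0 (x n) + Theta hil k (x n) \<le> c" by blast
  from rel_of_bounded[OF k k' this] show "(\<exists>b>0. b *\<^sub>R fst k' - fst k \<in> C) \<and> (\<exists>b>0. b *\<^sub>R snd k' - snd k \<in> C)"
    using rel_supp[OF K_mem(1)[OF k] K_mem(1)[OF k']] rel_supp[OF K_mem(2)[OF k] K_mem(2)[OF k']] exp_gt_zero by metis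
next
  assume "(\<exists>b>0. b *\<^sub>R fst k' - fst k \<in> C) \<and> (\<exists>b>0. b *\<^sub>R snd k' - snd k \<in> C)"
  then obtain b1 b2 where b: "0 < b1" "rel b1 (fst k) (fst k')" "0 < b2" "rel b2 (snd k) (snd k')"
    using rel_supp[OF K_mem(1)[OF k] K_mem(1)[OF k']] rel_supp[OF K_mem(2)[OF k] K_mem(2)[OF k']] by metis
  obtain x where x: "\<And>n. x n \<in> X" "(\<lambda>n. embed hil (x n)) \<longlonglongrightarrow> k'"
    "\<And>n. dominates (fst k') (x n - shift1 hil (x n) *\<^sub>R u)" "\<And>n. dominates (snd k') (- x n - shift2 hil (x n) *\<^sub>R u)"
    using K_special_on[OF k' X] by blast
  have "gdist hil 0 (x n) + Theta hil k (x n) \<le> ln (combine hil b1 b2)" for n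
    by (rule special_bound[OF k k' b(1,3,2,4) x(3,4)])
  then show "\<exists>c x. (\<forall>n. x n \<in> X) \<and> (\<lambda>n. embed hil (x n)) \<longlonglongrightarrow> k' \<and> (\<forall>n. gdist hil 0 (x n) + Theta hil k (x n) \<le> c)"
    using x by blast
qed

end


subsection \<open>Parametrised horofunction compactifications\<close>

lemma compact_fun_imp_closed:
  fixes A :: "('b \<Rightarrow> real) set"
  assumes "compact A" shows "closed A"
proof -
  have "Hausdorff_space (product_topology (\<lambda>_::'b. euclidean :: real topology) UNIV)"
    by (simp add: Hausdorff_space_product_topology)
  then have "Hausdorff_space (euclidean :: ('b \<Rightarrow> real) topology)"
    by (simp add: euclidean_product_topology)
  moreover have "compactin euclidean A" using assms by simp
  ultimately have "closedin euclidean A" by (rule compactin_imp_closedin)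
  then show ?thesis unfolding closed_closedin .
qed

text \<open>\<open>I\<close> consists of the parameters of the points of \<open>S\<close>. A metric
  parameter space allows arguments with sequences, although pointwise convergence of functions on
  \<open>S\<close> need not be metrisable.\<close>

locale horo_param =
  fixes d :: "'b \<Rightarrow> 'b \<Rightarrow> real" and S :: "'b set" and b :: 'b
    and Kc I :: "'k::metric_space set" and kp :: "'b \<Rightarrow> 'k" and Th :: "'k \<Rightarrow> 'b \<Rightarrow> real"
  assumes Kc_compact: "compact Kc" and Kc_closure: "Kc = closure I" and kp_image: "kp ` S = I"
    and Th_cont: "s \<in> S \<Longrightarrow> continuous_on Kc (\<lambda>k. Th k s)"
    and Th_outside: "s \<notin> S \<Longrightarrow> Th k s = 0"
    and Th_inj: "k \<in> Kc \<Longrightarrow> k' \<in> Kc \<Longrightarrow> (\<And>s. s \<in> S \<Longrightarrow> Th k s = Th k' s) \<Longrightarrow> k = k'"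
    and Th_horo: "s \<in> S \<Longrightarrow> horo_fn d S b s = Th (kp s)"
begin

lemma Th_continuous: "continuous_on Kc Th"
proof (rule continuous_on_coordinatewise_then_product)
  fix s
  show "continuous_on Kc (\<lambda>k. Th k s)"
    by (cases "s \<in> S") (simp_all add: Th_cont Th_outside)
qed

lemma Th_inj_on: "inj_on Th Kc"
  by (rule inj_onI) (metis Th_inj)

lemma horo_fn_image: "horo_fn d S b ` S = Th ` I"
  unfolding kp_image[symmetric] image_image using Th_horo by (rule image_cong[OF refl])

lemma I_subset: "I \<subseteq> Kc"
  unfolding Kc_closure by (rule closure_subset)

lemma horo_compact_eq: "horo_compact d S b = Th ` Kc"
proof
  have "closed (Th ` Kc)"
    by (rule compact_fun_imp_closed[OF compact_continuous_image[OF Th_continuous Kc_compact]])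
  then show "horo_compact d S b \<subseteq> Th ` Kc"
    unfolding horo_compact_def horo_fn_image using I_subset by (intro closure_minimal image_mono)
  have "Th ` closure I \<subseteq> closure (Th ` I)"
    by (rule image_closure_subset) (use Th_continuous Kc_closure in simp, simp, rule closure_subset)
  then show "Th ` Kc \<subseteq> horo_compact d S b"
    unfolding horo_compact_def horo_fn_image Kc_closure .
qed

text \<open>A continuous injection of a compact space whose compact images are closed has a
  continuous inverse.\<close>

lemma Th_homeomorphism: "\<exists>G. homeomorphism Kc (horo_compact d S b) Th G"
proof -
  define G where "G = inv_into Kc Th"
  have G: "G (Th k) = k" if "k \<in> Kc" for k
    unfolding G_def using Th_inj_on that by (rule inv_into_f_f)
  have "continuous_on (Th ` Kc) G"
    unfolding continuous_on_closed_invariant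
  proof (intro allI impI)
    fix B :: "'k set" assume "closed B"
    then have "compact (Kc \<inter> B)" using Kc_compact by (simp add: compact_Int_closed)
    then have "compact (Th ` (Kc \<inter> B))"
      using continuous_on_subset[OF Th_continuous] by (intro compact_continuous_image) auto
    then have "closed (Th ` (Kc \<inter> B))" by (rule compact_fun_imp_closed)
    moreover have "Th ` (Kc \<inter> B) \<inter> Th ` Kc = G -` B \<inter> Th ` Kc" using G by force
    ultimately show "\<exists>A. closed A \<and> A \<inter> Th ` Kc = G -` B \<inter> Th ` Kc" by blast
  qed
  then have "homeomorphism Kc (Th ` Kc) Th G"
    using Th_continuous G by (intro homeomorphismI) auto
  then show ?thesis unfolding horo_compact_eq by blast
qed

lemma horo_boundary_eq: "horo_boundary d S b = Th ` (Kc - I)"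
  unfolding horo_boundary_def horo_compact_eq horo_fn_image
  using inj_on_image_set_diff[OF Th_inj_on, of Kc I] I_subset by simp

text \<open>Neighbourhoods of \<open>Th k\<close> correspond to neighbourhoods of \<open>k\<close>
  in \<open>Kc\<close>. A finite cost yields, in each ball of radius \<open>1 / (n + 1)\<close>
  around \<open>k\<close>, a point with value at most one fixed \<open>c\<close>; conversely, a
  bounded sequence tending to \<open>k\<close> enters every neighbourhood.\<close>

lemma detour_cost_finite_iff:
  assumes k: "k \<in> Kc"
  shows "detour_cost d S b (Th k) h < \<infinity> \<longleftrightarrow>
    (\<exists>c x. (\<forall>n. x n \<in> S) \<and> (\<lambda>n. kp (x n)) \<longlonglongrightarrow> k \<and> (\<forall>n. d b (x n) + h (x n) \<le> c))"
proof
  let ?hc = "horo_compact d S b"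
  let ?N = "{W. W \<subseteq> ?hc \<and> (\<exists>U. open U \<and> Th k \<in> U \<and> U \<inter> ?hc \<subseteq> W)}"
  let ?i = "\<lambda>W. INF x \<in> {x \<in> S. horo_fn d S b x \<in> W}. ereal (d b x + h x)"
  have kpK: "kp s \<in> Kc" if "s \<in> S" for s using that kp_image I_subset by blast
  {
    assume fin: "detour_cost d S b (Th k) h < \<infinity>"
    obtain c where c: "detour_cost d S b (Th k) h < ereal c"
      using ereal_dense2[OF fin] by blast
    obtain G where G: "homeomorphism Kc ?hc Th G" using Th_homeomorphism by blast
    have GTh: "G (Th j) = j" if "j \<in> Kc" for j using G that by (simp add: homeomorphism_def)
    have Gc: "continuous_on ?hc G" using G by (simp add: homeomorphism_def)
    have "\<exists>x\<in>S. dist (kp x) k < 1 / real (Suc n) \<and> d b x + h x \<le> c" for n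
    proof -
      define W where "W = ?hc \<inter> G -` ball k (1 / real (Suc n))"
      have "openin (top_of_set ?hc) W" unfolding W_def
        by (rule continuous_openin_preimage_gen[OF Gc open_ball])
      then obtain T where T: "open T" "W = ?hc \<inter> T" unfolding openin_open by blast
      have "Th k \<in> W" unfolding W_def using GTh[OF k] horo_compact_eq k by auto
      then have "W \<in> ?N" using T by blast
      then have "?i W \<le> detour_cost d S b (Th k) h"
        unfolding detour_cost_def by (rule SUP_upper)
      then have "?i W < ereal c" using c by (rule le_less_trans)
      then obtain x where x: "x \<in> S" "horo_fn d S b x \<in> W" "ereal (d b x + h x) < ereal c"
        unfolding INF_less_iff by blast
      have "G (Th (kp x)) \<in> ball k (1 / real (Suc n))" using x(2) Th_horo[OF x(1)] by (simp add: W_def)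
      then have "dist (kp x) k < 1 / real (Suc n)" using GTh[OF kpK[OF x(1)]] by (simp add: dist_commute)
      then show ?thesis using x by auto
    qed
    then obtain x where x: "\<And>n. x n \<in> S" "\<And>n. dist (kp (x n)) k < 1 / real (Suc n)"
      "\<And>n. d b (x n) + h (x n) \<le> c" by metis
    have "(\<lambda>n. dist (kp (x n)) k) \<longlonglongrightarrow> 0"
    proof (rule tendsto_sandwich[OF _ _ tendsto_const LIMSEQ_inverse_real_of_nat])
      show "\<forall>\<^sub>F n in sequentially. dist (kp (x n)) k \<le> inverse (real (Suc n))"
        using x(2) by (simp add: less_imp_le inverse_eq_divide)
    qed simp
    then have "(\<lambda>n. kp (x n)) \<longlonglongrightarrow> k" by (rule tendsto_dist_iff[THEN iffD2])
    then show "\<exists>c x. (\<forall>n. x n \<in> S) \<and> (\<lambda>n. kp (x n)) \<longlonglongrightarrow> k \<and> (\<forall>n. d b (x n) + h (x n) \<le> c)"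
      using x(1,3) by blast
  next
    assume "\<exists>c x. (\<forall>n. x n \<in> S) \<and> (\<lambda>n. kp (x n)) \<longlonglongrightarrow> k \<and> (\<forall>n. d b (x n) + h (x n) \<le> c)"
    then obtain c x where x: "\<And>n. x n \<in> S" "(\<lambda>n. kp (x n)) \<longlonglongrightarrow> k" "\<And>n. d b (x n) + h (x n) \<le> c" by blast
    have "?i W \<le> ereal c" if W: "W \<in> ?N" for W
    proof -
      obtain U where U: "open U" "Th k \<in> U" "U \<inter> ?hc \<subseteq> W" using W by blast
      have "openin (top_of_set Kc) (Kc \<inter> Th -` U)"
        by (rule continuous_openin_preimage_gen[OF Th_continuous U(1)])
      then obtain T where T: "open T" "Kc \<inter> Th -` U = Kc \<inter> T" unfolding openin_open by blast
      have "k \<in> T" using T U k by blast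
      then have "\<forall>\<^sub>F n in sequentially. kp (x n) \<in> T" using x(2) T(1) by (simp add: tendsto_def)
      then obtain n where "kp (x n) \<in> T" using eventually_happens'[OF sequentially_bot] by blast
      then have "Th (kp (x n)) \<in> U" using T(2) kpK[OF x(1)] by blast
      moreover have "Th (kp (x n)) \<in> ?hc" using horo_compact_eq kpK[OF x(1)] by blast
      ultimately have "horo_fn d S b (x n) \<in> W" using U(3) Th_horo[OF x(1)] by auto
      then show ?thesis using x(1) x(3)[of n] by (intro INF_lower2[of "x n"]) auto
    qed
    then have "detour_cost d S b (Th k) h \<le> ereal c" unfolding detour_cost_def by (rule SUP_least)
    then show "detour_cost d S b (Th k) h < \<infinity>" by (rule le_less_trans) simp
  }
qed

end

text \<open>Both compactifications are images of the same \<open>Kc\<close> with the same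
  \<open>I\<close>, so the second parametrisation after the inverse of the first matches points and
  boundaries. Parts depend only on finiteness of detour costs, hence the assumption
  \<open>det\<close>.\<close>

lemma horo_param_transfer:
  fixes Kc I :: "'k::metric_space set"
  assumes 1: "horo_param d1 S1 b1 Kc I kp1 Th1" and 2: "horo_param d2 S2 b2 Kc I kp2 Th2"
    and det: "\<And>k k'. k \<in> Kc \<Longrightarrow> k' \<in> Kc \<Longrightarrow>
      detour_cost d1 S1 b1 (Th1 k) (Th1 k') < \<infinity> \<longleftrightarrow> detour_cost d2 S2 b2 (Th2 k) (Th2 k') < \<infinity>"
  shows "\<exists>F G. homeomorphism (horo_compact d1 S1 b1) (horo_compact d2 S2 b2) F G
    \<and> (\<forall>k\<in>Kc. F (Th1 k) = Th2 k)
    \<and> (\<forall>P\<in>horo_parts d1 S1 b1. F ` P \<in> horo_parts d2 S2 b2)"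
proof -
  interpret A: horo_param d1 S1 b1 Kc I kp1 Th1 by (rule 1)
  interpret B: horo_param d2 S2 b2 Kc I kp2 Th2 by (rule 2)
  obtain G1 where G1: "homeomorphism Kc (horo_compact d1 S1 b1) Th1 G1" using A.Th_homeomorphism by blast
  obtain G2 where G2: "homeomorphism Kc (horo_compact d2 S2 b2) Th2 G2" using B.Th_homeomorphism by blast
  define F where "F = Th2 \<circ> G1"
  have hom: "homeomorphism (horo_compact d1 S1 b1) (horo_compact d2 S2 b2) F (Th1 \<circ> G2)"
    unfolding F_def using G1 by (intro homeomorphism_compose[OF _ G2]) (simp add: homeomorphism_symD)
  have FTh: "F (Th1 k) = Th2 k" if "k \<in> Kc" for k
    using G1 that by (simp add: F_def homeomorphism_def)
  have dd: "detour_dist d1 S1 b1 (Th1 k) (Th1 k') < \<infinity> \<longleftrightarrow> detour_dist d2 S2 b2 (Th2 k) (Th2 k') < \<infinity>"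
    if "k \<in> Kc" "k' \<in> Kc" for k k'
    using det[OF that] det[OF that(2,1)] unfolding detour_dist_def
    by (simp add: less_top[symmetric] top_ereal_def ereal_plus_eq_PInfty)
  have "F ` P \<in> horo_parts d2 S2 b2" if P: "P \<in> horo_parts d1 S1 b1" for P
  proof -
    obtain k where k: "k \<in> Kc - I"
      and P: "P = {h' \<in> Th1 ` (Kc - I). detour_dist d1 S1 b1 (Th1 k) h' < \<infinity>}"
      using P unfolding horo_parts_def A.horo_boundary_eq by blast
    have "F ` P = {h' \<in> Th2 ` (Kc - I). detour_dist d2 S2 b2 (Th2 k) h' < \<infinity>}"
    proof (intro set_eqI iffI)
      fix h assume "h \<in> F ` P"
      then obtain k' where k': "k' \<in> Kc - I" "h = F (Th1 k')" "detour_dist d1 S1 b1 (Th1 k) (Th1 k') < \<infinity>"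
        unfolding P by blast
      then have "h = Th2 k'" "detour_dist d2 S2 b2 (Th2 k) (Th2 k') < \<infinity>" using FTh dd k by auto
      then show "h \<in> {h' \<in> Th2 ` (Kc - I). detour_dist d2 S2 b2 (Th2 k) h' < \<infinity>}" using k' by blast
    next
      fix h assume "h \<in> {h' \<in> Th2 ` (Kc - I). detour_dist d2 S2 b2 (Th2 k) h' < \<infinity>}"
      then obtain k' where k': "k' \<in> Kc - I" "h = Th2 k'" "detour_dist d2 S2 b2 (Th2 k) (Th2 k') < \<infinity>" by blast
      then have "h = F (Th1 k')" "Th1 k' \<in> P" using FTh dd k unfolding P by auto
      then show "h \<in> F ` P" by blast
    qed
    then show ?thesis unfolding horo_parts_def B.horo_boundary_eq using k by blast
  qed
  then show ?thesis using hom FTh by blast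
qed

section \<open>Comparison of two gauges\<close>

context gauge
begin

text \<open>\<open>f\<close> is the logarithm for the cone metrics and the identity for the norms;
  the value 0 off \<open>S\<close> matches the convention of \<open>horo_fn\<close>.\<close>

definition Th_on :: "bool \<Rightarrow> 'b set \<Rightarrow> ('b \<Rightarrow> 'a) \<Rightarrow> 'a \<times> 'a \<Rightarrow> 'b \<Rightarrow> real" where
  "Th_on hil S f k s = (if s \<in> S then Theta hil k (f s) else 0)"

lemma horo_param_gauge:
  assumes b: "b \<in> S" "f b = 0" and X: "embed hil ` f ` S = range (embed hil)"
    and d: "\<And>s t. s \<in> S \<Longrightarrow> t \<in> S \<Longrightarrow> d s t = gdist hil (f s) (f t)"
  shows "horo_param d S b (K hil) (range (embed hil)) (\<lambda>s. embed hil (f s)) (Th_on hil S f)"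
proof (unfold_locales, goal_cases)
  case 1
  show ?case by (rule K_compact)
next
  case 2
  show ?case by (simp add: K_def)
next
  case 3
  show ?case using X by (simp add: image_image)
next
  case (4 s)
  then show ?case using Theta_continuous by (simp add: Th_on_def)
next
  case (5 s k)
  then show ?case by (simp add: Th_on_def)
next
  case (6 k k')
  then show ?case by (intro Theta_inj[OF 6(1,2) X]) (auto simp: Th_on_def)
next
  case (7 s)
  show ?case
  proof
    fix z
    show "horo_fn d S b s z = Th_on hil S f (embed hil (f s)) z"
      using 7 b d[of z s] d[of b s] by (simp add: horo_fn_def Th_on_def gdist_Theta[of hil "f z"] gdist_0)
  qed
qed

lemma detour_cost_gauge:
  assumes b: "b \<in> S" "f b = 0" and X: "embed hil ` f ` S = range (embed hil)"
    and d: "\<And>s t. s \<in> S \<Longrightarrow> t \<in> S \<Longrightarrow> d s t = gdist hil (f s) (f t)"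
    and k: "k \<in> K hil" and k': "k' \<in> K hil"
  shows "detour_cost d S b (Th_on hil S f k) (Th_on hil S f k') < \<infinity>
    \<longleftrightarrow> (\<exists>b>0. b *\<^sub>R fst k - fst k' \<in> C) \<and> (\<exists>b>0. b *\<^sub>R snd k - snd k' \<in> C)"
proof -
  interpret horo_param d S b "K hil" "range (embed hil)" "\<lambda>s. embed hil (f s)" "Th_on hil S f"
    by (rule horo_param_gauge[OF b X d])
  have "(\<exists>c x. (\<forall>n. x n \<in> S) \<and> (\<lambda>n. embed hil (f (x n))) \<longlonglongrightarrow> k \<and> (\<forall>n. d b (x n) + Th_on hil S f k' (x n) \<le> c))
    \<longleftrightarrow> (\<exists>c y. (\<forall>n. y n \<in> f ` S) \<and> (\<lambda>n. embed hil (y n)) \<longlonglongrightarrow> k \<and> (\<forall>n. gdist hil 0 (y n) + Theta hil k' (y n) \<le> c))"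
  proof
    assume "\<exists>c x. (\<forall>n. x n \<in> S) \<and> (\<lambda>n. embed hil (f (x n))) \<longlonglongrightarrow> k \<and> (\<forall>n. d b (x n) + Th_on hil S f k' (x n) \<le> c)"
    then obtain c x where x: "\<And>n. x n \<in> S" "(\<lambda>n. embed hil (f (x n))) \<longlonglongrightarrow> k"
      "\<And>n. d b (x n) + Th_on hil S f k' (x n) \<le> c" by blast
    have "gdist hil 0 (f (x n)) + Theta hil k' (f (x n)) \<le> c" for n
      using x(3)[of n] x(1)[of n] d[OF b(1) x(1)[of n]] b(2) by (simp add: Th_on_def)
    then show "\<exists>c y. (\<forall>n. y n \<in> f ` S) \<and> (\<lambda>n. embed hil (y n)) \<longlonglongrightarrow> k \<and> (\<forall>n. gdist hil 0 (y n) + Theta hil k' (y n) \<le> c)"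
      using x(1,2) by (intro exI[of _ c] exI[of _ "\<lambda>n. f (x n)"]) simp
  next
    assume "\<exists>c y. (\<forall>n. y n \<in> f ` S) \<and> (\<lambda>n. embed hil (y n)) \<longlonglongrightarrow> k \<and> (\<forall>n. gdist hil 0 (y n) + Theta hil k' (y n) \<le> c)"
    then obtain c y where y: "\<And>n. y n \<in> f ` S" "(\<lambda>n. embed hil (y n)) \<longlonglongrightarrow> k"
      "\<And>n. gdist hil 0 (y n) + Theta hil k' (y n) \<le> c" by blast
    have "\<exists>s\<in>S. y n = f s" for n using y(1)[of n] by blast
    then obtain x where x: "\<And>n. x n \<in> S" "\<And>n. y n = f (x n)" by metis
    have "d b (x n) + Th_on hil S f k' (x n) \<le> c" for n
      using y(3)[of n] x(1)[of n] d[OF b(1) x(1)[of n]] b(2) x(2)[of n] by (simp add: Th_on_def)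
    moreover have "(\<lambda>n. embed hil (f (x n))) \<longlonglongrightarrow> k" using y(2) unfolding x(2) .
    ultimately show "\<exists>c x. (\<forall>n. x n \<in> S) \<and> (\<lambda>n. embed hil (f (x n))) \<longlonglongrightarrow> k \<and> (\<forall>n. d b (x n) + Th_on hil S f k' (x n) \<le> c)"
      using x(1) by blast
  qed
  then show ?thesis unfolding detour_cost_finite_iff[OF k] bounded_iff_order[OF k' k X] .
qed

end

text \<open>Neither \<open>embed\<close> and \<open>K\<close> nor the order criterion in
  \<open>detour_cost_gauge\<close> involves the gauge, so both metrics meet the assumptions of
  \<open>horo_param_transfer\<close> with the same parameters.\<close>

lemma gauge_transfer:
  assumes g1: "gauge m u g1 rel1" and g2: "gauge m u g2 rel2"
    and b1: "b1 \<in> S1" "f1 b1 = 0" and X1: "formally_real_jordan_algebra.embed m u hil ` f1 ` S1 = range (formally_real_jordan_algebra.embed m u hil)"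
    and d1: "\<And>s t. s \<in> S1 \<Longrightarrow> t \<in> S1 \<Longrightarrow> d1 s t = gauge.gdist m u g1 hil (f1 s) (f1 t)"
    and b2: "b2 \<in> S2" "f2 b2 = 0" and X2: "formally_real_jordan_algebra.embed m u hil ` f2 ` S2 = range (formally_real_jordan_algebra.embed m u hil)"
    and d2: "\<And>s t. s \<in> S2 \<Longrightarrow> t \<in> S2 \<Longrightarrow> d2 s t = gauge.gdist m u g2 hil (f2 s) (f2 t)"
    and e: "\<And>s. s \<in> S1 \<Longrightarrow> e s \<in> S2" "\<And>s. s \<in> S1 \<Longrightarrow> f2 (e s) = f1 s"
  shows "\<exists>F G. homeomorphism (horo_compact d1 S1 b1) (horo_compact d2 S2 b2) F G
    \<and> (\<forall>s\<in>S1. F (horo_fn d1 S1 b1 s) = horo_fn d2 S2 b2 (e s))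
    \<and> (\<forall>P\<in>horo_parts d1 S1 b1. F ` P \<in> horo_parts d2 S2 b2)"
proof -
  interpret A: gauge m u g1 rel1 by (rule g1)
  interpret B: gauge m u g2 rel2 by (rule g2)
  note hp1 = A.horo_param_gauge[of b1 S1 f1 hil d1, OF b1 X1 d1]
  note hp2 = B.horo_param_gauge[of b2 S2 f2 hil d2, OF b2 X2 d2]
  have det: "detour_cost d1 S1 b1 (A.Th_on hil S1 f1 k) (A.Th_on hil S1 f1 k') < \<infinity>
      \<longleftrightarrow> detour_cost d2 S2 b2 (B.Th_on hil S2 f2 k) (B.Th_on hil S2 f2 k') < \<infinity>"
    if "k \<in> A.K hil" "k' \<in> A.K hil" for k k'
    using A.detour_cost_gauge[of b1 S1 f1 hil d1, OF b1 X1 d1 that]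
      B.detour_cost_gauge[of b2 S2 f2 hil d2, OF b2 X2 d2 that] by simp
  obtain F G where F: "homeomorphism (horo_compact d1 S1 b1) (horo_compact d2 S2 b2) F G"
    "\<And>k. k \<in> A.K hil \<Longrightarrow> F (A.Th_on hil S1 f1 k) = B.Th_on hil S2 f2 k"
    "\<forall>P\<in>horo_parts d1 S1 b1. F ` P \<in> horo_parts d2 S2 b2"
    using horo_param_transfer[OF hp1 hp2 det] by blast
  have "F (horo_fn d1 S1 b1 s) = horo_fn d2 S2 b2 (e s)" if "s \<in> S1" for s
    using horo_param.Th_horo[OF hp1 that] horo_param.Th_horo[OF hp2 e(1)[OF that]] e(2)[OF that]
      F(2)[OF A.embed_K] by simp
  then show ?thesis using F by blast
qed

section \<open>The norms and cone metrics as instances\<close>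

context formally_real_jordan_algebra
begin

lemma spec_norm_eq: "spec_norm m u x = max (lam_max x) (lam_max (- x))"
proof -
  obtain p l where p: "jframe jrank p" "x = lc jrank p l" by (rule decomp)
  have mx: "- x = lc jrank p (\<lambda>i. - l i)" by (simp add: p sum_negf)
  note n = jframe_nsys[OF p(1)]
  have ne: "{..<jrank} \<noteq> {}" using jrank_pos by auto
  show ?thesis
    unfolding spec_norm_def p(2) jspectrum_lc[OF p(1)] unfolding p(2)[symmetric]
  proof (rule Max_eqI)
    show "finite (abs ` l ` {..<jrank})" by simp
  next
    fix y assume "y \<in> abs ` l ` {..<jrank}"
    then show "y \<le> max (lam_max x) (lam_max (- x))" using eigenvalue_bound[OF n] p(2) by auto
  next
    obtain i where i: "i < jrank" "lam_max x = l i" using lam_max_nsys(2)[OF n, of l] p(2) by blast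
    obtain j where j: "j < jrank" "lam_max (- x) = - l j" using lam_max_nsys(2)[OF n, of "\<lambda>i. - l i"] mx by auto
    have "- lam_max (- x) \<le> lam_max x" by (rule lam_max_neg)
    then have "max (lam_max x) (lam_max (- x)) = \<bar>l i\<bar> \<or> max (lam_max x) (lam_max (- x)) = \<bar>l j\<bar>"
      using i j by linarith
    then show "max (lam_max x) (lam_max (- x)) \<in> abs ` l ` {..<jrank}" using i(1) j(1) by (metis imageI lessThan_iff)
  qed
qed

lemma var_norm_eq: "var_norm m u x = lam_max x + lam_max (- x)"
proof -
  obtain p l where p: "jframe jrank p" "x = lc jrank p l" by (rule decomp)
  have mx: "- x = lc jrank p (\<lambda>i. - l i)" by (simp add: p sum_negf)
  note n = jframe_nsys[OF p(1)]
  have "Min (l ` {..<jrank}) = - lam_max (- x)"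
  proof (rule Min_eqI)
    fix y assume "y \<in> l ` {..<jrank}"
    then show "- lam_max (- x) \<le> y" using lam_max_nsys(1)[OF n, of _ "\<lambda>i. - l i"] mx by force
  next
    obtain j where j: "j < jrank" "lam_max (- x) = - l j" using lam_max_nsys(2)[OF n, of "\<lambda>i. - l i"] mx by auto
    then show "- lam_max (- x) \<in> l ` {..<jrank}" by simp
  qed simp
  then show ?thesis
    using lam_max_lc[OF p(1), of l] unfolding var_norm_def p(2) jspectrum_lc[OF p(1)] unfolding p(2)[symmetric] by simp
qed

lemma gdist_norm:
  "gauge.gdist m u norm_gauge hil x y = (if hil then var_norm m u (x - y) else spec_norm m u (x - y))"
proof -
  interpret N: gauge m u norm_gauge "\<lambda>b Y Y'. \<forall>v\<in>states. Q v Y \<le> b * Q v Y'" by (rule gauge_norm)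
  have "ln (max (exp a) (exp c)) = max a c" for a c :: real by (simp add: max_def)
  then show ?thesis
    by (simp add: N.gdist_def combine_def norm_gauge_fexp var_norm_eq spec_norm_eq ln_mult_pos)
qed

lemma gdist_Thompson:
  "gauge.gdist m u (\<lambda>Y z. Mfun m Y (fexp z)) hil x y
    = (if hil then hilbert_dist m (fexp x) (fexp y) else thompson_dist m (fexp x) (fexp y))"
proof -
  interpret T: gauge m u "\<lambda>Y z. Mfun m Y (fexp z)" "\<lambda>b Y Y'. b *\<^sub>R Y' - Y \<in> C" by (rule gauge_Thompson)
  have "0 < Mfun m (fexp a) (fexp c)" for a c by (rule Mfun_pos[OF fexp_C fexp_nonzero])
  moreover have "ln (max a c) = max (ln a) (ln c)" if "0 < a" "0 < c" for a c :: real
    using that by (simp add: max_def)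
  ultimately show ?thesis
    by (simp add: T.gdist_def combine_def hilbert_dist_def thompson_dist_def ln_mult_pos)
qed

lemma zero_tangent: "0 \<in> tangent_space m u"
proof -
  obtain p l where p: "jframe jrank p" "(0::'a) = lc jrank p l" by (rule decomp)
  have "jtrace m u (lc jrank p (\<lambda>_. 0)) = 0" unfolding jtrace_lc[OF p(1)] by simp
  then show ?thesis by (simp add: tangent_space_def)
qed

text \<open>In part (b) the shifts absorb any multiple of \<open>u\<close> added to
  \<open>x\<close>, so each image is already attained at an element of trace 0.\<close>

lemma embed_tangent: "embed True ` tangent_space m u = range (embed True)"
proof
  show "range (embed True) \<subseteq> embed True ` tangent_space m u"
  proof
    fix k assume "k \<in> range (embed True)"
    then obtain x where x: "k = embed True x" by blast
    \<comment> \<open>Adding \<open>c *\<^sub>R u\<close> changes the trace by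
      \<open>c * real jrank\<close>, so this choice cancels it.\<close>
    define c where "c = - jtrace m u x / real jrank"
    have "x + c *\<^sub>R u \<in> tangent_space m u"
      using jrank_pos jtrace_shift[of x c] by (simp add: tangent_space_def c_def)
    moreover have "embed True (x + c *\<^sub>R u) = embed True x"
    proof -
      have "- (x + c *\<^sub>R u) = - x + (- c) *\<^sub>R u" by simp
      then have "lam_max (- (x + c *\<^sub>R u)) = lam_max (- x) - c" using lam_max_shift[of "- x" "- c"] by simp
      then have "- (x + c *\<^sub>R u) - lam_max (- (x + c *\<^sub>R u)) *\<^sub>R u = - x - lam_max (- x) *\<^sub>R u"
        by (simp add: scaleR_diff_left)
      moreover have "(x + c *\<^sub>R u) - lam_max (x + c *\<^sub>R u) *\<^sub>R u = x - lam_max x *\<^sub>R u"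
        by (simp add: lam_max_shift scaleR_add_left)
      ultimately show ?thesis unfolding embed_def shift1_def shift2_def by (simp only: if_True)
    qed
    ultimately show "k \<in> embed True ` tangent_space m u" using x by (metis imageI)
  qed
qed blast

lemma proj_cone_int_eq: "proj_cone_int m u = fexp ` tangent_space m u"
  unfolding proj_cone_int_def jcone_int_fexp tangent_space_def by (auto simp: jdet_fexp)

end

theorem theorem1p1:
  fixes m :: "'a::euclidean_space \<Rightarrow> 'a \<Rightarrow> 'a" and u :: 'a
  assumes "formally_real_jordan m u"
  shows
    "(\<exists>F G. homeomorphism
              (horo_compact (\<lambda>x y. spec_norm m u (x - y)) UNIV 0)
              (horo_compact (thompson_dist m) (jcone_int m) u) F G \<and>
            (\<forall>x. F (horo_fn (\<lambda>x y. spec_norm m u (x - y)) UNIV 0 x)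
                 = horo_fn (thompson_dist m) (jcone_int m) u (jexp m u x)) \<and>
            (\<forall>P \<in> horo_parts (\<lambda>x y. spec_norm m u (x - y)) UNIV 0.
                 F ` P \<in> horo_parts (thompson_dist m) (jcone_int m) u))
     \<and>
     (\<exists>F G. homeomorphism
              (horo_compact (\<lambda>x y. var_norm m u (x - y)) (tangent_space m u) 0)
              (horo_compact (hilbert_dist m) (proj_cone_int m u) u) F G \<and>
            (\<forall>x \<in> tangent_space m u.
                 F (horo_fn (\<lambda>x y. var_norm m u (x - y)) (tangent_space m u) 0 x)
                 = horo_fn (hilbert_dist m) (proj_cone_int m u) u (jexp m u x)) \<and>
            (\<forall>P \<in> horo_parts (\<lambda>x y. var_norm m u (x - y)) (tangent_space m u) 0.
                 F ` P \<in> horo_parts (hilbert_dist m) (proj_cone_int m u) u))"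
proof -
  interpret formally_real_jordan_algebra m u by (unfold_locales) (rule assms)
  have lgu: "flog u = 0" using flog_fexp[of 0] by (simp add: fexp_0)
  have u_mem: "u \<in> jcone_int m" "u \<in> proj_cone_int m u"
    unfolding jcone_int_fexp proj_cone_int_eq using fexp_0 zero_tangent by (metis rangeI, metis imageI)
  have flog_img: "flog ` jcone_int m = UNIV" "flog ` proj_cone_int m u = tangent_space m u"
    unfolding jcone_int_fexp proj_cone_int_eq image_image by simp_all
  have dT: "thompson_dist m s t = gauge.gdist m u (\<lambda>Y z. Mfun m Y (fexp z)) False (flog s) (flog t)"
    if "s \<in> jcone_int m" "t \<in> jcone_int m" for s t
    using that fexp_flog by (simp add: gdist_Thompson jcone_int_fexp)
  have dH: "hilbert_dist m s t = gauge.gdist m u (\<lambda>Y z. Mfun m Y (fexp z)) True (flog s) (flog t)"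
    if "s \<in> proj_cone_int m u" "t \<in> proj_cone_int m u" for s t
  proof -
    have "fexp (flog s) = s" "fexp (flog t) = t" using that unfolding proj_cone_int_eq by auto
    then show ?thesis by (simp add: gdist_Thompson)
  qed
  show ?thesis
  proof (rule conjI)
    show "\<exists>F G. homeomorphism
              (horo_compact (\<lambda>x y. spec_norm m u (x - y)) UNIV 0)
              (horo_compact (thompson_dist m) (jcone_int m) u) F G \<and>
            (\<forall>x. F (horo_fn (\<lambda>x y. spec_norm m u (x - y)) UNIV 0 x)
                 = horo_fn (thompson_dist m) (jcone_int m) u (jexp m u x)) \<and>
            (\<forall>P \<in> horo_parts (\<lambda>x y. spec_norm m u (x - y)) UNIV 0.
                 F ` P \<in> horo_parts (thompson_dist m) (jcone_int m) u)"
      using gauge_transfer[OF gauge_norm gauge_Thompson, of 0 UNIV id False "\<lambda>x y. spec_norm m u (x - y)"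
          u "jcone_int m" flog "thompson_dist m" fexp]
        u_mem(1) lgu flog_img(1) dT
      by (simp add: gdist_norm jexp_eq jcone_int_fexp)
    show "\<exists>F G. homeomorphism
              (horo_compact (\<lambda>x y. var_norm m u (x - y)) (tangent_space m u) 0)
              (horo_compact (hilbert_dist m) (proj_cone_int m u) u) F G \<and>
            (\<forall>x \<in> tangent_space m u.
                 F (horo_fn (\<lambda>x y. var_norm m u (x - y)) (tangent_space m u) 0 x)
                 = horo_fn (hilbert_dist m) (proj_cone_int m u) u (jexp m u x)) \<and>
            (\<forall>P \<in> horo_parts (\<lambda>x y. var_norm m u (x - y)) (tangent_space m u) 0.
                 F ` P \<in> horo_parts (hilbert_dist m) (proj_cone_int m u) u)"
      using gauge_transfer[OF gauge_norm gauge_Thompson, of 0 "tangent_space m u" id True "\<lambda>x y. var_norm m u (x - y)"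
          u "proj_cone_int m u" flog "hilbert_dist m" fexp]
        u_mem(2) lgu flog_img(2) dH zero_tangent embed_tangent
      by (simp add: gdist_norm jexp_eq proj_cone_int_eq)
  qed
qed

end
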